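(* Let $\star\in\{\mathsf T,\mathsf H\}$ and consider a nonsingular system $$\left\{\begin{array}{ll} A_kX_kB_k-C_kX_{k+1}D_k=E_k, & k=1,\dots,r-1,\\ A_rX_rB_r-C_rX_1^\star D_r=E_r,\end{array}\right.$$ with $n\times n$ complex coefficients, with $A_k,C_k,B_k^{\mathsf T},D_k^{\mathsf T}$ upper triangular for $k=1,\dots,r$. Let $M\mathcal X=\mathcal E$ be its vectorized form, where $M\in\mathbb{C}^{rn^2\times rn^2}$ if $\star=\mathsf T$, or $M\in\mathbb{R}^{2rn^2\times2rn^2}$ if $\star=\mathsf H$. When implemented in standard floating-point arithmetic, the block back substitution algorithm described in the context produces a result $\widetilde{\mathcal X}$ satisfying $$(M+\delta M)\widetilde{\mathcal X}=\mathcal E+\delta\mathcal E,$$ with $$\frac{\|\delta M\|_2}{\|M\|_2}\le r\,\gamma_r+\gamma_{n^2}(1+r\,\gamma_r),\qquad \frac{\|\delta\mathcal E\|_2}{\|\mathcal E\|_2}\le\gamma_{n^2}.$$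
   Context: $\mathsf T$ is transpose, $\mathsf H$ conjugate transpose. A system is nonsingular if it has a unique solution for every right-hand side. Convention: $X_{r+1}:=X_1^\star$. Vectorized form. If $\star=\mathsf T$, $\mathcal X$ and $\mathcal E$ stack $\mathrm{vec}\,X_1,\dots,\mathrm{vec}\,X_r$ and $\mathrm{vec}\,E_1,\dots,\mathrm{vec}\,E_r$, and $M$ is the matrix of the resulting complex linear system (vec stacks columns). If $\star=\mathsf H$, the system is written as a real linear system in the real and imaginary parts of the entries of the $X_k$. Floating point. The standard floating point model with unit roundoff $u$ is used, and $\gamma_k:=\dfrac{cku}{1-cku}$, where $c$ denotes a small constant whose exact value is not specified. The algorithm. Initialize $X_k,X_k^B,X_k^D$ ($k=1,\dots,r$) to zero $n\times n$ matrices. Order the pairs $(i,j)$ with $1\le j\le i\le n$ as $(1,1),(2,1),(2,2),(3,1),(3,2),(3,3),\dots,(n,1),\dots,(n,n)$, and process them in the reverse order. For each pair $(i,j)$: (1) For $k=1,\dots,r$ compute $$v_{ijk}=\sum_{\substack{s\ge i,\,t\ge j\\(s,t)\ne(i,j)}}\bigl((A_k)_{is}(X_k)_{st}(B_k)_{tj}-(C_k)_{is}(X_{k+1})_{st}(D_k)_{tj}\bigr)$$ (and also $v_{jik}$ if $i\ne j$), which only involves already computed entries, in the form $$\Bigl(\sum_{t>j}(A_k)_{ii}(X_k)_{it}(B_k)_{tj}+\sum_{s>i}(A_k)_{is}(X_k^B)_{sj}\Bigr)-\Bigl(\sum_{t>j}(C_k)_{ii}(X_{k+1})_{it}(D_k)_{tj}+\sum_{s>i}(C_k)_{is}(X_k^D)_{sj}\Bigr).$$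 (2) Solve the small system $$(A_k)_{ii}(B_k)_{jj}(X_k)_{ij}-(C_k)_{ii}(D_k)_{jj}(X_{k+1})_{ij}=(E_k)_{ij}-v_{ijk},\qquad k=1,\dots,r,$$ together, if $i\ne j$, with the same equations with $i$ and $j$ exchanged. For $\star=\mathsf T$ one has $(X_{r+1})_{ij}=(X_1)_{ji}$, and this is a linear system of size $r$ (if $i=j$) or $2r$ (if $i\ne j$) in the unknowns $(X_k)_{ij},(X_k)_{ji}$; the order of unknowns and equations is $(i,j)$ for $k=1,\dots,r$ and then $(j,i)$ for $k=1,\dots,r$, so that its matrix is upper bidiagonal except for the bottom-left entry. It is solved by a QR factorization: successive plane rotations acting on row $q$ and the last row, $q=1,2,\dots$, annihilate the entry in position (last row, $q$), leaving an upper triangular matrix that is bidiagonal except for its last column; the same rotations are applied to the right-hand side, and the triangular system is solved by back substitution. For $\star=\mathsf H$ one has $(X_{r+1})_{ij}=\overline{(X_1)_{ji}}$, and the small system is rewritten over $\mathbb{R}$ in the real and imaginary parts of the unknowns: a coefficient $a$ multiplying $x$ becomes $\left[\begin{smallmatrix}\mathrm{re}\,a&-\mathrm{im}\,a\\ \mathrm{im}\,a&\mathrm{re}\,a\end{smallmatrix}\right]$ and a coefficient $a$ multiplying $\overline x$ becomes $\left[\begin{smallmatrix}\mathrm{re}\,a&\mathrm{im}\,a\\ \mathrm{im}\,a&-\mathrm{re}\,a\end{smallmatrix}\right]$; the matrix is block bidiagonal with $2\times2$ blocks apart from the bottom-left block, and the system is solved in the same way, by reduction to (block bidiagonal, except for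 the last block column) upper triangular form with $O(r)$ plane rotations, and back substitution. (3) Store the computed entries $(X_k)_{ij}$ (and $(X_k)_{ji}$) for all $k$, and compute and store $(X_k^B)_{ij}=\sum_{t\ge j}(X_k)_{it}(B_k)_{tj}$ and $(X_k^D)_{ij}=\sum_{t\ge j}(X_{k+1})_{it}(D_k)_{tj}$ (and the same with $i,j$ exchanged if $i\ne j$). The output $\widetilde{\mathcal X}$ is the vector (in the same format as $\mathcal X$) of computed entries of the $X_k$.
   Formalization: For ⋆ = T the formal statement assumes r ≥ 2, since for r = 1 cancellation between the two products makes the claim false (n=1, A=B=C=1, D=1−u, E=1, with AB rounded to 1+u); it concerns runs that meet no division by zero, with c·r·u < 1 and c·n²·u < 1. *)

theory Defs
  imports
    Complex_Main
    "HOL-Library.FuncSet"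
    "Jordan_Normal_Form.Matrix"
    "Jordan_Normal_Form.Conjugate"
begin

text \<open>
  Everything is indexed from 0: matrix entries by \<open>i, j < n\<close> and equations by \<open>k < r\<close>,
  so that the convention for the last equation reads \<open>X\<^sub>r = X\<^sub>0\<^sup>\<star>\<close>.
\<close>

section \<open>The system and its vectorized form\<close>

datatype star = Transp | ConjTransp

fun star_mat :: "star \<Rightarrow> complex mat \<Rightarrow> complex mat" where
  "star_mat Transp X = transpose_mat X"
| "star_mat ConjTransp X = map_mat cnj (transpose_mat X)"

definition next_mat :: "star \<Rightarrow> nat \<Rightarrow> (nat \<Rightarrow> complex mat) \<Rightarrow> nat \<Rightarrow> complex mat" where
  "next_mat st r X k = (if Suc k = r then star_mat st (X 0) else X (Suc k))"

definition sylv_op ::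
  "star \<Rightarrow> nat \<Rightarrow> (nat \<Rightarrow> complex mat) \<Rightarrow> (nat \<Rightarrow> complex mat) \<Rightarrow> (nat \<Rightarrow> complex mat)
    \<Rightarrow> (nat \<Rightarrow> complex mat) \<Rightarrow> (nat \<Rightarrow> complex mat) \<Rightarrow> nat \<Rightarrow> complex mat" where
  "sylv_op st r A B C D X k = A k * X k * B k - C k * next_mat st r X k * D k"

definition nonsingular_system ::
  "star \<Rightarrow> nat \<Rightarrow> nat \<Rightarrow> (nat \<Rightarrow> complex mat) \<Rightarrow> (nat \<Rightarrow> complex mat) \<Rightarrow> (nat \<Rightarrow> complex mat)
    \<Rightarrow> (nat \<Rightarrow> complex mat) \<Rightarrow> bool" where
  "nonsingular_system st r n A B C D \<longleftrightarrow>
     (\<forall>E \<in> {..<r} \<rightarrow>\<^sub>E carrier_mat n n. \<exists>!X. X \<in> {..<r} \<rightarrow>\<^sub>E carrier_mat n n \<and>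
        (\<forall>k<r. sylv_op st r A B C D X k = E k))"

definition vecs :: "nat \<Rightarrow> nat \<Rightarrow> (nat \<Rightarrow> complex mat) \<Rightarrow> complex vec" where
  "vecs r n X = vec (r * n\<^sup>2) (\<lambda>p. X (p div n\<^sup>2) $$ (p mod n, p mod n\<^sup>2 div n))"

definition unvecs :: "nat \<Rightarrow> complex vec \<Rightarrow> nat \<Rightarrow> complex mat" where
  "unvecs n x k = mat n n (\<lambda>(i, j). x $ (k * n\<^sup>2 + j * n + i))"

text \<open>The real format interleaves the real and imaginary parts of the entries.\<close>

definition realify :: "complex vec \<Rightarrow> real vec" where
  "realify x = vec (2 * dim_vec x)
     (\<lambda>p. if even p then Re (x $ (p div 2)) else Im (x $ (p div 2)))"

definition complexify :: "real vec \<Rightarrow> complex vec" where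
  "complexify x = vec (dim_vec x div 2) (\<lambda>p. Complex (x $ (2 * p)) (x $ (2 * p + 1)))"

text \<open>Matrix of a linear endomorphism in the standard basis: column \<open>q\<close> is the image of
  the \<open>q\<close>-th unit vector.\<close>

definition matrix_of :: "nat \<Rightarrow> ('a::semiring_1 vec \<Rightarrow> 'a vec) \<Rightarrow> 'a mat" where
  "matrix_of N f = mat N N (\<lambda>(p, q). f (unit_vec N q) $ p)"

definition system_matrix_T ::
  "nat \<Rightarrow> nat \<Rightarrow> (nat \<Rightarrow> complex mat) \<Rightarrow> (nat \<Rightarrow> complex mat) \<Rightarrow> (nat \<Rightarrow> complex mat)
    \<Rightarrow> (nat \<Rightarrow> complex mat) \<Rightarrow> complex mat" where
  "system_matrix_T r n A B C D =
     matrix_of (r * n\<^sup>2) (\<lambda>x. vecs r n (sylv_op Transp r A B C D (unvecs n x)))"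

definition system_matrix_H ::
  "nat \<Rightarrow> nat \<Rightarrow> (nat \<Rightarrow> complex mat) \<Rightarrow> (nat \<Rightarrow> complex mat) \<Rightarrow> (nat \<Rightarrow> complex mat)
    \<Rightarrow> (nat \<Rightarrow> complex mat) \<Rightarrow> real mat" where
  "system_matrix_H r n A B C D =
     matrix_of (2 * r * n\<^sup>2)
       (\<lambda>x. realify (vecs r n (sylv_op ConjTransp r A B C D (unvecs n (complexify x)))))"

section \<open>Euclidean and spectral norms\<close>

definition vec_norm2 :: "'a::real_normed_vector vec \<Rightarrow> real" where
  "vec_norm2 x = sqrt (\<Sum>i<dim_vec x. (norm (x $ i))\<^sup>2)"

definition mat_norm2 :: "'a::real_normed_field mat \<Rightarrow> real" where
  "mat_norm2 M = (SUP x \<in> {x \<in> carrier_vec (dim_col M). vec_norm2 x \<le> 1}. vec_norm2 (M *\<^sub>v x))"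

section \<open>Floating point arithmetic\<close>

text \<open>
  The operations are relations: \<open>fl_add \<epsilon> x y z\<close> says that \<open>z\<close> is an admissible computed value
  of \<open>x + y\<close> under the standard model with relative error at most \<open>\<epsilon>\<close>.  Division requires a
  nonzero divisor, so an execution that breaks down produces no result.
  Real operations have \<open>\<epsilon> = u\<close>; a complex operation carried out in real arithmetic satisfies
  the same model with \<open>\<epsilon> = \<kappa> * u\<close>, where \<open>\<kappa>\<close> depends only on how it is implemented.
\<close>

definition fl_round :: "real \<Rightarrow> 'a::real_normed_field \<Rightarrow> 'a \<Rightarrow> bool" where
  "fl_round \<epsilon> x z \<longleftrightarrow> (\<exists>\<delta>. norm \<delta> \<le> \<epsilon> \<and> z = x * (1 + \<delta>))"

definition fl_add :: "real \<Rightarrow> 'a::real_normed_field \<Rightarrow> 'a \<Rightarrow> 'a \<Rightarrow> bool" where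
  "fl_add \<epsilon> x y = fl_round \<epsilon> (x + y)"

definition fl_sub :: "real \<Rightarrow> 'a::real_normed_field \<Rightarrow> 'a \<Rightarrow> 'a \<Rightarrow> bool" where
  "fl_sub \<epsilon> x y = fl_round \<epsilon> (x - y)"

definition fl_mul :: "real \<Rightarrow> 'a::real_normed_field \<Rightarrow> 'a \<Rightarrow> 'a \<Rightarrow> bool" where
  "fl_mul \<epsilon> x y = fl_round \<epsilon> (x * y)"

definition fl_div :: "real \<Rightarrow> 'a::real_normed_field \<Rightarrow> 'a \<Rightarrow> 'a \<Rightarrow> bool" where
  "fl_div \<epsilon> x y z \<longleftrightarrow> y \<noteq> 0 \<and> fl_round \<epsilon> (x / y) z"

definition fl_mul3 :: "real \<Rightarrow> 'a::real_normed_field \<Rightarrow> 'a \<Rightarrow> 'a \<Rightarrow> 'a \<Rightarrow> bool" where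
  "fl_mul3 \<epsilon> x y z w \<longleftrightarrow> (\<exists>v. fl_mul \<epsilon> x y v \<and> fl_mul \<epsilon> v z w)"

text \<open>Summation of \<open>f t\<close>, \<open>t \<in> I\<close>, in an arbitrary order and with arbitrary bracketing.\<close>

inductive fl_sum :: "real \<Rightarrow> ('i \<Rightarrow> 'a::real_normed_field) \<Rightarrow> 'i set \<Rightarrow> 'a \<Rightarrow> bool"
  for \<epsilon> f where
  empty: "fl_sum \<epsilon> f {} 0"
| single: "fl_sum \<epsilon> f {t} (f t)"
| join: "fl_sum \<epsilon> f I x \<Longrightarrow> fl_sum \<epsilon> f J y \<Longrightarrow> I \<noteq> {} \<Longrightarrow> J \<noteq> {} \<Longrightarrow> I \<inter> J = {} \<Longrightarrow>
    fl_add \<epsilon> x y z \<Longrightarrow> fl_sum \<epsilon> f (I \<union> J) z"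

text \<open>The same for summands that are themselves computed: \<open>F t\<close> is the set of admissible
  values of the \<open>t\<close>-th summand.\<close>

definition fl_sum_of ::
  "real \<Rightarrow> ('i \<Rightarrow> 'a::real_normed_field \<Rightarrow> bool) \<Rightarrow> 'i set \<Rightarrow> 'a \<Rightarrow> bool" where
  "fl_sum_of \<epsilon> F I z \<longleftrightarrow> (\<exists>f. (\<forall>t\<in>I. F t (f t)) \<and> fl_sum \<epsilon> f I z)"

definition gamma_const :: "real \<Rightarrow> real \<Rightarrow> nat \<Rightarrow> real" where
  "gamma_const c u k = c * real k * u / (1 - c * real k * u)"

fun run :: "('i \<Rightarrow> 's \<Rightarrow> 's \<Rightarrow> bool) \<Rightarrow> 'i list \<Rightarrow> 's \<Rightarrow> 's \<Rightarrow> bool" where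
  "run R [] s t \<longleftrightarrow> t = s"
| "run R (x # xs) s t \<longleftrightarrow> (\<exists>s'. R x s s' \<and> run R xs s' t)"

section \<open>Solution of the small systems\<close>

text \<open>
  Computed plane rotation \<open>[cnj c, cnj s; -s, c]\<close> taking \<open>(a, b)\<close> to \<open>(\<rho>, 0)\<close>, with
  \<open>\<rho> = sqrt (\<bar>a\<bar>\<^sup>2 + \<bar>b\<bar>\<^sup>2)\<close>, \<open>c = a / \<rho>\<close>, \<open>s = b / \<rho>\<close>.  Squared moduli count as one operation.
\<close>

definition fl_rotation :: "real \<Rightarrow> 'a::real_normed_field \<Rightarrow> 'a \<Rightarrow> 'a \<Rightarrow> 'a \<Rightarrow> bool" where
  "fl_rotation \<epsilon> a b c s \<longleftrightarrow>
     (\<exists>\<alpha> \<beta> \<sigma> \<rho> :: real. fl_round \<epsilon> ((norm a)\<^sup>2) \<alpha> \<and> fl_round \<epsilon> ((norm b)\<^sup>2) \<beta> \<and>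
        fl_add \<epsilon> \<alpha> \<beta> \<sigma> \<and> fl_round \<epsilon> (sqrt \<sigma>) \<rho> \<and>
        fl_div \<epsilon> a (of_real \<rho>) c \<and> fl_div \<epsilon> b (of_real \<rho>) s)"

definition fl_lincomb2 :: "real \<Rightarrow> 'a::real_normed_field \<Rightarrow> 'a \<Rightarrow> 'a \<Rightarrow> 'a \<Rightarrow> 'a \<Rightarrow> bool" where
  "fl_lincomb2 \<epsilon> a x b y z \<longleftrightarrow>
     (\<exists>v w. fl_mul \<epsilon> a x v \<and> fl_mul \<epsilon> b y w \<and> fl_add \<epsilon> v w z)"

text \<open>
  Annihilation of the entry \<open>(q, p)\<close> of an augmented matrix (the last column is the right-hand
  side) by a rotation of the rows \<open>p\<close> and \<open>q\<close>; nothing is done if the entry is already zero.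
\<close>

definition fl_annihilate ::
  "real \<Rightarrow> nat \<times> nat \<Rightarrow> 'a::{real_normed_field,conjugatable_field} mat \<Rightarrow> 'a mat \<Rightarrow> bool" where
  "fl_annihilate \<epsilon> = (\<lambda>(p, q) W W'.
     if W $$ (q, p) = 0 then W' = W
     else W' \<in> carrier_mat (dim_row W) (dim_col W) \<and>
       (\<exists>c s. fl_rotation \<epsilon> (W $$ (p, p)) (W $$ (q, p)) c s \<and>
         (\<forall>j < dim_col W.
            fl_lincomb2 \<epsilon> (conjugate c) (W $$ (p, j)) (conjugate s) (W $$ (q, j)) (W' $$ (p, j)) \<and>
            (if j = p then W' $$ (q, j) = 0
             else fl_lincomb2 \<epsilon> (- s) (W $$ (p, j)) c (W $$ (q, j)) (W' $$ (q, j))) \<and>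
            (\<forall>i < dim_row W. i \<noteq> p \<longrightarrow> i \<noteq> q \<longrightarrow> W' $$ (i, j) = W $$ (i, j)))))"

text \<open>
  Entries to be annihilated in an \<open>m \<times> m\<close> matrix that is block upper bidiagonal with
  \<open>b \<times> b\<close> blocks (\<open>b = 1\<close> or \<open>b = 2\<close>) except for the bottom-left block: below the diagonal,
  column \<open>p\<close> is filled only inside its diagonal block and in the last \<open>b\<close> rows.
\<close>

definition rotation_list :: "nat \<Rightarrow> nat \<Rightarrow> (nat \<times> nat) list" where
  "rotation_list b m = [(p, q). p \<leftarrow> [0..<m], q \<leftarrow> [p+1..<m], q div b = p div b \<or> m \<le> q + b]"

text \<open>Back substitution, for an upper triangular matrix that is block bidiagonal except for its
  last block column.\<close>

definition fl_back_subst ::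
  "nat \<Rightarrow> real \<Rightarrow> nat \<Rightarrow> 'a::real_normed_field mat \<Rightarrow> (nat \<Rightarrow> 'a) \<Rightarrow> bool" where
  "fl_back_subst b \<epsilon> m W x \<longleftrightarrow>
     (\<forall>i<m. \<exists>v w.
        fl_sum_of \<epsilon> (\<lambda>j. fl_mul \<epsilon> (W $$ (i, j)) (x j))
          {j. i < j \<and> j < m \<and> (j div b \<le> i div b + 1 \<or> m \<le> j + b)} v \<and>
        fl_sub \<epsilon> (W $$ (i, m)) v w \<and> fl_div \<epsilon> w (W $$ (i, i)) (x i))"

definition fl_small_solve ::
  "nat \<Rightarrow> real \<Rightarrow> nat \<Rightarrow> 'a::{real_normed_field,conjugatable_field} mat \<Rightarrow> (nat \<Rightarrow> 'a) \<Rightarrow> bool"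
  where
  "fl_small_solve b \<epsilon> m W x \<longleftrightarrow>
     (\<exists>W'. run (fl_annihilate \<epsilon>) (rotation_list b m) W W' \<and> fl_back_subst b \<epsilon> m W' x)"

text \<open>
  Augmented matrix of the small system
  \<open>p\<^sub>q x\<^sub>q - g\<^sub>q x\<^sub>q\<^sub>+\<^sub>1 = b\<^sub>q\<close>, \<open>q < N\<close>, with \<open>x\<^sub>N = x\<^sub>0\<close>.
  For \<open>N = 1\<close> both coefficients fall on the same entry and their difference is computed.
\<close>

definition fl_system_T ::
  "real \<Rightarrow> nat \<Rightarrow> (nat \<Rightarrow> complex) \<Rightarrow> (nat \<Rightarrow> complex) \<Rightarrow> (nat \<Rightarrow> complex) \<Rightarrow> complex mat \<Rightarrow> bool"
  where
  "fl_system_T \<epsilon> N p g b W \<longleftrightarrow> W \<in> carrier_mat N (N + 1) \<and>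
     (\<forall>q<N. W $$ (q, N) = b q \<and>
        (\<forall>l<N. if l = q \<and> l = (q + 1) mod N then fl_sub \<epsilon> (p q) (g q) (W $$ (q, l))
               else W $$ (q, l) =
                 (if l = q then p q else if l = (q + 1) mod N then - g q else 0)))"

text \<open>The \<open>2 \<times> 2\<close> real blocks of a coefficient multiplying \<open>x\<close> and \<open>cnj x\<close>, respectively.\<close>

definition lin_block :: "complex \<Rightarrow> nat \<Rightarrow> nat \<Rightarrow> real" where
  "lin_block a i j =
     (if i = 0 then (if j = 0 then Re a else - Im a) else (if j = 0 then Im a else Re a))"

definition cnj_block :: "complex \<Rightarrow> nat \<Rightarrow> nat \<Rightarrow> real" where
  "cnj_block a i j =
     (if i = 0 then (if j = 0 then Re a else Im a) else (if j = 0 then Im a else - Re a))"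

text \<open>As above over the reals; \<open>x\<^sub>q\<^sub>+\<^sub>1\<close> is conjugated in the equations \<open>q \<in> K\<close>.\<close>

definition fl_system_H ::
  "real \<Rightarrow> nat \<Rightarrow> nat set \<Rightarrow> (nat \<Rightarrow> complex) \<Rightarrow> (nat \<Rightarrow> complex) \<Rightarrow> (nat \<Rightarrow> complex)
    \<Rightarrow> real mat \<Rightarrow> bool" where
  "fl_system_H \<epsilon> N K p g b W \<longleftrightarrow> W \<in> carrier_mat (2 * N) (2 * N + 1) \<and>
     (\<forall>q<N. W $$ (2 * q, 2 * N) = Re (b q) \<and> W $$ (2 * q + 1, 2 * N) = Im (b q) \<and>
        (\<forall>l<N. \<forall>i<2. \<forall>j<2.
           let P = lin_block (p q) i j;
               G = (if q \<in> K then cnj_block (- g q) i j else lin_block (- g q) i j)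
           in if l = q \<and> l = (q + 1) mod N then fl_add \<epsilon> P G (W $$ (2 * q + i, 2 * l + j))
              else W $$ (2 * q + i, 2 * l + j) =
                (if l = q then P else if l = (q + 1) mod N then G else 0)))"

section \<open>The block back substitution algorithm\<close>

text \<open>The state consists of the families \<open>X\<^sub>k\<close>, \<open>X\<^sub>k\<^sup>B\<close>, \<open>X\<^sub>k\<^sup>D\<close>.\<close>

type_synonym bbs_state = "(nat \<Rightarrow> complex mat) \<times> (nat \<Rightarrow> complex mat) \<times> (nat \<Rightarrow> complex mat)"

definition fl_v ::
  "star \<Rightarrow> real \<Rightarrow> nat \<Rightarrow> nat \<Rightarrow> (nat \<Rightarrow> complex mat) \<Rightarrow> (nat \<Rightarrow> complex mat)
    \<Rightarrow> (nat \<Rightarrow> complex mat) \<Rightarrow> (nat \<Rightarrow> complex mat) \<Rightarrow> bbs_state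
    \<Rightarrow> nat \<Rightarrow> nat \<Rightarrow> nat \<Rightarrow> complex \<Rightarrow> bool" where
  "fl_v st \<epsilon> r n A B C D = (\<lambda>(X, XB, XD) i j k v.
     \<exists>s1 s2 s3 s4 y z.
       fl_sum_of \<epsilon> (\<lambda>t. fl_mul3 \<epsilon> (A k $$ (i, i)) (X k $$ (i, t)) (B k $$ (t, j))) {j<..<n} s1 \<and>
       fl_sum_of \<epsilon> (\<lambda>s. fl_mul \<epsilon> (A k $$ (i, s)) (XB k $$ (s, j))) {i<..<n} s2 \<and>
       fl_add \<epsilon> s1 s2 y \<and>
       fl_sum_of \<epsilon>
         (\<lambda>t. fl_mul3 \<epsilon> (C k $$ (i, i)) (next_mat st r X k $$ (i, t)) (D k $$ (t, j))) {j<..<n} s3 \<and>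
       fl_sum_of \<epsilon> (\<lambda>s. fl_mul \<epsilon> (C k $$ (i, s)) (XD k $$ (s, j))) {i<..<n} s4 \<and>
       fl_add \<epsilon> s3 s4 z \<and>
       fl_sub \<epsilon> y z v)"

text \<open>
  One pass of the main loop.  Unknown (and equation) number \<open>q\<close> of the small system is the
  entry at position \<open>P ! (q div r)\<close> of the matrix with index \<open>q mod r\<close>.
\<close>

definition fl_step ::
  "star \<Rightarrow> real \<Rightarrow> real \<Rightarrow> nat \<Rightarrow> nat \<Rightarrow> (nat \<Rightarrow> complex mat) \<Rightarrow> (nat \<Rightarrow> complex mat)
    \<Rightarrow> (nat \<Rightarrow> complex mat) \<Rightarrow> (nat \<Rightarrow> complex mat) \<Rightarrow> (nat \<Rightarrow> complex mat)
    \<Rightarrow> nat \<times> nat \<Rightarrow> bbs_state \<Rightarrow> bbs_state \<Rightarrow> bool" where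
  "fl_step st \<kappa> u r n A B C D E = (\<lambda>(i, j) (X, XB, XD) (X', XB', XD').
     let P = (if i = j then [(i, j)] else [(i, j), (j, i)]);
         N = r * length P;
         \<epsilon> = \<kappa> * u
     in \<exists>v p g b x.
       (\<forall>q<N. let k = q mod r; a = fst (P ! (q div r)); d = snd (P ! (q div r)) in
          fl_v st \<epsilon> r n A B C D (X, XB, XD) a d k (v q) \<and>
          fl_mul \<epsilon> (A k $$ (a, a)) (B k $$ (d, d)) (p q) \<and>
          fl_mul \<epsilon> (C k $$ (a, a)) (D k $$ (d, d)) (g q) \<and>
          fl_sub \<epsilon> (E k $$ (a, d)) (v q) (b q) \<and>
          X' k $$ (a, d) = x q) \<and>
       (case st of
          Transp \<Rightarrow> \<exists>W. fl_system_T \<epsilon> N p g b W \<and> fl_small_solve 1 \<epsilon> N W x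
        | ConjTransp \<Rightarrow> \<exists>W y. fl_system_H u N {q. q mod r = r - 1} p g b W \<and>
            fl_small_solve 2 u (2 * N) W y \<and> (\<forall>q<N. x q = Complex (y (2 * q)) (y (2 * q + 1)))) \<and>
       (\<forall>k<r. X' k \<in> carrier_mat n n \<and> XB' k \<in> carrier_mat n n \<and> XD' k \<in> carrier_mat n n \<and>
          (\<forall>a<n. \<forall>d<n.
             if (a, d) \<in> set P then
               fl_sum_of \<epsilon> (\<lambda>t. fl_mul \<epsilon> (X' k $$ (a, t)) (B k $$ (t, d))) {d..<n} (XB' k $$ (a, d)) \<and>
               fl_sum_of \<epsilon> (\<lambda>t. fl_mul \<epsilon> (next_mat st r X' k $$ (a, t)) (D k $$ (t, d))) {d..<n}
                 (XD' k $$ (a, d))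
             else
               X' k $$ (a, d) = X k $$ (a, d) \<and> XB' k $$ (a, d) = XB k $$ (a, d) \<and>
               XD' k $$ (a, d) = XD k $$ (a, d))))"

definition pair_list :: "nat \<Rightarrow> (nat \<times> nat) list" where
  "pair_list n = [(i, j). i \<leftarrow> [0..<n], j \<leftarrow> [0..<i+1]]"

definition fl_block_back_subst ::
  "star \<Rightarrow> real \<Rightarrow> real \<Rightarrow> nat \<Rightarrow> nat \<Rightarrow> (nat \<Rightarrow> complex mat) \<Rightarrow> (nat \<Rightarrow> complex mat)
    \<Rightarrow> (nat \<Rightarrow> complex mat) \<Rightarrow> (nat \<Rightarrow> complex mat) \<Rightarrow> (nat \<Rightarrow> complex mat)
    \<Rightarrow> (nat \<Rightarrow> complex mat) \<Rightarrow> bool" where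
  "fl_block_back_subst st \<kappa> u r n A B C D E Xt \<longleftrightarrow>
     (\<exists>XB XD. run (fl_step st \<kappa> u r n A B C D E) (rev (pair_list n))
        (\<lambda>_. 0\<^sub>m n n, \<lambda>_. 0\<^sub>m n n, \<lambda>_. 0\<^sub>m n n) (Xt, XB, XD))"

section \<open>Backward error\<close>

definition backward_error_le ::
  "'a::real_normed_field mat \<Rightarrow> 'a vec \<Rightarrow> 'a vec \<Rightarrow> real \<Rightarrow> real \<Rightarrow> bool" where
  "backward_error_le M x e \<mu> \<eta> \<longleftrightarrow>
     (\<exists>dM de. dM \<in> carrier_mat (dim_row M) (dim_col M) \<and> de \<in> carrier_vec (dim_vec e) \<and>
        (M + dM) *\<^sub>v x = e + de \<and>
        mat_norm2 dM \<le> \<mu> * mat_norm2 M \<and> vec_norm2 de \<le> \<eta> * vec_norm2 e)"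

end

theory Submission
  imports Defs "HOL-Analysis.L2_Norm"
begin

text \<open>
  Both error measures are normwise, so everything can be read off the residual. If the computed
  \<open>x\<close> satisfies \<open>\<parallel>E - M x\<parallel> \<le> \<tau> \<parallel>M\<parallel> \<parallel>x\<parallel>\<close>, then the rank one matrix \<open>(E - M x) x\<^sup>H / \<parallel>x\<parallel>\<^sup>2\<close> has norm
  at most \<open>\<tau> \<parallel>M\<parallel>\<close>, and adding it to \<open>M\<close> turns \<open>x\<close> into an exact solution for the unperturbed
  right-hand side (\<open>backward_error_of_residual\<close>). It remains to bound the residual by
  \<open>c u (r\<^sup>2 + n\<^sup>2) \<parallel>M\<parallel> \<parallel>x\<parallel>\<close>, which is below \<open>r \<gamma>\<^sub>r + \<gamma>\<close> with \<open>\<gamma>\<close> taken at \<open>n\<^sup>2\<close>.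

  The algorithm writes every position \<open>(i, j)\<close> exactly once, and all the data that it reads at a
  position have their final values by then. Hence the final state satisfies the equations of all
  steps at once (\<open>fl_step_final\<close>), and the residual can be studied one position at a time. With
  \<open>\<epsilon> = \<kappa> u\<close>, its value at a position has three sources (\<open>entry_residual\<close>).

  The first is the evaluation of the coefficients and of \<open>v\<close>. Each product \<open>A\<^sub>i\<^sub>s X\<^sub>s\<^sub>t B\<^sub>t\<^sub>j\<close> passes
  through at most \<open>2 n + 5\<close> roundings, so this error is of order \<open>n \<epsilon>\<close> times the entry of
  \<open>|A| |X| |B| + |C| |X'| |D|\<close>, where \<open>X'\<close> is the next unknown matrix. The products \<open>A\<^sub>i\<^sub>s B\<^sub>t\<^sub>j\<close> with
  \<open>s\<close> and \<open>t\<close> fixed are part of one column of \<open>M\<close> when \<open>r \<ge> 2\<close>, so the sum of their squared moduli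
  over \<open>i\<close> and \<open>j\<close> is at most \<open>\<parallel>M\<parallel>\<^sup>2\<close>; for \<open>r = 1\<close> the two Kronecker blocks overlap, but the bound persists
  (\<open>kronecker_bounds\<close>). There are \<open>n\<^sup>2\<close> choices of \<open>s\<close> and \<open>t\<close>, and the
  Frobenius norm of the whole Kronecker block is at most \<open>n \<parallel>M\<parallel>\<close> (\<open>L2_majorant\<close>). This gives
  \<open>n\<^sup>2 \<epsilon> \<parallel>M\<parallel> \<parallel>x\<parallel>\<close>.

  The second is the solution of the small systems. An exact rotation is an isometry, so the errors
  of the \<open>O(r)\<close> rotations simply add up in the residual, each of them relative to the norms of the
  columns; back substitution contributes errors of the same form. The error relative to the
  right-hand side is absorbed by the others, because the right-hand side itself is the matrix times
  \<open>x\<close> plus the residual (\<open>small_solve_residual\<close>). All coefficients are bounded by a multiple of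
  \<open>\<parallel>M\<parallel>\<close> and every row has a bounded number of nonzero entries. The Frobenius norm of a small
  matrix is therefore of order \<open>\<surd>r \<parallel>M\<parallel>\<close>, and the contribution is of order \<open>r \<surd>r \<epsilon> \<parallel>M\<parallel> \<parallel>x\<parallel>\<close>.

  The third is the subtraction \<open>E - v\<close>. Its error is relative to the right-hand side of the small
  system, which has just been bounded.
\<close>

section \<open>Accumulation of rounding errors\<close>

text \<open>
  \<open>z\<close> is an approximation of \<open>s\<close> affected by at most \<open>k\<close> roundings. The error is measured
  against a majorant \<open>S\<close> of \<open>s\<close>, obtained by replacing all terms by their moduli. In this form
  the relation survives sums with cancellation: a sum keeps the larger of the two counts, a
  product adds them, and a rounding increases the count by one.
\<close>

definition close :: "real \<Rightarrow> nat \<Rightarrow> real \<Rightarrow> 'a::real_normed_field \<Rightarrow> 'a \<Rightarrow> bool" where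
  "close \<epsilon> k S s z \<longleftrightarrow> norm s \<le> S \<and> norm (z - s) \<le> ((1 + \<epsilon>) ^ k - 1) * S"

lemma close_nonneg: "close \<epsilon> k S s z \<Longrightarrow> 0 \<le> S"
  unfolding close_def using norm_ge_zero[of s] by linarith

lemma close_norm:
  assumes "close \<epsilon> k S s z"
  shows "norm z \<le> (1 + \<epsilon>) ^ k * S"
proof -
  have "norm z \<le> norm s + norm (z - s)"
    using norm_triangle_ineq[of s "z - s"] by simp
  also have "\<dots> \<le> S + ((1 + \<epsilon>) ^ k - 1) * S"
    using assms by (simp add: close_def)
  finally show ?thesis by (simp add: algebra_simps)
qed

lemma close_exact: "close \<epsilon> 0 (norm s) s s"
  by (simp add: close_def)

lemma close_mono:
  assumes "close \<epsilon> k S s z" "k \<le> l" "S \<le> T" "0 \<le> \<epsilon>"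
  shows "close \<epsilon> l T s z"
proof -
  have "(1 + \<epsilon>) ^ k \<le> (1 + \<epsilon>) ^ l" "1 \<le> (1 + \<epsilon>) ^ l"
    using assms by (auto intro: power_increasing)
  then have "((1 + \<epsilon>) ^ k - 1) * S \<le> ((1 + \<epsilon>) ^ l - 1) * T"
    using assms(3) close_nonneg[OF assms(1)] by (intro mult_mono) auto
  then show ?thesis using assms unfolding close_def by linarith
qed

lemma close_round:
  assumes "close \<epsilon> k S s z" "fl_round \<epsilon> z w" "0 \<le> \<epsilon>"
  shows "close \<epsilon> (Suc k) S s w"
proof -
  from assms(2) obtain \<delta> where \<delta>: "norm \<delta> \<le> \<epsilon>" "w = z * (1 + \<delta>)"
    by (auto simp: fl_round_def)
  have "norm (w - s) \<le> norm (z - s) + norm z * norm \<delta>"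
    using norm_triangle_ineq[of "z - s" "z * \<delta>"] by (simp add: \<delta>(2) algebra_simps norm_mult)
  also have "\<dots> \<le> ((1 + \<epsilon>) ^ k - 1) * S + ((1 + \<epsilon>) ^ k * S) * \<epsilon>"
    using assms \<delta>(1) close_norm[OF assms(1)] close_nonneg[OF assms(1)]
    by (intro add_mono mult_mono) (auto simp: close_def)
  finally show ?thesis using assms(1) by (simp add: close_def algebra_simps)
qed

lemma close_uminus: "close \<epsilon> k S s z \<Longrightarrow> close \<epsilon> k S (- s) (- z)"
  unfolding close_def by (metis minus_diff_minus norm_minus_cancel)

lemma close_plus:
  assumes "close \<epsilon> k S s z" "close \<epsilon> k T t w"
  shows "close \<epsilon> k (S + T) (s + t) (z + w)"
proof -
  have "norm (z + w - (s + t)) \<le> norm (z - s) + norm (w - t)"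
    using norm_triangle_ineq[of "z - s" "w - t"] by (simp add: algebra_simps)
  also have "\<dots> \<le> ((1 + \<epsilon>) ^ k - 1) * (S + T)"
    using assms by (simp add: close_def algebra_simps)
  finally show ?thesis
    using assms norm_triangle_ineq[of s t] unfolding close_def by linarith
qed

lemma close_times:
  assumes "close \<epsilon> k S s z" "close \<epsilon> l T t w" "0 \<le> \<epsilon>"
  shows "close \<epsilon> (k + l) (S * T) (s * t) (z * w)"
proof -
  note nn = close_nonneg[OF assms(1)] close_nonneg[OF assms(2)]
  have st: "norm (s * t) \<le> S * T"
    using assms nn by (auto simp: close_def norm_mult intro: mult_mono)
  have "z * w - s * t = (z - s) * w + s * (w - t)" by (simp add: algebra_simps)
  then have "norm (z * w - s * t) \<le> norm (z - s) * norm w + norm s * norm (w - t)"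
    by (metis norm_mult norm_triangle_ineq)
  also have "\<dots> \<le> (((1 + \<epsilon>) ^ k - 1) * S) * ((1 + \<epsilon>) ^ l * T) + S * (((1 + \<epsilon>) ^ l - 1) * T)"
    using assms nn close_norm[OF assms(2)]
    by (intro add_mono mult_mono) (auto simp: close_def intro: mult_nonneg_nonneg)
  also have "\<dots> = ((1 + \<epsilon>) ^ (k + l) - 1) * (S * T)"
    by (simp add: power_add algebra_simps)
  finally show ?thesis using st by (simp add: close_def)
qed

lemma close_fl_add:
  assumes "close \<epsilon> k S s z" "close \<epsilon> k T t w" "fl_add \<epsilon> z w y" "0 \<le> \<epsilon>"
  shows "close \<epsilon> (Suc k) (S + T) (s + t) y"
  using close_round[OF close_plus[OF assms(1,2)]] assms(3,4) by (simp add: fl_add_def)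

lemma close_fl_sub:
  assumes "close \<epsilon> k S s z" "close \<epsilon> k T t w" "fl_sub \<epsilon> z w y" "0 \<le> \<epsilon>"
  shows "close \<epsilon> (Suc k) (S + T) (s - t) y"
  using close_round[OF close_plus[OF assms(1) close_uminus[OF assms(2)]]] assms(3,4)
  by (simp add: fl_sub_def)

lemma close_fl_mul:
  assumes "fl_mul \<epsilon> x z w" "close \<epsilon> k S s z" "0 \<le> \<epsilon>"
  shows "close \<epsilon> (Suc k) (norm x * S) (x * s) w"
  using close_round[OF close_times[OF close_exact assms(2,3)]] assms(1,3) by (simp add: fl_mul_def)

lemma close_fl_mul_exact:
  assumes "fl_mul \<epsilon> x z w" "0 \<le> \<epsilon>"
  shows "close \<epsilon> 1 (norm x * norm z) (x * z) w"
  using close_fl_mul[OF assms(1) close_exact assms(2)] by simp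

lemma close_fl_mul3:
  assumes "fl_mul3 \<epsilon> x y z w" "0 \<le> \<epsilon>"
  shows "close \<epsilon> 2 (norm x * norm y * norm z) (x * y * z) w"
proof -
  from assms obtain v where v: "fl_mul \<epsilon> x y v" "fl_mul \<epsilon> v z w" by (auto simp: fl_mul3_def)
  have "close \<epsilon> (1 + 0) (norm x * norm y * norm z) (x * y * z) (v * z)"
    by (rule close_times[OF close_fl_mul_exact[OF v(1) assms(2)] close_exact assms(2)])
  from close_round[OF this] v(2) assms(2) show ?thesis by (simp add: fl_mul_def numeral_2_eq_2)
qed

lemma fl_sum_finite: "fl_sum \<epsilon> f I z \<Longrightarrow> finite I"
  by (induction rule: fl_sum.induct) auto

text \<open>
  Whatever the bracketing, a summand takes part in fewer than \<open>card I\<close> additions, because each of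
  them merges its group with a nonempty one.
\<close>

lemma close_fl_sum:
  assumes "fl_sum \<epsilon> f I z" "\<And>t. t \<in> I \<Longrightarrow> close \<epsilon> k (S t) (s t) (f t)" "0 \<le> \<epsilon>"
  shows "close \<epsilon> (k + card I) (\<Sum>t\<in>I. S t) (\<Sum>t\<in>I. s t) z"
  using assms
proof (induction rule: fl_sum.induct)
  case empty
  then show ?case by (simp add: close_def)
next
  case (single t)
  then have "close \<epsilon> k (S t) (s t) (f t)" by auto
  then show ?case using \<open>0 \<le> \<epsilon>\<close> by (auto intro: close_mono)
next
  case (join I x J y z)
  have fin: "finite I" "finite J" using join.hyps by (auto intro: fl_sum_finite)
  then have pos: "card I > 0" "card J > 0" using join.hyps by (auto simp: card_gt_0_iff)
  define m where "m = k + card (I \<union> J) - 1"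
  have card: "card (I \<union> J) = card I + card J"
    using fin join.hyps by (simp add: card_Un_disjoint)
  have "close \<epsilon> m (\<Sum>t\<in>I. S t) (\<Sum>t\<in>I. s t) x"
    using join.IH(1)[OF join.prems(1) \<open>0 \<le> \<epsilon>\<close>] pos card \<open>0 \<le> \<epsilon>\<close>
    by (auto simp: m_def intro: close_mono)
  moreover have "close \<epsilon> m (\<Sum>t\<in>J. S t) (\<Sum>t\<in>J. s t) y"
    using join.IH(2)[OF join.prems(1) \<open>0 \<le> \<epsilon>\<close>] pos card \<open>0 \<le> \<epsilon>\<close>
    by (auto simp: m_def intro: close_mono)
  ultimately have "close \<epsilon> (Suc m) (\<Sum>t\<in>I \<union> J. S t) (\<Sum>t\<in>I \<union> J. s t) z"
    using close_fl_add join.hyps join.prems fin by (simp add: sum.union_disjoint)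
  then show ?case using pos card by (simp add: m_def)
qed

lemma close_fl_sum_of:
  assumes "fl_sum_of \<epsilon> F I z" "\<And>t y. t \<in> I \<Longrightarrow> F t y \<Longrightarrow> close \<epsilon> k (S t) (s t) y"
    "0 \<le> \<epsilon>" "k + card I \<le> l"
  shows "close \<epsilon> l (\<Sum>t\<in>I. S t) (\<Sum>t\<in>I. s t) z"
proof -
  from assms(1) obtain f where "\<forall>t\<in>I. F t (f t)" "fl_sum \<epsilon> f I z" by (auto simp: fl_sum_of_def)
  then have "close \<epsilon> (k + card I) (\<Sum>t\<in>I. S t) (\<Sum>t\<in>I. s t) z"
    using assms(2,3) by (intro close_fl_sum) auto
  then show ?thesis using assms(3,4) by (auto intro: close_mono)
qed

section \<open>Euclidean norms of indexed families\<close>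

abbreviation l2 :: "('i \<Rightarrow> 'a::real_normed_vector) \<Rightarrow> 'i set \<Rightarrow> real" where
  "l2 f I \<equiv> L2_set (\<lambda>i. norm (f i)) I"

lemma l2_triangle: "l2 (\<lambda>i. f i + g i) I \<le> l2 f I + l2 g I"
proof -
  have "l2 (\<lambda>i. f i + g i) I \<le> L2_set (\<lambda>i. norm (f i) + norm (g i)) I"
    by (intro L2_set_mono) (auto intro: norm_triangle_ineq)
  also have "\<dots> \<le> l2 f I + l2 g I" by (rule L2_set_triangle_ineq)
  finally show ?thesis .
qed

lemma L2_set_sum_le: "finite J \<Longrightarrow> L2_set (\<lambda>i. \<Sum>j\<in>J. f j i) I \<le> (\<Sum>j\<in>J. L2_set (f j) I)"
proof (induction rule: finite_induct)
  case (insert x F)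
  then have "L2_set (\<lambda>i. \<Sum>j\<in>insert x F. f j i) I = L2_set (\<lambda>i. f x i + (\<Sum>j\<in>F. f j i)) I"
    by simp
  also have "\<dots> \<le> L2_set (f x) I + L2_set (\<lambda>i. \<Sum>j\<in>F. f j i) I"
    by (rule L2_set_triangle_ineq)
  finally show ?case using insert by simp
qed (simp add: L2_set_def)

lemma l2_lincomb:
  fixes f :: "'j \<Rightarrow> 'i \<Rightarrow> 'a::real_normed_field"
  assumes "finite J"
  shows "l2 (\<lambda>i. \<Sum>j\<in>J. f j i * x j) I \<le> (\<Sum>j\<in>J. l2 (f j) I * norm (x j))"
proof -
  have "l2 (\<lambda>i. \<Sum>j\<in>J. f j i * x j) I \<le> L2_set (\<lambda>i. \<Sum>j\<in>J. norm (f j i) * norm (x j)) I"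
    by (intro L2_set_mono) (auto simp: norm_mult[symmetric] intro: norm_sum)
  also have "\<dots> \<le> (\<Sum>j\<in>J. L2_set (\<lambda>i. norm (f j i) * norm (x j)) I)"
    using assms by (rule L2_set_sum_le)
  also have "\<dots> = (\<Sum>j\<in>J. l2 (f j) I * norm (x j))"
    by (simp add: L2_set_left_distrib)
  finally show ?thesis .
qed

lemma l2_uminus: "l2 (\<lambda>i. - f i) I = l2 f I" by simp

lemma l2_mono_set: "finite J \<Longrightarrow> I \<subseteq> J \<Longrightarrow> L2_set f I \<le> L2_set f J"
  unfolding L2_set_def by (intro real_sqrt_le_mono sum_mono2) auto

lemma l2_power2: "(L2_set f I)\<^sup>2 = (\<Sum>i\<in>I. (f i)\<^sup>2)"
  by (simp add: L2_set_def sum_nonneg)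

lemma l2_nested: "L2_set (\<lambda>i. L2_set (f i) (J i)) I = sqrt (\<Sum>i\<in>I. \<Sum>j\<in>J i. (f i j)\<^sup>2)"
  by (simp add: L2_set_def sum_nonneg)

lemma l2_swap: "L2_set (\<lambda>i. L2_set (f i) J) I = L2_set (\<lambda>j. L2_set (\<lambda>i. f i j) I) J"
  unfolding l2_nested by (subst sum.swap) simp

lemma l2_const_bound:
  assumes "\<And>i. i \<in> I \<Longrightarrow> 0 \<le> f i" "\<And>i. i \<in> I \<Longrightarrow> f i \<le> c" "0 \<le> c"
  shows "L2_set f I \<le> sqrt (card I) * c"
proof -
  have "(\<Sum>i\<in>I. (f i)\<^sup>2) \<le> (\<Sum>i\<in>I. c\<^sup>2)"
    using assms by (intro sum_mono power_mono) auto
  then have "L2_set f I \<le> sqrt (card I * c\<^sup>2)"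
    unfolding L2_set_def by (intro real_sqrt_le_mono) simp
  then show ?thesis using assms by (simp add: real_sqrt_mult)
qed

text \<open>
  By the Cauchy--Schwarz inequality, weighting the column norms with the entries of \<open>x\<close> costs no
  more than the Frobenius norm.
\<close>

lemma sum_col_le:
  "(\<Sum>j\<in>J. l2 (f j) I * norm (x j)) \<le> L2_set (\<lambda>i. L2_set (\<lambda>j. norm (f j i)) J) I * l2 x J"
proof -
  have "(\<Sum>j\<in>J. l2 (f j) I * norm (x j)) \<le> L2_set (\<lambda>j. l2 (f j) I) J * l2 x J"
    using L2_set_mult_ineq[of "\<lambda>j. l2 (f j) I" "\<lambda>j. norm (x j)" J]
    by (simp add: abs_mult)
  also have "L2_set (\<lambda>j. l2 (f j) I) J = L2_set (\<lambda>i. L2_set (\<lambda>j. norm (f j i)) J) I"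
    by (rule l2_swap)
  finally show ?thesis .
qed

section \<open>Plane rotations\<close>

text \<open>
  The action of the matrix \<open>[cnj c, cnj s; -s, c]\<close> on the components \<open>p\<close> and \<open>q\<close>.
\<close>

definition rot :: "'a::conjugatable_field \<Rightarrow> 'a \<Rightarrow> nat \<Rightarrow> nat \<Rightarrow> (nat \<Rightarrow> 'a) \<Rightarrow> nat \<Rightarrow> 'a" where
  "rot c s p q f i = (if i = p then conjugate c * f p + conjugate s * f q
     else if i = q then - s * f p + c * f q else f i)"

text \<open>
  The assumption on conjugation is the one property shared by the real and the complex numbers on
  which rotations rely, so that one proof covers both arithmetics.
\<close>

lemma rot_pair_isometry:
  fixes c s x y :: "'a::{real_normed_field, conjugatable_field}"
  assumes conj: "\<And>z::'a. z * conjugate z = of_real ((norm z)\<^sup>2)"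
    and cs: "(norm c)\<^sup>2 + (norm s)\<^sup>2 = 1"
  shows "(norm (conjugate c * x + conjugate s * y))\<^sup>2 + (norm (- s * x + c * y))\<^sup>2
    = (norm x)\<^sup>2 + (norm y)\<^sup>2"
proof -
  have cn: "conjugate (y - z) = conjugate y - conjugate z" for y z :: 'a
    using conjugate_dist_add[of y "- z"] by (simp add: conjugate_neg)
  have 1: "c * conjugate c + s * conjugate s = 1"
    unfolding conj using cs by (metis of_real_1 of_real_add)
  have "of_real ((norm (conjugate c * x + conjugate s * y))\<^sup>2 + (norm (- s * x + c * y))\<^sup>2)
    = (conjugate c * x + conjugate s * y) * (c * conjugate x + s * conjugate y)
      + (- s * x + c * y) * (- conjugate s * conjugate x + conjugate c * conjugate y)"
    unfolding of_real_add conj[symmetric]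
    by (simp add: conjugate_dist_add conjugate_dist_mul conjugate_neg cn)
  also have "\<dots> = (c * conjugate c + s * conjugate s) * (x * conjugate x + y * conjugate y)"
    by (simp add: algebra_simps)
  also have "\<dots> = of_real ((norm x)\<^sup>2 + (norm y)\<^sup>2)"
    by (subst 1) (simp add: conj)
  finally show ?thesis by (simp only: of_real_eq_iff)
qed

lemma norm_conjugate:
  fixes c :: "'a::{real_normed_field, conjugatable_field}"
  assumes conj: "\<And>z::'a. z * conjugate z = of_real ((norm z)\<^sup>2)"
  shows "norm (conjugate c) = norm c"
proof (cases "c = 0")
  case False
  have "norm c * norm (conjugate c) = norm c * norm c"
    using arg_cong[OF conj[of c], of norm] by (simp add: norm_mult norm_power power2_eq_square)
  then show ?thesis using False by simp
qed (simp add: conjugate_zero)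

lemma sum_split_pair:
  assumes "p < m" "q < m" "p \<noteq> (q::nat)"
  shows "(\<Sum>i<m. f i) = f p + f q + (\<Sum>i\<in>{..<m} - {p, q}. f i)"
proof -
  have "(\<Sum>i<m. f i) = (\<Sum>i\<in>{p, q}. f i) + (\<Sum>i\<in>{..<m} - {p, q}. f i)"
    using sum.subset_diff[of "{p, q}" "{..<m}" f] assms by (simp add: add.commute)
  then show ?thesis using assms by simp
qed

lemma rot_isometry:
  fixes f :: "nat \<Rightarrow> 'a::{real_normed_field, conjugatable_field}"
  assumes conj: "\<And>z::'a. z * conjugate z = of_real ((norm z)\<^sup>2)"
    and cs: "(norm c)\<^sup>2 + (norm s)\<^sup>2 = 1" and pq: "p < m" "q < m" "p \<noteq> q"
  shows "l2 (rot c s p q f) {..<m} = l2 f {..<m}"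
proof -
  have "(\<Sum>i<m. (norm (rot c s p q f i))\<^sup>2) = (\<Sum>i<m. (norm (f i))\<^sup>2)"
    unfolding sum_split_pair[OF pq] using rot_pair_isometry[OF conj cs, of "f p" "f q"] pq
    by (simp add: rot_def)
  then show ?thesis by (simp add: L2_set_def)
qed

text \<open>
  The two squares and their sum change the square of \<open>\<rho>\<close> by two factors between \<open>1 - \<epsilon>\<close> and
  \<open>1 + \<epsilon>\<close>; the root halves this, and its own rounding and the division add two more. All
  quantities added are nonnegative, so there is no cancellation and the errors stay relative.
\<close>

lemma fl_rotation_error:
  fixes a b :: "'a::real_normed_field"
  assumes "fl_rotation \<epsilon> a b c' s'" "b \<noteq> 0" "0 \<le> \<epsilon>" "\<epsilon> \<le> 1/10"
  defines "\<rho> \<equiv> sqrt ((norm a)\<^sup>2 + (norm b)\<^sup>2)"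
  shows "\<rho> > 0" "norm (c' - a / of_real \<rho>) \<le> 4 * \<epsilon> * norm (a / of_real \<rho>)"
    "norm (s' - b / of_real \<rho>) \<le> 4 * \<epsilon> * norm (b / of_real \<rho>)"
proof -
  from assms obtain \<alpha> \<beta> \<sigma> \<rho>' :: real where r: "fl_round \<epsilon> ((norm a)\<^sup>2) \<alpha>" "fl_round \<epsilon> ((norm b)\<^sup>2) \<beta>"
    "fl_round \<epsilon> (\<alpha> + \<beta>) \<sigma>" "fl_round \<epsilon> (sqrt \<sigma>) \<rho>'"
    "fl_div \<epsilon> a (of_real \<rho>') c'" "fl_div \<epsilon> b (of_real \<rho>') s'"
    by (auto simp: fl_rotation_def fl_add_def)
  have rp: "(norm a)\<^sup>2 + (norm b)\<^sup>2 > 0" using assms(2) by (simp add: add_nonneg_pos)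
  then show rho: "\<rho> > 0" by (simp add: \<rho>_def)
  have rr: "\<rho>\<^sup>2 = (norm a)\<^sup>2 + (norm b)\<^sup>2" by (simp add: \<rho>_def)
  have bounds: "(1 - \<epsilon>) * x \<le> y \<and> y \<le> (1 + \<epsilon>) * x" if "fl_round \<epsilon> x y" "0 \<le> x" for x y :: real
  proof -
    from that obtain \<delta> where "\<bar>\<delta>\<bar> \<le> \<epsilon>" "y = x * (1 + \<delta>)" by (auto simp: fl_round_def)
    then show ?thesis using that(2) by (auto simp: mult.commute[of x] intro!: mult_right_mono)
  qed
  note ab = bounds[OF r(1)] bounds[OF r(2)]
  have sum: "(1 - \<epsilon>) * \<rho>\<^sup>2 \<le> \<alpha> + \<beta>" "\<alpha> + \<beta> \<le> (1 + \<epsilon>) * \<rho>\<^sup>2"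
    unfolding rr using ab by (auto simp: algebra_simps)
  have e1: "0 \<le> 1 - \<epsilon>" "0 \<le> 1 + \<epsilon>" using assms by auto
  have nn: "0 \<le> \<alpha> + \<beta>" using sum(1) e1 by (meson mult_nonneg_nonneg order_trans zero_le_power2)
  have "(1 - \<epsilon>) * ((1 - \<epsilon>) * \<rho>\<^sup>2) \<le> \<sigma>" "\<sigma> \<le> (1 + \<epsilon>) * ((1 + \<epsilon>) * \<rho>\<^sup>2)"
    using bounds[OF r(3) nn] mult_left_mono[OF sum(1) e1(1)] mult_left_mono[OF sum(2) e1(2)] by linarith+
  then have s2: "((1 - \<epsilon>) * \<rho>)\<^sup>2 \<le> \<sigma>" "\<sigma> \<le> ((1 + \<epsilon>) * \<rho>)\<^sup>2"
    by (auto simp: power2_eq_square algebra_simps)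
  have sq: "(1 - \<epsilon>) * \<rho> \<le> sqrt \<sigma>" "sqrt \<sigma> \<le> (1 + \<epsilon>) * \<rho>"
    using s2 e1 rho by (auto intro!: real_le_rsqrt real_le_lsqrt)
  have nn': "0 \<le> sqrt \<sigma>" using sq(1) e1 rho by (meson mult_nonneg_nonneg order_trans less_imp_le)
  have r': "(1 - \<epsilon>) * ((1 - \<epsilon>) * \<rho>) \<le> \<rho>'" "\<rho>' \<le> (1 + \<epsilon>) * ((1 + \<epsilon>) * \<rho>)"
    using bounds[OF r(4) nn'] mult_left_mono[OF sq(1) e1(1)] mult_left_mono[OF sq(2) e1(2)] by linarith+
  \<comment> \<open>\<open>81/100 = (1 - 1/10)\<^sup>2\<close> bounds the computed \<open>\<rho>\<close> away from zero.\<close>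
  have low: "81/100 * \<rho> \<le> (1 - \<epsilon>) * ((1 - \<epsilon>) * \<rho>)"
  proof -
    have "(9/10) * (9/10) \<le> (1 - \<epsilon>) * (1 - \<epsilon>)" using assms by (intro mult_mono) auto
    then have "81/100 * \<rho> \<le> (1 - \<epsilon>) * (1 - \<epsilon>) * \<rho>" using rho by (intro mult_right_mono) auto
    then show ?thesis by (simp only: mult.assoc)
  qed
  have r0: "\<rho>' > 0" using low r'(1) rho by linarith
  have e2: "\<epsilon> * \<epsilon> \<le> \<epsilon> / 10" using mult_left_mono[OF assms(4,3)] by simp
  have dr: "\<bar>\<rho> - \<rho>'\<bar> \<le> 21/10 * \<epsilon> * \<rho>"
  proof -
    have "\<epsilon> * \<epsilon> * \<rho> \<le> \<epsilon> / 10 * \<rho>" "0 \<le> \<epsilon> * \<epsilon> * \<rho>"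
      using mult_right_mono[OF e2, of \<rho>] rho by simp_all
    then show ?thesis using r' unfolding abs_le_iff by (auto simp: algebra_simps)
  qed
  define \<tau> where "\<tau> = \<rho> / \<rho>'"
  have "\<bar>\<tau> - 1\<bar> = \<bar>\<rho> - \<rho>'\<bar> / \<rho>'" using r0
    by (metis \<tau>_def abs_divide abs_of_pos diff_divide_distrib divide_self less_irrefl)
  also have "\<dots> \<le> (21/10 * \<epsilon> * \<rho>) / (81/100 * \<rho>)"
    using dr order_trans[OF low r'(1)] rho assms(3) by (intro frac_le) auto
  also have "\<dots> \<le> 26/10 * \<epsilon>" using rho assms(3) by (simp add: field_simps)
  finally have l1: "\<bar>\<tau> - 1\<bar> \<le> 26/10 * \<epsilon>" .
  then have "\<bar>\<tau>\<bar> \<le> 13/10" using assms(4) by linarith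
  then have lam: "26/10 * \<epsilon> + \<bar>\<tau>\<bar> * \<epsilon> \<le> 4 * \<epsilon>"
    using mult_right_mono[of "\<bar>\<tau>\<bar>" "13/10" \<epsilon>] assms(3) by linarith
  have main: "norm (z - w / of_real \<rho>) \<le> 4 * \<epsilon> * norm (w / of_real \<rho>)"
    if d: "fl_div \<epsilon> w (of_real \<rho>') z" for w z :: 'a
  proof -
    from d obtain \<delta> where \<delta>: "norm \<delta> \<le> \<epsilon>" "z = w / of_real \<rho>' * (1 + \<delta>)"
      by (auto simp: fl_div_def fl_round_def)
    have w: "w / of_real \<rho>' = w / of_real \<rho> * of_real \<tau>"
      using rho r0 by (simp add: \<tau>_def)
    have "z - w / of_real \<rho> = (w / of_real \<rho>) * (of_real (\<tau> - 1) + of_real \<tau> * \<delta>)"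
      unfolding \<delta>(2) w by (simp add: algebra_simps add_divide_distrib)
    then have "norm (z - w / of_real \<rho>) = norm (w / of_real \<rho>) * norm (of_real (\<tau> - 1) + of_real \<tau> * \<delta>)"
      by (simp only: norm_mult)
    also have "\<dots> \<le> norm (w / of_real \<rho>) * (\<bar>\<tau> - 1\<bar> + \<bar>\<tau>\<bar> * norm \<delta>)"
      by (intro mult_left_mono) (auto intro: norm_triangle_ineq[THEN order_trans] simp: norm_mult
          simp del: of_real_diff)
    also have "\<dots> \<le> norm (w / of_real \<rho>) * (4 * \<epsilon>)"
    proof (rule mult_left_mono)
      have "\<bar>\<tau>\<bar> * norm \<delta> \<le> \<bar>\<tau>\<bar> * \<epsilon>" using \<delta>(1) by (intro mult_left_mono) auto
      then show "\<bar>\<tau> - 1\<bar> + \<bar>\<tau>\<bar> * norm \<delta> \<le> 4 * \<epsilon>" using l1 lam by linarith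
    qed simp
    finally show ?thesis by (simp add: mult.commute)
  qed
  show "norm (c' - a / of_real \<rho>) \<le> 4 * \<epsilon> * norm (a / of_real \<rho>)"
    "norm (s' - b / of_real \<rho>) \<le> 4 * \<epsilon> * norm (b / of_real \<rho>)"
    using main r(5,6) by auto
qed

text \<open>
  The constant comes from \<open>(1 + 4 \<epsilon>) (1 + \<epsilon>)\<^sup>2 - 1 \<le> 7 \<epsilon>\<close> for \<open>\<epsilon> \<le> 1/10\<close>.
\<close>

lemma fl_lincomb2_error:
  fixes x y :: "'a::real_normed_field"
  assumes "fl_lincomb2 \<epsilon> c' x s' y z" "0 \<le> \<epsilon>" "\<epsilon> \<le> 1/10"
    and c: "norm (c' - c) \<le> 4 * \<epsilon> * norm c" and s: "norm (s' - s) \<le> 4 * \<epsilon> * norm s"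
  shows "norm (z - (c * x + s * y)) \<le> 7 * \<epsilon> * (norm c * norm x + norm s * norm y)"
proof -
  from assms(1) obtain v w where vw: "fl_mul \<epsilon> c' x v" "fl_mul \<epsilon> s' y w" "fl_add \<epsilon> v w z"
    by (auto simp: fl_lincomb2_def)
  have "close \<epsilon> 2 (norm c' * norm x + norm s' * norm y) (c' * x + s' * y) z"
    using close_fl_add[OF close_fl_mul_exact[OF vw(1) assms(2)] close_fl_mul_exact[OF vw(2)
        assms(2)] vw(3) assms(2)]
    by (simp add: numeral_2_eq_2)
  then have 1: "norm (z - (c' * x + s' * y)) \<le> ((1 + \<epsilon>)\<^sup>2 - 1) * (norm c' * norm x + norm s' * norm y)"
    by (simp add: close_def)
  have n: "norm c' \<le> (1 + 4 * \<epsilon>) * norm c" "norm s' \<le> (1 + 4 * \<epsilon>) * norm s"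
    using norm_triangle_ineq[of c "c' - c"] norm_triangle_ineq[of s "s' - s"] c s
    by (auto simp: algebra_simps)
  define S where "S = norm c * norm x + norm s * norm y"
  have S0: "0 \<le> S" by (simp add: S_def)
  have "norm c' * norm x + norm s' * norm y \<le> ((1 + 4 * \<epsilon>) * norm c) * norm x + ((1 + 4 * \<epsilon>) * norm
      s) * norm y"
    using n by (intro add_mono mult_right_mono) auto
  also have "\<dots> = (1 + 4 * \<epsilon>) * S" by (simp add: S_def algebra_simps)
  finally have 2: "norm c' * norm x + norm s' * norm y \<le> (1 + 4 * \<epsilon>) * S" .
  have e0: "0 \<le> (1 + \<epsilon>)\<^sup>2 - 1" using assms(2) by (simp add: power2_eq_square algebra_simps)
  have 3: "norm ((c' * x + s' * y) - (c * x + s * y)) \<le> 4 * \<epsilon> * S"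
  proof -
    have "norm ((c' * x + s' * y) - (c * x + s * y)) = norm ((c' - c) * x + (s' - s) * y)"
      by (simp add: algebra_simps)
    also have "\<dots> \<le> norm (c' - c) * norm x + norm (s' - s) * norm y"
      by (metis norm_mult norm_triangle_ineq)
    also have "\<dots> \<le> (4 * \<epsilon> * norm c) * norm x + (4 * \<epsilon> * norm s) * norm y"
      using c s by (intro add_mono mult_right_mono) auto
    finally show ?thesis by (simp add: S_def algebra_simps)
  qed
  have "norm (z - (c * x + s * y)) \<le> norm (z - (c' * x + s' * y)) + norm ((c' * x + s' * y) - (c *
      x + s * y))"
    using dist_triangle[of z "c * x + s * y" "c' * x + s' * y"] unfolding dist_norm .
  also have "\<dots> \<le> ((1 + \<epsilon>)\<^sup>2 - 1) * ((1 + 4 * \<epsilon>) * S) + 4 * \<epsilon> * S"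
    using 1 2 3 mult_left_mono[OF 2 e0] by linarith
  also have "\<dots> = (6 * \<epsilon> + 9 * (\<epsilon> * \<epsilon>) + 4 * (\<epsilon> * (\<epsilon> * \<epsilon>))) * S"
    by (simp add: power2_eq_square algebra_simps)
  also have "\<dots> \<le> 7 * \<epsilon> * S"
  proof (rule mult_right_mono[OF _ S0])
    have "\<epsilon> * \<epsilon> \<le> \<epsilon> / 10" using mult_left_mono[OF assms(3,2)] by simp
    moreover have "\<epsilon> * (\<epsilon> * \<epsilon>) \<le> \<epsilon> * (1 / 100)"
      using mult_mono[OF assms(3,3)] assms(2) by (intro mult_left_mono) auto
    ultimately show "6 * \<epsilon> + 9 * (\<epsilon> * \<epsilon>) + 4 * (\<epsilon> * (\<epsilon> * \<epsilon>)) \<le> 7 * \<epsilon>" using assms(2) by linarith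
  qed
  finally show ?thesis by (simp add: S_def)
qed

section \<open>Fill-in during the elimination\<close>

lemma run_append: "run R (xs @ ys) s t \<longleftrightarrow> (\<exists>m. run R xs s m \<and> run R ys m t)"
  by (induction xs arbitrary: s) auto

lemma last_block_iff:
  assumes "0 < b" "0 < N" "q < b * N"
  shows "b * N \<le> q + b \<longleftrightarrow> q div b = N - (1::nat)"
proof -
  obtain M where N: "N = Suc M" using assms(2) by (cases N) auto
  have "b * N \<le> q + b \<longleftrightarrow> M \<le> q div b"
    using assms(1) by (simp add: N less_eq_div_iff_mult_less_eq mult.commute)
  moreover have "q div b < Suc M"
    using assms by (simp add: N div_less_iff_less_mult mult.commute)
  ultimately show ?thesis by (auto simp: N)
qed

lemma block_less: "0 < b \<Longrightarrow> q < b * N \<Longrightarrow> q div b < (N::nat)"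
  by (simp add: div_less_iff_less_mult mult.commute)

lemma fl_lincomb2_zero: "fl_lincomb2 \<epsilon> a 0 b 0 z \<Longrightarrow> z = 0"
  by (auto simp: fl_lincomb2_def fl_mul_def fl_add_def fl_round_def)

lemma fl_annihilate_carrier:
  "fl_annihilate \<epsilon> (p, q) W W' \<Longrightarrow> W \<in> carrier_mat m k \<Longrightarrow> W' \<in> carrier_mat m k"
  by (auto simp: fl_annihilate_def split: if_splits)

text \<open>
  The positions that may be nonzero while column \<open>p\<close> is eliminated, after the rows before \<open>q\<close>. A row
  outside the last block has entries in its own block, in the next one, and in the last one. The
  rows of the last block, when they are rotated with row \<open>p\<close>, inherit the pattern of row \<open>p\<close>. All columns
  before \<open>p\<close> already vanish below the diagonal.
\<close>

definition elim_admissible :: "nat \<Rightarrow> nat \<Rightarrow> nat \<Rightarrow> nat \<Rightarrow> nat \<Rightarrow> nat \<Rightarrow> bool" where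
  "elim_admissible b N p q i j \<longleftrightarrow>
     (j div b \<in> (if i div b = N - 1 then {p div b, p div b + 1, N - 1}
        else {i div b, i div b + 1, N - 1})) \<and>
     (j < p \<longrightarrow> i \<le> j) \<and> (j = p \<longrightarrow> i \<le> p \<or> q \<le> i)"

definition elim_shape :: "nat \<Rightarrow> nat \<Rightarrow> nat \<Rightarrow> nat \<Rightarrow> 'a::zero mat \<Rightarrow> bool" where
  "elim_shape b N p q W \<longleftrightarrow>
     (\<forall>i < b * N. \<forall>j < b * N. W $$ (i, j) \<noteq> 0 \<longrightarrow> elim_admissible b N p q i j)"

lemma elim_shapeD:
  assumes "elim_shape b N p q W" "i < b * N" "j < b * N" "W $$ (i, j) \<noteq> 0"
  shows "j div b \<in> (if i div b = N - 1 then {p div b, p div b + 1, N - 1}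
        else {i div b, i div b + 1, N - 1})" "j < p \<Longrightarrow> i \<le> j" "j = p \<Longrightarrow> i \<le> p \<or> q \<le> i"
  using assms unfolding elim_shape_def elim_admissible_def by blast+

lemma elim_shape_zero_entry:
  assumes sh: "elim_shape b N p q W" and z: "W $$ (q, p) = 0"
  shows "elim_shape b N p (q + 1) W"
  unfolding elim_shape_def
proof (intro allI impI)
  fix i j assume ij: "i < b * N" "j < b * N" "W $$ (i, j) \<noteq> 0"
  have "\<not> (i = q \<and> j = p)" using z ij(3) by auto
  then show "elim_admissible b N p (q + 1) i j"
    using elim_shapeD[OF sh ij] by (auto simp: elim_admissible_def)
qed

text \<open>
  Rows \<open>p\<close> and \<open>q\<close> have the same admissible blocks, either because \<open>q\<close> lies in the block of \<open>p\<close> or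
  because \<open>q\<close> lies in the last block. A combination of the two rows stays within this pattern.
\<close>

lemma elim_shape_annihilate:
  assumes sh: "elim_shape b N p q W" and ann: "fl_annihilate \<epsilon> (p, q) W W'"
    and W: "W \<in> carrier_mat (b * N) (b * N + 1)"
    and pq: "p < q" "q < b * N" and blk: "q div b = p div b \<or> q div b = N - 1"
  shows "elim_shape b N p (q + 1) W'"
proof (cases "W $$ (q, p) = 0")
  case True
  then have "W' = W" using ann by (simp add: fl_annihilate_def)
  with sh True show ?thesis
    by (auto dest: elim_shape_zero_entry)
next
  case False
  with ann W obtain c s where
    rows: "\<And>j. j < b * N + 1 \<Longrightarrow>
        fl_lincomb2 \<epsilon> (conjugate c) (W $$ (p, j)) (conjugate s) (W $$ (q, j)) (W' $$ (p, j)) \<and>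
        (if j = p then W' $$ (q, j) = 0
         else fl_lincomb2 \<epsilon> (- s) (W $$ (p, j)) c (W $$ (q, j)) (W' $$ (q, j))) \<and>
        (\<forall>i < b * N. i \<noteq> p \<longrightarrow> i \<noteq> q \<longrightarrow> W' $$ (i, j) = W $$ (i, j))"
    by (auto simp: fl_annihilate_def)
  have nz: "W $$ (p, j) \<noteq> 0 \<or> W $$ (q, j) \<noteq> 0"
    if "j < b * N" "W' $$ (p, j) \<noteq> 0 \<or> W' $$ (q, j) \<noteq> 0" for j
    using rows[of j] that by (auto split: if_splits dest: fl_lincomb2_zero)
  have qp: "W' $$ (q, p) = 0" using rows[of p] pq by auto
  have set_pq: "j div b \<in> {p div b, p div b + 1, N - 1}" "j < p \<longrightarrow> q \<le> j"
    if j: "j < b * N" "W $$ (p, j) \<noteq> 0 \<or> W $$ (q, j) \<noteq> 0" for j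
  proof -
    have pN: "p < b * N" using pq by auto
    from j(2) show "j div b \<in> {p div b, p div b + 1, N - 1}"
    proof
      assume "W $$ (p, j) \<noteq> 0"
      from elim_shapeD(1)[OF sh pN j(1) this] show ?thesis by (auto split: if_splits)
    next
      assume "W $$ (q, j) \<noteq> 0"
      from elim_shapeD(1)[OF sh pq(2) j(1) this] blk show ?thesis by (auto split: if_splits)
    qed
    from j(2) show "j < p \<longrightarrow> q \<le> j"
      using elim_shapeD(2)[OF sh pN j(1)] elim_shapeD(2)[OF sh pq(2) j(1)] pq by auto
  qed
  show ?thesis unfolding elim_shape_def
  proof (intro allI impI)
    fix i j assume ij: "i < b * N" "j < b * N" "W' $$ (i, j) \<noteq> 0"
    show "elim_admissible b N p (q + 1) i j"
    proof (cases "i = p \<or> i = q")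
      case True
      then have "W $$ (p, j) \<noteq> 0 \<or> W $$ (q, j) \<noteq> 0" using nz ij by auto
      note * = set_pq[OF ij(2) this]
      have "j = p \<longrightarrow> i \<le> p" using True qp ij(3) by auto
      then show ?thesis using * True blk pq by (auto simp: elim_admissible_def)
    next
      case False
      then have "W $$ (i, j) \<noteq> 0" using rows[of j] ij by auto
      from elim_shapeD[OF sh ij(1,2) this] False show ?thesis by (auto simp: elim_admissible_def)
    qed
  qed
qed

text \<open>
  The rows without a rotation lie strictly between the block of \<open>p\<close> and the last block, so their
  pattern does not reach column \<open>p\<close>.
\<close>

lemma elim_shape_skip:
  assumes sh: "elim_shape b N p q W" and pq: "p < q" "q < b * N" and b: "0 < b" "0 < N"
    and blk: "q div b \<noteq> p div b" "q div b \<noteq> N - 1"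
  shows "elim_shape b N p (q + 1) W"
proof -
  have "p div b \<le> q div b" using pq by (intro div_le_mono) auto
  then have "p div b < q div b" using blk by auto
  moreover have "q div b < N" using b pq by (intro block_less)
  ultimately have "W $$ (q, p) = 0"
    using elim_shapeD(1)[OF sh pq(2), of p] pq blk by (cases "W $$ (q, p) = 0") auto
  with sh show ?thesis by (rule elim_shape_zero_entry)
qed

lemma elim_shape_column:
  assumes "run (fl_annihilate \<epsilon>)
      (concat (map (\<lambda>q. if q div b = p div b \<or> b * N \<le> q + b then [(p, q)] else []) [p+1..<a])) W W'"
    and "elim_shape b N p (p + 1) W" "W \<in> carrier_mat (b * N) (b * N + 1)"
    and "p + 1 \<le> a" "a \<le> b * N" and b: "0 < b" "0 < N"
  shows "elim_shape b N p a W' \<and> W' \<in> carrier_mat (b * N) (b * N + 1)"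
  using assms(4,5,1)
proof (induction a arbitrary: W' rule: nat_induct_at_least)
  case base
  then show ?case using assms by simp
next
  case (Suc a)
  let ?L = "concat (map (\<lambda>q. if q div b = p div b \<or> b * N \<le> q + b then [(p, q)] else []) [p+1..<a])"
  let ?l = "if a div b = p div b \<or> b * N \<le> a + b then [(p, a)] else []"
  from Suc.prems Suc.hyps obtain V where V: "run (fl_annihilate \<epsilon>) ?L W V" "run (fl_annihilate \<epsilon>) ?l V W'"
    by (auto simp: run_append)
  from Suc.IH[OF _ V(1)] Suc.prems have sh: "elim_shape b N p a V" "V \<in> carrier_mat (b * N) (b * N + 1)"
    by auto
  have lb: "b * N \<le> a + b \<longleftrightarrow> a div b = N - 1"
    using last_block_iff b Suc.prems by auto
  show ?case
  proof (cases "a div b = p div b \<or> b * N \<le> a + b")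
    case True
    then have "fl_annihilate \<epsilon> (p, a) V W'" using V(2) by auto
    with sh True lb Suc.hyps Suc.prems show ?thesis
      using elim_shape_annihilate[of b N p a V \<epsilon> W'] fl_annihilate_carrier by auto
  next
    case False
    then have "W' = V" using V(2) by auto
    with sh False lb Suc.hyps Suc.prems b show ?thesis
      using elim_shape_skip[of b N p a V] by auto
  qed
qed

text \<open>
  When \<open>p + 1\<close> opens a new block, the last rows must no longer have entries in the block of \<open>p\<close>. All
  columns of that block have been eliminated, so such entries would lie below the diagonal.
\<close>

lemma elim_shape_next:
  assumes sh: "elim_shape b N p (b * N) W" and p: "p + 1 < b * N" and b: "0 < b" "0 < N"
  shows "elim_shape b N (p + 1) (p + 2) W"
  unfolding elim_shape_def
proof (intro allI impI)
  fix i j assume ij: "i < b * N" "j < b * N" "W $$ (i, j) \<noteq> 0"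
  then have sh': "j div b \<in> (if i div b = N - 1 then {p div b, p div b + 1, N - 1}
        else {i div b, i div b + 1, N - 1})" "j < p + 1 \<longrightarrow> i \<le> j"
    using elim_shapeD[OF sh ij] by (auto simp: less_Suc_eq)
  have "(p + 1) div b = p div b \<or> (p + 1) div b = p div b + 1"
    by (simp add: div_Suc)
  moreover have "j div b \<noteq> p div b \<or> j div b = N - 1"
    if "(p + 1) div b = p div b + 1" "i div b = N - 1"
  proof (rule ccontr)
    assume n: "\<not> ?thesis"
    then have "j div b < (p + 1) div b" using that by auto
    then have "j < p + 1" by (metis div_le_mono leD not_le_imp_less)
    then have "i div b \<le> j div b" using sh'(2) by (auto intro: div_le_mono)
    moreover have "j div b < N" using ij b by (intro block_less)
    ultimately show False using n that by auto
  qed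
  ultimately show "elim_admissible b N (p + 1) (p + 2) i j"
    using sh' unfolding elim_admissible_def by (auto split: if_splits)
qed

lemma elim_shape_elimination:
  assumes "run (fl_annihilate \<epsilon>) (concat (map (\<lambda>p. concat (map (\<lambda>q.
      if q div b = p div b \<or> b * N \<le> q + b then [(p, q)] else []) [p+1..<b*N])) [0..<a])) W W'"
    and "elim_shape b N 0 1 W" "W \<in> carrier_mat (b * N) (b * N + 1)"
    and "a \<le> b * N" and b: "0 < b" "0 < N"
  shows "(0 < a \<longrightarrow> elim_shape b N (a - 1) (b * N) W') \<and> (a < b * N \<longrightarrow> elim_shape b N a (a + 1) W') \<and>
    W' \<in> carrier_mat (b * N) (b * N + 1)"
  using assms(1,4)
proof (induction a arbitrary: W')
  case 0
  then show ?case using assms by simp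
next
  case (Suc a)
  then obtain V where V: "run (fl_annihilate \<epsilon>) (concat (map (\<lambda>p. concat (map (\<lambda>q.
      if q div b = p div b \<or> b * N \<le> q + b then [(p, q)] else []) [p+1..<b*N])) [0..<a])) W V"
    "run (fl_annihilate \<epsilon>) (concat (map (\<lambda>q.
      if q div b = a div b \<or> b * N \<le> q + b then [(a, q)] else []) [a+1..<b*N])) V W'"
    by (auto simp: run_append)
  with Suc have "elim_shape b N a (a + 1) V" "V \<in> carrier_mat (b * N) (b * N + 1)" by auto
  from elim_shape_column[OF V(2) this _ _ b] Suc.prems
  have "elim_shape b N a (b * N) W'" "W' \<in> carrier_mat (b * N) (b * N + 1)" by auto
  then show ?case using elim_shape_next[of b N a W'] b by auto
qed

definition cyclic_block_bidiagonal :: "nat \<Rightarrow> nat \<Rightarrow> 'a::zero mat \<Rightarrow> bool" where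
  "cyclic_block_bidiagonal b N W \<longleftrightarrow> (\<forall>i < b * N. \<forall>j < b * N. W $$ (i, j) \<noteq> 0 \<longrightarrow>
     j div b = i div b \<or> j div b = (i div b + 1) mod N)"

text \<open>
  The result has zeros wherever back substitution does not look: below the diagonal and, above it,
  outside the current block, the next one and the last block column.
\<close>

lemma elimination_result:
  assumes "run (fl_annihilate \<epsilon>) (rotation_list b (b * N)) W W'"
    and "cyclic_block_bidiagonal b N W" "W \<in> carrier_mat (b * N) (b * N + 1)" and b: "0 < b" "0 < N"
  shows "W' \<in> carrier_mat (b * N) (b * N + 1)"
    and "\<And>i j. j < i \<Longrightarrow> i < b * N \<Longrightarrow> W' $$ (i, j) = 0"
    and "\<And>i j. i < j \<Longrightarrow> j < b * N \<Longrightarrow> \<not> (j div b \<le> i div b + 1 \<or> b * N \<le> j + b) \<Longrightarrow> W' $$ (i, j) = 0"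
proof -
  have "elim_shape b N 0 1 W" unfolding elim_shape_def
  proof (intro allI impI)
    fix i j assume ij: "i < b * N" "j < b * N" "W $$ (i, j) \<noteq> 0"
    have lt: "i div b < N" using ij b by (intro block_less)
    have "j div b = i div b \<or> j div b = (i div b + 1) mod N"
      using assms(2) ij unfolding cyclic_block_bidiagonal_def by blast
    then show "elim_admissible b N 0 1 i j"
      using lt b unfolding elim_admissible_def by (auto simp: mod_Suc split: if_splits)
  qed
  with assms have *: "(0 < b * N \<longrightarrow> elim_shape b N (b * N - 1) (b * N) W') \<and>
    W' \<in> carrier_mat (b * N) (b * N + 1)"
    using elim_shape_elimination[of \<epsilon> b N "b * N" W W'] by (auto simp: rotation_list_def)
  then show "W' \<in> carrier_mat (b * N) (b * N + 1)" by auto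
  have sh: "elim_shape b N (b * N - 1) (b * N) W'" using * b by auto
  show z: "W' $$ (i, j) = 0" if "j < i" "i < b * N" for i j
  proof (rule ccontr)
    assume nz: "W' $$ (i, j) \<noteq> 0"
    have j: "j < b * N - 1" "j < b * N" using that by auto
    from elim_shapeD(2)[OF sh that(2) j(2) nz j(1)] that(1) show False by simp
  qed
  show "W' $$ (i, j) = 0" if "i < j" "j < b * N" "\<not> (j div b \<le> i div b + 1 \<or> b * N \<le> j + b)" for i j
  proof (rule ccontr)
    assume nz: "W' $$ (i, j) \<noteq> 0"
    have lb: "j div b \<noteq> N - 1" using that last_block_iff[of b N j] b by auto
    have jN: "j div b < N" using that b by (intro block_less)
    have ij: "i div b \<le> j div b" using that by (intro div_le_mono) auto
    then have "i div b \<noteq> N - 1" using lb jN by auto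
    then show False using elim_shapeD(1)[OF sh _ that(2) nz] that lb by auto
  qed
qed

lemma rotation_list_pairs: "(p, q) \<in> set (rotation_list b m) \<Longrightarrow> p < q \<and> q < m"
  by (auto simp: rotation_list_def split: if_splits)

text \<open>
  In each column, the rows to be treated lie in two blocks.
\<close>

lemma length_rotation_list:
  assumes "0 < b"
  shows "length (rotation_list b m) \<le> 2 * b * m"
proof -
  have col: "length (concat (map (\<lambda>q. if q div b = p div b \<or> m \<le> q + b then [(p, q)] else []) [p+1..<m]))
    \<le> 2 * b" for p
  proof -
    have "length (concat (map (\<lambda>q. if q div b = p div b \<or> m \<le> q + b then [(p, q)] else []) xs))
      = length (filter (\<lambda>q. q div b = p div b \<or> m \<le> q + b) xs)" for xs
      by (induction xs) auto
    then have "length (concat (map (\<lambda>q. if q div b = p div b \<or> m \<le> q + b then [(p, q)] else []) [p+1..<m]))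
      = card {q \<in> {p+1..<m}. q div b = p div b \<or> m \<le> q + b}"
      by (simp add: distinct_card[symmetric] Int_def conj_commute)
    also have "\<dots> \<le> card ({b * (p div b)..<b * (p div b) + b} \<union> {m - b..<m})"
    proof (rule card_mono)
      show "{q \<in> {p+1..<m}. q div b = p div b \<or> m \<le> q + b}
        \<subseteq> {b * (p div b)..<b * (p div b) + b} \<union> {m - b..<m}"
      proof
        fix q assume q: "q \<in> {q \<in> {p+1..<m}. q div b = p div b \<or> m \<le> q + b}"
        have "b * (q div b) \<le> q" "q < b * (q div b) + b"
          using assms mult_div_mod_eq[of b q] mod_less_divisor[of b q] by linarith+
        then have blk: "p div b = q div b \<Longrightarrow> q \<in> {b * (p div b)..<b * (p div b) + b}"
          by (simp only: atLeastLessThan_iff)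
        have "p div b \<noteq> q div b \<Longrightarrow> q \<in> {m - b..<m}" using q by auto
        with blk show "q \<in> {b * (p div b)..<b * (p div b) + b} \<union> {m - b..<m}" by blast
      qed
    qed simp
    also have "\<dots> \<le> 2 * b" by (rule card_Un_le[THEN order_trans]) auto
    finally show ?thesis .
  qed
  have "length (rotation_list b m) = (\<Sum>p\<leftarrow>[0..<m]. length (concat (map (\<lambda>q. if q div b = p div b \<or> m
      \<le> q + b then [(p, q)] else []) [p+1..<m])))"
    by (simp add: rotation_list_def length_concat comp_def)
  also have "\<dots> \<le> (\<Sum>p\<leftarrow>[0..<m]. 2 * b)" by (intro sum_list_mono col)
  finally show ?thesis by (simp add: sum_list_triv mult.commute)
qed

section \<open>Residuals of the small systems\<close>

definition aug_res :: "nat \<Rightarrow> (nat \<Rightarrow> 'a::comm_ring_1) \<Rightarrow> 'a mat \<Rightarrow> nat \<Rightarrow> 'a" where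
  "aug_res m x W i = W $$ (i, m) - (\<Sum>j<m. W $$ (i, j) * x j)"

text \<open>
  In the residual at \<open>x\<close>, an error relative to the norms of the columns counts with this weight.
  The vector \<open>x\<close> is the final computed solution, which is fixed during the elimination.
\<close>

definition col_weight :: "nat \<Rightarrow> (nat \<Rightarrow> 'a::real_normed_field) \<Rightarrow> 'a mat \<Rightarrow> real" where
  "col_weight m x W = (\<Sum>j<m. l2 (\<lambda>i. W $$ (i, j)) {..<m} * norm (x j))"

definition aug_weight :: "nat \<Rightarrow> (nat \<Rightarrow> 'a::real_normed_field) \<Rightarrow> 'a mat \<Rightarrow> real" where
  "aug_weight m x W = l2 (\<lambda>i. W $$ (i, m)) {..<m} + col_weight m x W"

lemma col_weight_nonneg: "0 \<le> col_weight m x W"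
  by (auto simp: col_weight_def intro!: sum_nonneg mult_nonneg_nonneg)

lemma aug_weight_nonneg: "0 \<le> aug_weight m x W"
  by (auto simp: aug_weight_def col_weight_nonneg)

text \<open>
  Each of the two changed components has an error of at most \<open>7 \<epsilon>\<close> times the norm of the pair, and
  \<open>7 \<surd>2 < 10\<close>. The entry that is set to zero carries no error, as the exact rotation annihilates
  it, too.
\<close>

lemma fl_annihilate_column_error:
  fixes W W' :: "'a::{real_normed_field, conjugatable_field} mat"
  assumes conj: "\<And>z::'a. z * conjugate z = of_real ((norm z)\<^sup>2)"
    and ann: "fl_annihilate \<epsilon> (p, q) W W'" and W: "W \<in> carrier_mat m (m + 1)"
    and pq: "p < q" "q < m" and nz: "W $$ (q, p) \<noteq> 0" and \<epsilon>: "0 \<le> \<epsilon>" "\<epsilon> \<le> 1/10"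
  obtains c s where "(norm c)\<^sup>2 + (norm s)\<^sup>2 = 1"
    and "\<And>j. j \<le> m \<Longrightarrow> l2 (\<lambda>i. rot c s p q (\<lambda>i. W $$ (i, j)) i - W' $$ (i, j)) {..<m}
      \<le> 10 * \<epsilon> * l2 (\<lambda>i. W $$ (i, j)) {..<m}"
proof -
  from ann W nz obtain c' s' where r: "fl_rotation \<epsilon> (W $$ (p, p)) (W $$ (q, p)) c' s'" and
    rows: "\<And>j. j < m + 1 \<Longrightarrow>
        fl_lincomb2 \<epsilon> (conjugate c') (W $$ (p, j)) (conjugate s') (W $$ (q, j)) (W' $$ (p, j)) \<and>
        (if j = p then W' $$ (q, j) = 0
         else fl_lincomb2 \<epsilon> (- s') (W $$ (p, j)) c' (W $$ (q, j)) (W' $$ (q, j))) \<and>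
        (\<forall>i < m. i \<noteq> p \<longrightarrow> i \<noteq> q \<longrightarrow> W' $$ (i, j) = W $$ (i, j))"
    by (auto simp: fl_annihilate_def)
  define \<rho> where "\<rho> = sqrt ((norm (W $$ (p, p)))\<^sup>2 + (norm (W $$ (q, p)))\<^sup>2)"
  define c where "c = W $$ (p, p) / of_real \<rho>"
  define s where "s = W $$ (q, p) / of_real \<rho>"
  note err = fl_rotation_error[OF r nz \<epsilon>, folded \<rho>_def, folded c_def s_def]
  have cs: "(norm c)\<^sup>2 + (norm s)\<^sup>2 = 1"
  proof -
    have "(norm (W $$ (p, p)))\<^sup>2 + (norm (W $$ (q, p)))\<^sup>2 = \<rho>\<^sup>2" by (simp add: \<rho>_def)
    then show ?thesis using err(1)
      by (simp add: c_def s_def norm_divide power_divide add_divide_distrib[symmetric])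
  qed
  note nc = norm_conjugate[OF conj]
  have cdiff: "conjugate x - conjugate y = conjugate (x - y)" for x y :: 'a
    using conjugate_dist_add[of x "- y"] by (simp add: conjugate_neg)
  have errc: "norm (conjugate c' - conjugate c) \<le> 4 * \<epsilon> * norm (conjugate c)"
    "norm (conjugate s' - conjugate s) \<le> 4 * \<epsilon> * norm (conjugate s)"
    "norm (- s' - - s) \<le> 4 * \<epsilon> * norm (- s)"
    using err(2,3) unfolding cdiff nc minus_diff_minus norm_minus_cancel by blast+
  have "l2 (\<lambda>i. rot c s p q (\<lambda>i. W $$ (i, j)) i - W' $$ (i, j)) {..<m}
      \<le> 10 * \<epsilon> * l2 (\<lambda>i. W $$ (i, j)) {..<m}" if j: "j \<le> m" for j
  proof -
    let ?x = "W $$ (p, j)" and ?y = "W $$ (q, j)"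
    let ?d = "\<lambda>i. rot c s p q (\<lambda>i. W $$ (i, j)) i - W' $$ (i, j)"
    define S where "S = sqrt ((norm ?x)\<^sup>2 + (norm ?y)\<^sup>2)"
    have S0: "0 \<le> S" by (simp add: S_def)
    have S2: "S\<^sup>2 = (norm ?x)\<^sup>2 + (norm ?y)\<^sup>2" by (simp add: S_def)
    have cauchy: "a * norm ?x + b * norm ?y \<le> S" if "a\<^sup>2 + b\<^sup>2 = 1" for a b :: real
    proof (rule power2_le_imp_le[OF _ S0])
      have lagrange: "(a * u + b * v)\<^sup>2 + (a * v - b * u)\<^sup>2 = (a\<^sup>2 + b\<^sup>2) * (u\<^sup>2 + v\<^sup>2)" for u v
        by (simp add: power2_eq_square algebra_simps)
      have "(a * norm ?x + b * norm ?y)\<^sup>2 + (a * norm ?y - b * norm ?x)\<^sup>2 = (a\<^sup>2 + b\<^sup>2) * S\<^sup>2"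
        unfolding S2 by (rule lagrange)
      then have "(a * norm ?x + b * norm ?y)\<^sup>2 + (a * norm ?y - b * norm ?x)\<^sup>2 = S\<^sup>2"
        using that by simp
      then show "(a * norm ?x + b * norm ?y)\<^sup>2 \<le> S\<^sup>2"
        using zero_le_power2[of "a * norm ?y - b * norm ?x"] by linarith
    qed
    have rj: "j < m + 1" using j by simp
    have "norm (?d p) \<le> 7 * \<epsilon> * (norm c * norm ?x + norm s * norm ?y)"
      using fl_lincomb2_error[OF conjunct1[OF rows[OF rj]] \<epsilon> errc(1,2)]
      unfolding nc norm_minus_commute[of "W' $$ (p, j)"] by (simp add: rot_def)
    also have "\<dots> \<le> 7 * \<epsilon> * S" using cauchy[OF cs] \<epsilon> by (intro mult_left_mono) auto
    finally have dp: "norm (?d p) \<le> 7 * \<epsilon> * S" .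
    have dq: "norm (?d q) \<le> 7 * \<epsilon> * S"
    proof (cases "j = p")
      case True
      then have "?d q = 0" using rows[OF rj] pq by (simp add: rot_def c_def s_def)
      then show ?thesis using S0 \<epsilon> by simp
    next
      case False
      then have "fl_lincomb2 \<epsilon> (- s') ?x c' ?y (W' $$ (q, j))" using rows[OF rj] by simp
      from fl_lincomb2_error[OF this \<epsilon> errc(3) err(2)]
      have "norm (?d q) \<le> 7 * \<epsilon> * (norm s * norm ?x + norm c * norm ?y)"
        unfolding norm_minus_cancel norm_minus_commute[of "W' $$ (q, j)"] using pq by (simp add: rot_def)
      also have "\<dots> \<le> 7 * \<epsilon> * S" using cauchy[of "norm s" "norm c"] cs \<epsilon>
        by (intro mult_left_mono) (auto simp: add.commute)
      finally show ?thesis .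
    qed
    have pm: "p < m" "p \<noteq> q" using pq by auto
    have other: "?d i = 0" if "i < m" "i \<noteq> p" "i \<noteq> q" for i
      using rows[OF rj] that by (simp add: rot_def)
    have "(\<Sum>i<m. (norm (?d i))\<^sup>2) = (norm (?d p))\<^sup>2 + (norm (?d q))\<^sup>2"
      using other by (simp add: sum_split_pair[OF pm(1) pq(2) pm(2)])
    also have "\<dots> \<le> (7 * \<epsilon> * S)\<^sup>2 + (7 * \<epsilon> * S)\<^sup>2"
      using dp dq by (intro add_mono power_mono) auto
    also have "\<dots> \<le> (10 * \<epsilon>)\<^sup>2 * S\<^sup>2"
      by (simp add: power_mult_distrib)
    also have "\<dots> \<le> (10 * \<epsilon>)\<^sup>2 * (\<Sum>i<m. (norm (W $$ (i, j)))\<^sup>2)"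
      unfolding S2 sum_split_pair[OF pm(1) pq(2) pm(2)]
      by (intro mult_left_mono) (auto intro: sum_nonneg)
    also have "\<dots> = (10 * \<epsilon> * l2 (\<lambda>i. W $$ (i, j)) {..<m})\<^sup>2"
      by (simp add: power_mult_distrib l2_power2)
    finally have "(l2 ?d {..<m})\<^sup>2 \<le> (10 * \<epsilon> * l2 (\<lambda>i. W $$ (i, j)) {..<m})\<^sup>2"
      by (simp only: l2_power2)
    then show ?thesis by (rule power2_le_imp_le) (use \<epsilon> in simp)
  qed
  with cs show ?thesis by (rule that)
qed

text \<open>
  The exact rotation preserves the norm of the residual. The computed matrix differs from the exactly
  rotated one by small multiples of the column norms, and these enter the residual with the weights
  \<open>norm (x j)\<close>.
\<close>

lemma fl_annihilate_residual:
  fixes W W' :: "'a::{real_normed_field, conjugatable_field} mat"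
  assumes conj: "\<And>z::'a. z * conjugate z = of_real ((norm z)\<^sup>2)"
    and ann: "fl_annihilate \<epsilon> (p, q) W W'" and W: "W \<in> carrier_mat m (m + 1)"
    and pq: "p < q" "q < m" and \<epsilon>: "0 \<le> \<epsilon>" "\<epsilon> \<le> 1/10"
  shows "aug_weight m x W' \<le> (1 + 10 * \<epsilon>) * aug_weight m x W \<and>
    l2 (aug_res m x W) {..<m} \<le> l2 (aug_res m x W') {..<m} + 10 * \<epsilon> * aug_weight m x W"
proof (cases "W $$ (q, p) = 0")
  case True
  then have "W' = W" using ann by (simp add: fl_annihilate_def)
  then show ?thesis using aug_weight_nonneg[of m x W] \<epsilon> by (auto simp: algebra_simps)
next
  case False
  let ?w = "\<lambda>j. l2 (\<lambda>i. W $$ (i, j)) {..<m}" and ?w' = "\<lambda>j. l2 (\<lambda>i. W' $$ (i, j)) {..<m}"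
  obtain c s where cs: "(norm c)\<^sup>2 + (norm s)\<^sup>2 = 1"
    and err: "\<And>j. j \<le> m \<Longrightarrow> l2 (\<lambda>i. rot c s p q (\<lambda>i. W $$ (i, j)) i - W' $$ (i, j)) {..<m}
      \<le> 10 * \<epsilon> * ?w j"
    by (rule fl_annihilate_column_error[OF conj ann W pq False \<epsilon>]) blast
  have pm: "p < m" "q < m" "p \<noteq> q" using pq by auto
  note iso = rot_isometry[OF conj cs pm]
  define d where "d j i = rot c s p q (\<lambda>i. W $$ (i, j)) i - W' $$ (i, j)" for j i
  have err': "l2 (d j) {..<m} \<le> 10 * \<epsilon> * ?w j" if "j \<le> m" for j
    using err[OF that] by (simp add: d_def)
  have col: "?w' j \<le> (1 + 10 * \<epsilon>) * ?w j" if "j \<le> m" for j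
  proof -
    have "?w' j = l2 (\<lambda>i. rot c s p q (\<lambda>i. W $$ (i, j)) i + - d j i) {..<m}" by (simp add: d_def)
    also have "\<dots> \<le> l2 (rot c s p q (\<lambda>i. W $$ (i, j))) {..<m} + l2 (\<lambda>i. - d j i) {..<m}"
      by (rule l2_triangle)
    also have "\<dots> \<le> (1 + 10 * \<epsilon>) * ?w j"
      using err'[OF that] by (simp add: iso algebra_simps)
    finally show ?thesis .
  qed
  have "aug_weight m x W' \<le> (1 + 10 * \<epsilon>) * ?w m + (\<Sum>j<m. ((1 + 10 * \<epsilon>) * ?w j) * norm (x j))"
    unfolding aug_weight_def col_weight_def using col
    by (intro add_mono sum_mono mult_right_mono) auto
  also have "\<dots> = (1 + 10 * \<epsilon>) * aug_weight m x W"
    unfolding aug_weight_def col_weight_def by (simp add: distrib_left sum_distrib_left mult.assoc)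
  finally have 1: "aug_weight m x W' \<le> (1 + 10 * \<epsilon>) * aug_weight m x W" .
  have split: "rot c s p q (aug_res m x W) i
      = aug_res m x W' i + (d m i + - (\<Sum>j<m. d j i * x j))" for i
  proof -
    have "rot c s p q (aug_res m x W) i
      = rot c s p q (\<lambda>i. W $$ (i, m)) i - (\<Sum>j<m. rot c s p q (\<lambda>i. W $$ (i, j)) i * x j)"
      by (simp add: rot_def aug_res_def sum_distrib_left algebra_simps sum.distrib sum_subtractf sum_negf)
    then show ?thesis
      by (simp add: aug_res_def d_def algebra_simps sum.distrib sum_subtractf)
  qed
  have "l2 (aug_res m x W) {..<m} = l2 (rot c s p q (aug_res m x W)) {..<m}" by (simp add: iso)
  also have "\<dots> \<le> l2 (aug_res m x W') {..<m} + l2 (\<lambda>i. d m i + - (\<Sum>j<m. d j i * x j)) {..<m}"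
    unfolding split by (rule l2_triangle)
  also have "l2 (\<lambda>i. d m i + - (\<Sum>j<m. d j i * x j)) {..<m}
      \<le> l2 (d m) {..<m} + l2 (\<lambda>i. - (\<Sum>j<m. d j i * x j)) {..<m}" by (rule l2_triangle)
  also have "l2 (\<lambda>i. - (\<Sum>j<m. d j i * x j)) {..<m} \<le> (\<Sum>j<m. l2 (d j) {..<m} * norm (x j))"
    unfolding l2_uminus by (rule l2_lincomb) simp
  also have "l2 (d m) {..<m} + (\<Sum>j<m. l2 (d j) {..<m} * norm (x j))
      \<le> 10 * \<epsilon> * ?w m + (\<Sum>j<m. (10 * \<epsilon> * ?w j) * norm (x j))"
    using err' by (intro add_mono sum_mono mult_right_mono) auto
  also have "\<dots> = 10 * \<epsilon> * aug_weight m x W"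
    unfolding aug_weight_def col_weight_def by (simp add: distrib_left sum_distrib_left mult.assoc)
  finally show ?thesis using 1 by simp
qed

lemma elimination_residual:
  fixes W W' :: "'a::{real_normed_field, conjugatable_field} mat"
  assumes conj: "\<And>z::'a. z * conjugate z = of_real ((norm z)\<^sup>2)" and \<epsilon>: "0 \<le> \<epsilon>" "\<epsilon> \<le> 1/10"
    and "run (fl_annihilate \<epsilon>) L W W'" "W \<in> carrier_mat m (m + 1)"
    "\<And>p q. (p, q) \<in> set L \<Longrightarrow> p < q \<and> q < m"
  shows "aug_weight m x W' \<le> (1 + 10 * \<epsilon>) ^ length L * aug_weight m x W \<and>
    l2 (aug_res m x W) {..<m} \<le> l2 (aug_res m x W') {..<m}
      + ((1 + 10 * \<epsilon>) ^ length L - 1) * aug_weight m x W"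
  using assms(4-)
proof (induction L arbitrary: W)
  case (Cons a L)
  obtain p q where a: "a = (p, q)" by force
  from Cons.prems obtain V where V: "fl_annihilate \<epsilon> (p, q) W V" "run (fl_annihilate \<epsilon>) L V W'"
    by (auto simp: a)
  have pq: "p < q" "q < m" using Cons.prems by (auto simp: a)
  note 1 = fl_annihilate_residual[OF conj V(1) Cons.prems(2) pq \<epsilon>, of x]
  have V': "V \<in> carrier_mat m (m + 1)" by (rule fl_annihilate_carrier[OF V(1) Cons.prems(2)])
  have pqL: "p < q \<and> q < m" if "(p, q) \<in> set L" for p q
    using Cons.prems(3)[of p q] that by auto
  note 2 = Cons.IH[OF V(2) V' pqL]
  let ?e = "1 + 10 * \<epsilon>" and ?k = "length L"
  have ge: "1 \<le> ?e ^ ?k" using \<epsilon> by simp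
  have "?e ^ ?k * aug_weight m x V \<le> ?e ^ ?k * (?e * aug_weight m x W)"
    using 1 ge by (intro mult_left_mono) auto
  moreover have "(?e ^ ?k - 1) * aug_weight m x V \<le> (?e ^ ?k - 1) * (?e * aug_weight m x W)"
    using 1 ge by (intro mult_left_mono) auto
  ultimately show ?case using 1 2 by (auto simp: algebra_simps)
qed simp

text \<open>
  Multiplying back by the diagonal entry undoes the division up to one rounding. The row equation
  then holds up to \<open>m + 3\<close> roundings: at most \<open>m + 1\<close> in the sum of products, one in the subtraction
  and one in the division.
\<close>

lemma fl_back_subst_row:
  fixes W :: "'a::real_normed_field mat"
  assumes bs: "fl_back_subst b \<epsilon> m W x" and i: "i < m" and \<epsilon>: "0 \<le> \<epsilon>"
    and lower: "\<And>j. j < i \<Longrightarrow> W $$ (i, j) = 0"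
    and upper: "\<And>j. i < j \<Longrightarrow> j < m \<Longrightarrow> \<not> (j div b \<le> i div b + 1 \<or> m \<le> j + b) \<Longrightarrow> W $$ (i, j) = 0"
  shows "norm (aug_res m x W i)
    \<le> ((1 + \<epsilon>) ^ (m + 3) - 1) * (norm (W $$ (i, m)) + (\<Sum>j<m. norm (W $$ (i, j)) * norm (x j)))"
proof -
  define J where "J = {j. i < j \<and> j < m \<and> (j div b \<le> i div b + 1 \<or> m \<le> j + b)}"
  from bs i obtain v w where vw: "fl_sum_of \<epsilon> (\<lambda>j. fl_mul \<epsilon> (W $$ (i, j)) (x j)) J v"
    "fl_sub \<epsilon> (W $$ (i, m)) v w" "fl_div \<epsilon> w (W $$ (i, i)) (x i)"
    by (auto simp: fl_back_subst_def J_def)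
  have J: "J \<subseteq> {..<m} - {i}" "finite J" by (auto simp: J_def)
  have "card J \<le> m" using card_mono[of "{..<m}" J] J by (auto simp: subset_iff)
  define s where "s = (\<Sum>j\<in>J. W $$ (i, j) * x j)"
  define S where "S = (\<Sum>j\<in>J. norm (W $$ (i, j)) * norm (x j))"
  have "close \<epsilon> (m + 1) S s v"
    unfolding s_def S_def
    by (rule close_fl_sum_of[OF vw(1) close_fl_mul_exact \<epsilon>]) (use \<open>card J \<le> m\<close> \<epsilon> in auto)
  then have "close \<epsilon> (m + 1) S (- s) (- v)" by (rule close_uminus)
  moreover have "close \<epsilon> (m + 1) (norm (W $$ (i, m))) (W $$ (i, m)) (W $$ (i, m))"
    by (rule close_mono[OF close_exact]) (use \<epsilon> in auto)
  ultimately have "close \<epsilon> (m + 1) (norm (W $$ (i, m)) + S) (W $$ (i, m) - s) (W $$ (i, m) - v)"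
    using close_plus by fastforce
  from close_round[OF this] vw(2) \<epsilon>
  have w: "close \<epsilon> (m + 2) (norm (W $$ (i, m)) + S) (W $$ (i, m) - s) w"
    by (simp add: fl_sub_def)
  from vw(3) obtain \<delta> where \<delta>: "norm \<delta> \<le> \<epsilon>" "x i = w / W $$ (i, i) * (1 + \<delta>)" "W $$ (i, i) \<noteq> 0"
    by (auto simp: fl_div_def fl_round_def)
  then have "fl_round \<epsilon> w (W $$ (i, i) * x i)" by (auto simp: fl_round_def)
  from close_round[OF w this \<epsilon>]
  have "norm (W $$ (i, i) * x i - (W $$ (i, m) - s)) \<le> ((1 + \<epsilon>) ^ (m + 3) - 1) * (norm (W $$ (i, m)) + S)"
    by (simp add: close_def eval_nat_numeral)
  also have "W $$ (i, i) * x i - (W $$ (i, m) - s) = - aug_res m x W i"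
  proof -
    have z: "W $$ (i, j) = 0" if "j < m" "j \<notin> insert i J" for j
      using that lower[of j] upper[of j] by (cases "i < j") (auto simp: J_def)
    have "(\<Sum>j<m. W $$ (i, j) * x j) = (\<Sum>j\<in>insert i J. W $$ (i, j) * x j)"
      using J i z by (intro sum.mono_neutral_right) auto
    also have "\<dots> = W $$ (i, i) * x i + s" using J
      by (subst sum.insert) (auto simp: s_def)
    finally show ?thesis by (simp add: aug_res_def)
  qed
  also have "S \<le> (\<Sum>j<m. norm (W $$ (i, j)) * norm (x j))"
    unfolding S_def using J by (intro sum_mono2) auto
  finally show ?thesis using \<epsilon> by (simp add: mult_left_mono)
qed

lemma power_one_plus_le:
  assumes "0 \<le> y" "real k * y \<le> 1"
  shows "(1 + y) ^ k - 1 \<le> 2 * (real k * y)"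
proof -
  have "(1 + y) ^ k \<le> exp y ^ k" using assms by (intro power_mono exp_ge_add_one_self) auto
  also have "\<dots> = exp (real k * y)" by (simp add: exp_of_nat_mult)
  also have "\<dots> \<le> 1 + real k * y + (real k * y)\<^sup>2" using assms by (intro exp_bound) auto
  also have "(real k * y)\<^sup>2 \<le> real k * y" using assms by (auto simp: power2_eq_square intro: mult_left_le)
  finally show ?thesis by (simp add: algebra_simps)
qed

text \<open>
  A first bound contains the norm of the right-hand side, which is not controlled by the matrix. It is
  at most the residual plus \<open>col_weight m x W\<close>, however, so it can be moved to the other side of the
  inequality when the error factor is at most \<open>1/4\<close>. The factor is a power of \<open>1 + 10 \<epsilon>\<close> with
  exponent at most \<open>8 m\<close>: there are at most \<open>4 m\<close> rotations, and \<open>m + 3\<close> further roundings.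
\<close>

lemma small_solve_residual:
  fixes W :: "'a::{real_normed_field, conjugatable_field} mat"
  assumes conj: "\<And>z::'a. z * conjugate z = of_real ((norm z)\<^sup>2)"
    and solve: "fl_small_solve b \<epsilon> m W x" and m: "m = b * N" "0 < N" and b: "0 < b" "b \<le> 2"
    and W: "W \<in> carrier_mat m (m + 1)" "cyclic_block_bidiagonal b N W"
    and \<epsilon>: "0 \<le> \<epsilon>" "640 * real m * \<epsilon> \<le> 1"
  shows "l2 (aug_res m x W) {..<m} \<le> 480 * real m * \<epsilon> * col_weight m x W"
    and "l2 (\<lambda>i. W $$ (i, m)) {..<m} \<le> 2 * col_weight m x W"
proof -
  have m1: "1 \<le> m" using m b by (simp add: Suc_le_eq)
  have "\<epsilon> \<le> real m * \<epsilon>" using mult_right_mono[of 1 "real m" \<epsilon>] m1 \<epsilon> by simp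
  then have \<epsilon>': "\<epsilon> \<le> 1/10" using \<epsilon> by linarith
  from solve obtain W' where W': "run (fl_annihilate \<epsilon>) (rotation_list b m) W W'"
    "fl_back_subst b \<epsilon> m W' x" by (auto simp: fl_small_solve_def)
  let ?K = "length (rotation_list b m)" and ?e = "1 + 10 * \<epsilon>"
  note el = elimination_residual[where x = x, OF conj \<epsilon>(1) \<epsilon>' W'(1) W(1)
      rotation_list_pairs[of _ _ b m]]
  note shape = elimination_result[OF W'(1)[unfolded m] W(2) W(1)[unfolded m] b(1) m(2), folded m(1)]
  let ?T = "aug_weight m x W" and ?T' = "aug_weight m x W'"
  define g where "g = (1 + \<epsilon>) ^ (m + 3)"
  have g1: "1 \<le> g" unfolding g_def using \<epsilon> by simp
  have "l2 (aug_res m x W') {..<m}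
    \<le> L2_set (\<lambda>i. (g - 1) * (norm (W' $$ (i, m)) + (\<Sum>j<m. norm (W' $$ (i, j)) * norm (x j)))) {..<m}"
    using fl_back_subst_row[OF W'(2) _ \<epsilon>(1)] shape(2,3)
    by (intro L2_set_mono) (auto simp: g_def)
  also have "\<dots> = (g - 1) * L2_set (\<lambda>i. norm (W' $$ (i, m)) + (\<Sum>j<m. norm (W' $$ (i, j)) * norm (x j))) {..<m}"
    using g1 by (simp add: L2_set_right_distrib)
  also have "\<dots> \<le> (g - 1) * (l2 (\<lambda>i. W' $$ (i, m)) {..<m}
      + L2_set (\<lambda>i. \<Sum>j<m. norm (W' $$ (i, j)) * norm (x j)) {..<m})"
    using g1 by (intro mult_left_mono L2_set_triangle_ineq) auto
  also have "L2_set (\<lambda>i. \<Sum>j<m. norm (W' $$ (i, j)) * norm (x j)) {..<m}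
      \<le> (\<Sum>j<m. L2_set (\<lambda>i. norm (W' $$ (i, j)) * norm (x j)) {..<m})"
    by (rule L2_set_sum_le) simp
  also have "(\<Sum>j<m. L2_set (\<lambda>i. norm (W' $$ (i, j)) * norm (x j)) {..<m}) = col_weight m x W'"
    by (simp add: col_weight_def L2_set_left_distrib)
  finally have bs: "l2 (aug_res m x W') {..<m} \<le> (g - 1) * ?T'"
    using g1 by (simp add: aug_weight_def mult_left_mono)
  have ek: "1 \<le> ?e ^ ?K" using \<epsilon> by simp
  have "(g - 1) * ?T' \<le> (g - 1) * (?e ^ ?K * ?T)" using el g1 by (intro mult_left_mono) auto
  then have "l2 (aug_res m x W) {..<m} \<le> (?e ^ ?K * g - 1) * ?T"
    using el bs by (auto simp: algebra_simps)
  also have "\<dots> \<le> (160 * real m * \<epsilon>) * ?T"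
  proof (rule mult_right_mono[OF _ aug_weight_nonneg])
    have "2 * b * m \<le> 4 * m" using b by simp
    then have K: "?K + (m + 3) \<le> 8 * m" using length_rotation_list[OF b(1), of m] m1 by linarith
    have "?e ^ ?K * g \<le> ?e ^ ?K * ?e ^ (m + 3)"
      unfolding g_def using \<epsilon> by (intro mult_left_mono power_mono) auto
    also have "\<dots> \<le> ?e ^ (8 * m)"
      unfolding power_add[symmetric] using K \<epsilon> by (intro power_increasing) auto
    finally have "?e ^ ?K * g - 1 \<le> ?e ^ (8 * m) - 1" by simp
    also have "\<dots> \<le> 2 * (real (8 * m) * (10 * \<epsilon>))"
      using \<epsilon> by (intro power_one_plus_le) auto
    finally show "?e ^ ?K * g - 1 \<le> 160 * real m * \<epsilon>" by simp
  qed
  finally have main: "l2 (aug_res m x W) {..<m} \<le> (160 * real m * \<epsilon>) * ?T" .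
  let ?S = "col_weight m x W" and ?R = "l2 (aug_res m x W) {..<m}" and ?\<beta> = "l2 (\<lambda>i. W $$ (i, m)) {..<m}"
  have "?\<beta> = l2 (\<lambda>i. aug_res m x W i + (\<Sum>j<m. W $$ (i, j) * x j)) {..<m}"
    by (simp add: aug_res_def)
  also have "\<dots> \<le> ?R + l2 (\<lambda>i. \<Sum>j<m. W $$ (i, j) * x j) {..<m}" by (rule l2_triangle)
  also have "l2 (\<lambda>i. \<Sum>j<m. W $$ (i, j) * x j) {..<m} \<le> ?S"
    unfolding col_weight_def by (rule l2_lincomb) simp
  finally have \<beta>: "?\<beta> \<le> ?R + ?S" by simp
  \<comment> \<open>The right-hand side is absorbed here: \<open>R \<le> \<theta> (R + 2 S)\<close> and \<open>\<theta> \<le> 1/4\<close>.\<close>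
  define \<theta> where "\<theta> = 160 * real m * \<epsilon>"
  have th: "0 \<le> \<theta>" "\<theta> \<le> 1/4" using \<epsilon> by (auto simp: \<theta>_def)
  have R0: "0 \<le> ?R" "0 \<le> ?S" by (auto simp: col_weight_nonneg)
  have "?R \<le> \<theta> * (?\<beta> + ?S)" using main by (simp add: \<theta>_def aug_weight_def)
  also have "\<dots> \<le> \<theta> * (?R + 2 * ?S)" using \<beta> th by (intro mult_left_mono) auto
  also have "\<dots> \<le> 1/4 * ?R + 2 * (\<theta> * ?S)"
    using mult_right_mono[OF th(2) R0(1)] by (simp add: algebra_simps)
  finally have R: "?R \<le> 3 * (\<theta> * ?S)" using mult_nonneg_nonneg[OF th(1) R0(2)] by linarith
  then show "?R \<le> 480 * real m * \<epsilon> * ?S" by (simp add: \<theta>_def)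
  have "\<theta> * ?S \<le> 1/4 * ?S" using th R0 by (intro mult_right_mono) auto
  then show "?\<beta> \<le> 2 * ?S" using R \<beta> R0 by linarith
qed

section \<open>The two forms of the small systems\<close>

lemma sum_if_two:
  fixes f g :: "nat \<Rightarrow> 'a::comm_monoid_add"
  assumes "a < N" "c < N"
  shows "(\<Sum>l<N. (if l = a then f l else 0) + (if l = c then g l else 0)) = f a + g c"
  using assms by (simp add: sum.distrib)

lemma col_weight_row_bound:
  assumes "\<And>i. i < m \<Longrightarrow> (\<Sum>j<m. norm (W $$ (i, j))) \<le> c" "0 \<le> c"
  shows "col_weight m x W \<le> sqrt m * c * l2 x {..<m}"
proof -
  have "L2_set (\<lambda>i. L2_set (\<lambda>j. norm (W $$ (i, j))) {..<m}) {..<m} \<le> sqrt (card {..<m}) * c"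
  proof (rule l2_const_bound)
    fix i assume "i \<in> {..<m}"
    then show "L2_set (\<lambda>j. norm (W $$ (i, j))) {..<m} \<le> c"
      using L2_set_le_sum[of "{..<m}" "\<lambda>j. norm (W $$ (i, j))"] assms(1)[of i] by auto
  qed (use assms in auto)
  then have "L2_set (\<lambda>i. L2_set (\<lambda>j. norm (W $$ (i, j))) {..<m}) {..<m} * l2 x {..<m}
      \<le> sqrt m * c * l2 x {..<m}" by (intro mult_right_mono) auto
  with sum_col_le[of "\<lambda>j i. W $$ (i, j)" "{..<m}" x "{..<m}"] show ?thesis
    unfolding col_weight_def by linarith
qed

lemma complex_conj: "z * conjugate z = of_real ((norm z)\<^sup>2)" for z :: complex
  by (simp only: conjugate_complex_def complex_norm_square)

lemma real_conj: "z * conjugate z = of_real ((norm z)\<^sup>2)" for z :: real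
  by (simp add: power2_eq_square)

text \<open>
  For \<open>N \<ge> 2\<close> the two coefficients of an equation occupy different entries of the matrix, which is
  therefore formed without rounding.
\<close>

lemma small_system_T:
  assumes sys: "fl_system_T \<epsilon>' N p g b W" and solve: "fl_small_solve 1 \<epsilon> N W x"
    and N: "2 \<le> N" and P: "\<And>q. q < N \<Longrightarrow> norm (p q) \<le> P" "\<And>q. q < N \<Longrightarrow> norm (g q) \<le> P"
    and \<epsilon>: "0 \<le> \<epsilon>" "640 * real N * \<epsilon> \<le> 1"
  shows "l2 (\<lambda>q. b q - (p q * x q - g q * x ((q + 1) mod N))) {..<N}
      \<le> 480 * real N * \<epsilon> * (sqrt N * (2 * P) * l2 x {..<N})"
    and "l2 b {..<N} \<le> 2 * (sqrt N * (2 * P) * l2 x {..<N})"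
proof -
  have P0: "0 \<le> P" using P(1)[of 0] N norm_ge_zero[of "p 0"] by linarith
  have W: "W \<in> carrier_mat N (N + 1)" and rhs: "\<And>q. q < N \<Longrightarrow> W $$ (q, N) = b q"
    using sys by (auto simp: fl_system_T_def)
  have ent: "W $$ (q, l) = (if l = q then p q else 0) + (if l = (q + 1) mod N then - g q else 0)"
    if "q < N" "l < N" for q l
  proof -
    have "q \<noteq> (q + 1) mod N" using N that by (auto simp: mod_Suc)
    then show ?thesis using sys that by (auto simp: fl_system_T_def)
  qed
  have cyc: "cyclic_block_bidiagonal 1 N W"
    unfolding cyclic_block_bidiagonal_def by (auto simp: ent split: if_splits)
  have "0 < N" using N by simp
  have res: "aug_res N x W q = b q - (p q * x q - g q * x ((q + 1) mod N))" if q: "q < N" for q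
  proof -
    have "(\<Sum>l<N. W $$ (q, l) * x l) = (\<Sum>l<N. (if l = q then p q * x l else 0)
        + (if l = (q + 1) mod N then - g q * x l else 0))"
      using q by (intro sum.cong) (auto simp: ent algebra_simps)
    also have "\<dots> = p q * x q + - g q * x ((q + 1) mod N)"
      using q N by (intro sum_if_two) auto
    finally show ?thesis using q by (simp add: aug_res_def rhs)
  qed
  have rows: "(\<Sum>l<N. norm (W $$ (q, l))) \<le> 2 * P" if q: "q < N" for q
  proof -
    have "(\<Sum>l<N. norm (W $$ (q, l))) \<le> (\<Sum>l<N. (if l = q then norm (p q) else 0)
        + (if l = (q + 1) mod N then norm (g q) else 0))"
      using q by (intro sum_mono) (auto simp: ent norm_triangle_ineq4)
    also have "\<dots> = norm (p q) + norm (g q)" using q N by (intro sum_if_two) auto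
    finally show ?thesis using P[OF q] by simp
  qed
  have cw: "col_weight N x W \<le> sqrt N * (2 * P) * l2 x {..<N}"
    using rows P0 by (intro col_weight_row_bound) auto
  note sm = small_solve_residual[OF complex_conj solve, of N, OF _ \<open>0 < N\<close> _ _ W cyc \<epsilon>, simplified]
  have "l2 (\<lambda>q. b q - (p q * x q - g q * x ((q + 1) mod N))) {..<N} = l2 (aug_res N x W) {..<N}"
    by (intro L2_set_cong) (auto simp: res)
  also have "\<dots> \<le> 480 * real N * \<epsilon> * col_weight N x W" by (rule sm(1))
  also have "\<dots> \<le> 480 * real N * \<epsilon> * (sqrt N * (2 * P) * l2 x {..<N})"
    using cw \<epsilon> by (intro mult_left_mono) auto
  finally show "l2 (\<lambda>q. b q - (p q * x q - g q * x ((q + 1) mod N))) {..<N}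
      \<le> 480 * real N * \<epsilon> * (sqrt N * (2 * P) * l2 x {..<N})" .
  have "l2 b {..<N} = l2 (\<lambda>i. W $$ (i, N)) {..<N}" by (intro L2_set_cong) (auto simp: rhs)
  also have "\<dots> \<le> 2 * col_weight N x W" by (rule sm(2))
  finally show "l2 b {..<N} \<le> 2 * (sqrt N * (2 * P) * l2 x {..<N})" using cw by linarith
qed

lemma sum_pairs: "(\<Sum>i<2 * N. f i) = (\<Sum>q<N. f (2 * q) + f (2 * q + 1 :: nat))"
  by (induction N) (auto simp: algebra_simps)

lemma l2_complex_parts:
  fixes f :: "nat \<Rightarrow> real" and z :: "nat \<Rightarrow> complex"
  assumes "\<And>q. q < N \<Longrightarrow> f (2 * q) = Re (z q)" "\<And>q. q < N \<Longrightarrow> f (2 * q + 1) = Im (z q)"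
  shows "l2 f {..<2 * N} = l2 z {..<N}"
proof -
  have "(\<Sum>i<2 * N. (norm (f i))\<^sup>2) = (\<Sum>q<N. (norm (z q))\<^sup>2)"
    unfolding sum_pairs using assms by (intro sum.cong) (auto simp: cmod_power2)
  then show ?thesis by (simp add: L2_set_def)
qed

text \<open>
  For \<open>N = 1\<close> both blocks fall on the same four entries, and their sum is rounded. The matrix \<open>Z\<close>
  in the proof is the one with exact sums; replacing it by \<open>W\<close> changes the residual by at most
  \<open>\<epsilon>\<close> times a weight of the same kind as the other errors.
\<close>

lemma small_system_H:
  assumes sys: "fl_system_H \<epsilon> N K p g b W" and solve: "fl_small_solve 2 \<epsilon> (2 * N) W y"
    and N: "0 < N" and x: "\<And>q. q < N \<Longrightarrow> x q = Complex (y (2 * q)) (y (2 * q + 1))"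
    and P: "\<And>q. q < N \<Longrightarrow> norm (p q) \<le> P" "\<And>q. q < N \<Longrightarrow> norm (g q) \<le> P"
    and \<epsilon>: "0 \<le> \<epsilon>" "1280 * real N * \<epsilon> \<le> 1"
  shows "l2 (\<lambda>q. b q - (p q * x q - g q *
        (if q \<in> K then cnj (x ((q + 1) mod N)) else x ((q + 1) mod N)))) {..<N}
      \<le> 1000 * real N * \<epsilon> * (sqrt (2 * N) * (8 * P) * l2 x {..<N})"
    and "l2 b {..<N} \<le> 2 * (sqrt (2 * N) * (8 * P) * l2 x {..<N})"
proof -
  have P0: "0 \<le> P" using P(1)[of 0] N norm_ge_zero[of "p 0"] by linarith
  define G where "G q i j = (if q \<in> K then cnj_block (- g q) i j else lin_block (- g q) i j)" for q i j
  define Z where "Z r c = (if c div 2 = r div 2 then lin_block (p (r div 2)) (r mod 2) (c mod 2) else 0)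
      + (if c div 2 = (r div 2 + 1) mod N then G (r div 2) (r mod 2) (c mod 2) else 0)" for r c
  have W: "W \<in> carrier_mat (2 * N) (2 * N + 1)"
    and rhs: "\<And>q. q < N \<Longrightarrow> W $$ (2 * q, 2 * N) = Re (b q)"
      "\<And>q. q < N \<Longrightarrow> W $$ (2 * q + 1, 2 * N) = Im (b q)"
    using sys by (auto simp: fl_system_H_def)
  have ent: "norm (W $$ (r, c) - Z r c) \<le> \<epsilon> * norm (Z r c)" if rc: "r < 2 * N" "c < 2 * N" for r c
  proof -
    define q l i j where "q = r div 2" "l = c div 2" "i = r mod 2" "j = c mod 2"
    have q: "q < N" "l < N" "i < 2" "j < 2" and r: "2 * q + i = r" "2 * l + j = c"
      using rc by (auto simp: q_l_i_j_def)
    have *: "if l = q \<and> l = (q + 1) mod N then fl_add \<epsilon> (lin_block (p q) i j) (G q i j) (W $$ (r, c))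
              else W $$ (r, c) =
                (if l = q then lin_block (p q) i j else if l = (q + 1) mod N then G q i j else 0)"
      using sys q unfolding fl_system_H_def Let_def G_def r[symmetric] by blast
    have Z: "Z r c = (if l = q then lin_block (p q) i j else 0)
        + (if l = (q + 1) mod N then G q i j else 0)"
      by (simp add: Z_def q_l_i_j_def)
    show ?thesis
    proof (cases "l = q \<and> l = (q + 1) mod N")
      case True
      with * have "fl_add \<epsilon> (lin_block (p q) i j) (G q i j) (W $$ (r, c))" by simp
      then obtain \<delta> where \<delta>: "\<bar>\<delta>\<bar> \<le> \<epsilon>" "W $$ (r, c) = Z r c * (1 + \<delta>)"
        using True Z by (auto simp: fl_add_def fl_round_def)
      then have "norm (W $$ (r, c) - Z r c) = \<bar>\<delta>\<bar> * norm (Z r c)"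
        by (simp add: algebra_simps abs_mult)
      then show ?thesis using \<delta>(1) by (simp add: mult_right_mono)
    next
      case False
      then have "W $$ (r, c) = Z r c" using * Z by auto
      then show ?thesis using \<epsilon> by simp
    qed
  qed
  have cyc: "cyclic_block_bidiagonal 2 N W"
    unfolding cyclic_block_bidiagonal_def
  proof (intro allI impI, rule ccontr)
    fix i j assume ij: "i < 2 * N" "j < 2 * N" "W $$ (i, j) \<noteq> 0"
      "\<not> (j div 2 = i div 2 \<or> j div 2 = (i div 2 + 1) mod N)"
    then have "Z i j = 0" by (auto simp: Z_def)
    with ent[OF ij(1,2)] ij(3) show False by simp
  qed
  have lin: "\<bar>lin_block a i j\<bar> \<le> norm a" for a i j
    by (auto simp: lin_block_def abs_Re_le_cmod abs_Im_le_cmod)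
  have cnj: "\<bar>cnj_block a i j\<bar> \<le> norm a" for a i j
    by (auto simp: cnj_block_def abs_Re_le_cmod abs_Im_le_cmod)
  have Gle: "\<bar>G q i j\<bar> \<le> norm (g q)" for q i j
    using lin[of "- g q"] cnj[of "- g q"] by (simp add: G_def)
  have Zrow: "(\<Sum>c<2 * N. norm (Z r c)) \<le> 4 * P" if r: "r < 2 * N" for r
  proof -
    let ?q = "r div 2"
    have q: "?q < N" using r by auto
    have le: "norm (Z r c) \<le> (if c div 2 = ?q then P else 0) + (if c div 2 = (?q + 1) mod N then P
        else 0)" for c
    proof -
      have "norm (Z r c) \<le> (if c div 2 = ?q then norm (p ?q) else 0)
          + (if c div 2 = (?q + 1) mod N then norm (g ?q) else 0)"
        unfolding Z_def using lin Gle
        by (intro norm_triangle_ineq[THEN order_trans] add_mono) auto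
      then show ?thesis using P[OF q] by (auto split: if_splits)
    qed
    have "(\<Sum>c<2 * N. norm (Z r c)) \<le> (\<Sum>c<2 * N. (if c div 2 = ?q then P else 0)
        + (if c div 2 = (?q + 1) mod N then P else 0))"
      by (intro sum_mono le)
    also have "\<dots> = (\<Sum>l<N. (if l = ?q then 2 * P else 0) + (if l = (?q + 1) mod N then 2 * P else 0))"
      unfolding sum_pairs by (intro sum.cong) auto
    also have "\<dots> = 2 * P + 2 * P" using q N by (intro sum_if_two) auto
    finally show ?thesis by simp
  qed
  have e1: "\<epsilon> \<le> 1"
    using mult_right_mono[of 1 "real N" \<epsilon>] N \<epsilon> by simp
  have Wrow: "(\<Sum>c<2 * N. norm (W $$ (r, c))) \<le> 8 * P" if r: "r < 2 * N" for r
  proof -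
    have "norm (W $$ (r, c)) \<le> 2 * norm (Z r c)" if c: "c < 2 * N" for c
    proof -
      have "norm (W $$ (r, c)) \<le> norm (Z r c) + norm (W $$ (r, c) - Z r c)"
        using norm_triangle_ineq[of "Z r c" "W $$ (r, c) - Z r c"] by simp
      also have "\<dots> \<le> norm (Z r c) + 1 * norm (Z r c)"
        using ent[OF r c] mult_right_mono[OF e1 norm_ge_zero[of "Z r c"]] by linarith
      finally show ?thesis by simp
    qed
    then have "(\<Sum>c<2 * N. norm (W $$ (r, c))) \<le> (\<Sum>c<2 * N. 2 * norm (Z r c))"
      by (intro sum_mono) auto
    then show ?thesis using Zrow[OF r] by (simp add: sum_distrib_left[symmetric])
  qed
  have yx: "l2 y {..<2 * N} = l2 x {..<N}" by (rule l2_complex_parts) (auto simp: x)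
  define Q where "Q = sqrt (2 * N) * (8 * P) * l2 x {..<N}"
  have Q0: "0 \<le> Q" using P0 by (simp add: Q_def)
  have cw: "col_weight (2 * N) y W \<le> Q"
    using col_weight_row_bound[of "2 * N" W "8 * P" y] Wrow P0 yx by (simp add: Q_def)
  have N2: "640 * real (2 * N) * \<epsilon> \<le> 1" using \<epsilon> by simp
  note sm = small_solve_residual[OF real_conj solve refl N _ _ W cyc \<epsilon>(1) N2, simplified]
  let ?res = "\<lambda>q. b q - (p q * x q - g q *
        (if q \<in> K then cnj (x ((q + 1) mod N)) else x ((q + 1) mod N)))"
  define bb where "bb i = W $$ (i, 2 * N)" for i
  have Suc_double_mod: "Suc (2 * l) mod 2 = 1" for l :: nat by presburger
  have Zsum: "(\<Sum>c<2 * N. Z (2 * q + i) c * y c)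
      = (lin_block (p q) i 0 * y (2 * q) + lin_block (p q) i 1 * y (2 * q + 1))
        + (G q i 0 * y (2 * ((q + 1) mod N)) + G q i 1 * y (2 * ((q + 1) mod N) + 1))"
    if "q < N" "i < 2" for q i
  proof -
    have "(\<Sum>c<2 * N. Z (2 * q + i) c * y c)
      = (\<Sum>l<N. (if l = q then lin_block (p q) i 0 * y (2 * l) + lin_block (p q) i 1 * y (2 * l + 1) else 0)
        + (if l = (q + 1) mod N then G q i 0 * y (2 * l) + G q i 1 * y (2 * l + 1) else 0))"
      unfolding sum_pairs using that
      by (intro sum.cong) (auto simp: Z_def distrib_right Suc_double_mod)
    also have "\<dots> = (lin_block (p q) i 0 * y (2 * q) + lin_block (p q) i 1 * y (2 * q + 1))
        + (G q i 0 * y (2 * ((q + 1) mod N)) + G q i 1 * y (2 * ((q + 1) mod N) + 1))"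
      using that N by (intro sum_if_two) auto
    finally show ?thesis .
  qed
  have "l2 ?res {..<N} = l2 (\<lambda>i. bb i - (\<Sum>c<2 * N. Z i c * y c)) {..<2 * N}"
  proof (rule l2_complex_parts[symmetric])
    fix q assume q: "q < N"
    then have q': "(q + 1) mod N < N" using N by simp
    note xs = x[OF q] x[OF q']
    show "bb (2 * q) - (\<Sum>c<2 * N. Z (2 * q) c * y c) = Re (?res q)"
      using Zsum[OF q, of 0] rhs(1)[OF q] unfolding xs
      by (simp add: bb_def G_def lin_block_def cnj_block_def)
    show "bb (2 * q + 1) - (\<Sum>c<2 * N. Z (2 * q + 1) c * y c) = Im (?res q)"
      using Zsum[OF q, of 1] rhs(2)[OF q] unfolding xs
      by (simp add: bb_def G_def lin_block_def cnj_block_def)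
  qed
  also have "\<dots> = l2 (\<lambda>i. aug_res (2 * N) y W i + (\<Sum>c<2 * N. (W $$ (i, c) - Z i c) * y c)) {..<2 * N}"
    by (simp add: aug_res_def bb_def algebra_simps sum_subtractf)
  also have "\<dots> \<le> l2 (aug_res (2 * N) y W) {..<2 * N}
      + l2 (\<lambda>i. \<Sum>c<2 * N. (W $$ (i, c) - Z i c) * y c) {..<2 * N}" by (rule l2_triangle)
  also have "l2 (\<lambda>i. \<Sum>c<2 * N. (W $$ (i, c) - Z i c) * y c) {..<2 * N}
      \<le> (\<Sum>c<2 * N. l2 (\<lambda>i. W $$ (i, c) - Z i c) {..<2 * N} * norm (y c))" by (rule l2_lincomb) simp
  also have "\<dots> = col_weight (2 * N) y (mat (2 * N) (2 * N) (\<lambda>(i, c). W $$ (i, c) - Z i c))"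
    unfolding col_weight_def
    by (intro sum.cong arg_cong2[where f = "(*)"] L2_set_cong) auto
  also have "\<dots> \<le> sqrt (2 * N) * (\<epsilon> * (4 * P)) * l2 y {..<2 * N}"
  proof (rule col_weight_row_bound)
    fix i assume i: "i < 2 * N"
    have "(\<Sum>j<2 * N. norm (mat (2 * N) (2 * N) (\<lambda>(i, c). W $$ (i, c) - Z i c) $$ (i, j)))
      \<le> (\<Sum>j<2 * N. \<epsilon> * norm (Z i j))" using ent i by (intro sum_mono) auto
    also have "\<dots> \<le> \<epsilon> * (4 * P)"
      unfolding sum_distrib_left[symmetric] using Zrow[OF i] \<epsilon> by (intro mult_left_mono) auto
    finally show "(\<Sum>j<2 * N. norm (mat (2 * N) (2 * N) (\<lambda>(i, c). W $$ (i, c) - Z i c) $$ (i, j)))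
      \<le> \<epsilon> * (4 * P)" .
  qed (use P0 \<epsilon> in simp)
  also have "\<dots> = 1/2 * \<epsilon> * Q" unfolding yx by (simp add: Q_def)
  also have "l2 (aug_res (2 * N) y W) {..<2 * N} \<le> 960 * real N * \<epsilon> * col_weight (2 * N) y W"
    using sm(1) by simp
  also have "\<dots> \<le> 960 * real N * \<epsilon> * Q" using cw \<epsilon> by (intro mult_left_mono) auto
  also have "960 * real N * \<epsilon> * Q + 1/2 * \<epsilon> * Q \<le> 1000 * real N * \<epsilon> * Q"
  proof -
    have "1 * (\<epsilon> * Q) \<le> real N * (\<epsilon> * Q)" using N \<epsilon> Q0 by (intro mult_right_mono) auto
    then show ?thesis using mult_nonneg_nonneg[OF \<epsilon>(1) Q0] by (simp add: algebra_simps)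
  qed
  finally show "l2 ?res {..<N} \<le> 1000 * real N * \<epsilon> * (sqrt (2 * N) * (8 * P) * l2 x {..<N})"
    by (simp add: Q_def)
  have "l2 b {..<N} = l2 (\<lambda>i. W $$ (i, 2 * N)) {..<2 * N}"
    by (rule l2_complex_parts[symmetric]) (use rhs in auto)
  also have "\<dots> \<le> 2 * col_weight (2 * N) y W" using sm(2) by simp
  finally show "l2 b {..<N} \<le> 2 * (sqrt (2 * N) * (8 * P) * l2 x {..<N})"
    using cw by (simp add: Q_def)
qed

section \<open>The final state of the algorithm\<close>

text \<open>
  The positions whose unknowns are determined together at the pair \<open>(i, j)\<close>.
\<close>

definition small_positions :: "nat \<Rightarrow> nat \<Rightarrow> (nat \<times> nat) list" where
  "small_positions i j = (if i = j then [(i, j)] else [(i, j), (j, i)])"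

lemma set_small_positions: "set (small_positions i j) = {(i, j), (j, i)}"
  by (auto simp: small_positions_def)

definition fl_small_block ::
  "star \<Rightarrow> real \<Rightarrow> real \<Rightarrow> nat \<Rightarrow> nat \<Rightarrow> (nat \<Rightarrow> complex) \<Rightarrow> (nat \<Rightarrow> complex) \<Rightarrow> (nat \<Rightarrow> complex)
    \<Rightarrow> (nat \<Rightarrow> complex) \<Rightarrow> bool" where
  "fl_small_block st \<kappa> u r N p g b x \<longleftrightarrow> (case st of
          Transp \<Rightarrow> \<exists>W. fl_system_T (\<kappa> * u) N p g b W \<and> fl_small_solve 1 (\<kappa> * u) N W x
        | ConjTransp \<Rightarrow> \<exists>W y. fl_system_H u N {q. q mod r = r - 1} p g b W \<and>
            fl_small_solve 2 u (2 * N) W y \<and> (\<forall>q<N. x q = Complex (y (2 * q)) (y (2 * q + 1))))"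

text \<open>
  The data of one equation of a small system: \<open>p\<close> and \<open>g\<close> are the computed coefficients, \<open>b\<close> is the
  computed right-hand side.
\<close>

definition fl_equation ::
  "star \<Rightarrow> real \<Rightarrow> nat \<Rightarrow> nat \<Rightarrow> (nat \<Rightarrow> complex mat) \<Rightarrow> (nat \<Rightarrow> complex mat)
    \<Rightarrow> (nat \<Rightarrow> complex mat) \<Rightarrow> (nat \<Rightarrow> complex mat) \<Rightarrow> (nat \<Rightarrow> complex mat)
    \<Rightarrow> bbs_state \<Rightarrow> nat \<Rightarrow> nat \<times> nat \<Rightarrow> complex \<Rightarrow> complex \<Rightarrow> complex \<Rightarrow> complex \<Rightarrow> bool" where
  "fl_equation st \<epsilon> r n A B C D E S k ad v p g b \<longleftrightarrow>
     fl_v st \<epsilon> r n A B C D S (fst ad) (snd ad) k v \<and>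
     fl_mul \<epsilon> (A k $$ (fst ad, fst ad)) (B k $$ (snd ad, snd ad)) p \<and>
     fl_mul \<epsilon> (C k $$ (fst ad, fst ad)) (D k $$ (snd ad, snd ad)) g \<and>
     fl_sub \<epsilon> (E k $$ ad) v b"

definition fl_stored ::
  "star \<Rightarrow> real \<Rightarrow> nat \<Rightarrow> nat \<Rightarrow> (nat \<Rightarrow> complex mat) \<Rightarrow> (nat \<Rightarrow> complex mat)
    \<Rightarrow> bbs_state \<Rightarrow> nat \<Rightarrow> nat \<Rightarrow> nat \<Rightarrow> bool" where
  "fl_stored st \<epsilon> r n B D = (\<lambda>(X, XB, XD) k a d.
     fl_sum_of \<epsilon> (\<lambda>t. fl_mul \<epsilon> (X k $$ (a, t)) (B k $$ (t, d))) {d..<n} (XB k $$ (a, d)) \<and>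
     fl_sum_of \<epsilon> (\<lambda>t. fl_mul \<epsilon> (next_mat st r X k $$ (a, t)) (D k $$ (t, d))) {d..<n}
       (XD k $$ (a, d)))"

lemma fl_step_iff:
  "fl_step st \<kappa> u r n A B C D E (i, j) (X, XB, XD) (X', XB', XD') \<longleftrightarrow>
    (\<exists>v p g b x.
       (\<forall>q<r * length (small_positions i j).
          fl_equation st (\<kappa> * u) r n A B C D E (X, XB, XD) (q mod r) (small_positions i j ! (q div r))
            (v q) (p q) (g q) (b q) \<and>
          X' (q mod r) $$ (small_positions i j ! (q div r)) = x q) \<and>
       fl_small_block st \<kappa> u r (r * length (small_positions i j)) p g b x \<and>
       (\<forall>k<r. X' k \<in> carrier_mat n n \<and> XB' k \<in> carrier_mat n n \<and> XD' k \<in> carrier_mat n n \<and>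
          (\<forall>a<n. \<forall>d<n.
             if (a, d) \<in> set (small_positions i j) then
               fl_stored st (\<kappa> * u) r n B D (X', XB', XD') k a d
             else
               X' k $$ (a, d) = X k $$ (a, d) \<and> XB' k $$ (a, d) = XB k $$ (a, d) \<and>
               XD' k $$ (a, d) = XD k $$ (a, d))))"
  unfolding fl_step_def Let_def prod.case small_positions_def[symmetric] fl_small_block_def
    fl_equation_def fl_stored_def prod.collapse by (simp only: conj_assoc)

lemma next_mat_entry:
  assumes "X 0 \<in> carrier_mat n n" "a < n" "t < n"
  shows "next_mat st r X k $$ (a, t) = (if Suc k = r then
      (case st of Transp \<Rightarrow> X 0 $$ (t, a) | ConjTransp \<Rightarrow> cnj (X 0 $$ (t, a))) else X (Suc k) $$ (a, t))"
  using assms by (auto simp: next_mat_def split: star.split)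

lemma fl_sum_of_cong:
  assumes "fl_sum_of \<epsilon> F I z" "\<And>t. t \<in> I \<Longrightarrow> F t = G t"
  shows "fl_sum_of \<epsilon> G I z"
  using assms by (auto simp: fl_sum_of_def)

lemma fl_v_cong:
  assumes "fl_v st \<epsilon> r n A B C D (X, XB, XD) a d k v"
    and "\<And>t. d < t \<Longrightarrow> t < n \<Longrightarrow> X k $$ (a, t) = Y k $$ (a, t)"
    and "\<And>t. d < t \<Longrightarrow> t < n \<Longrightarrow> next_mat st r X k $$ (a, t) = next_mat st r Y k $$ (a, t)"
    and "\<And>s. a < s \<Longrightarrow> s < n \<Longrightarrow> XB k $$ (s, d) = YB k $$ (s, d)"
    and "\<And>s. a < s \<Longrightarrow> s < n \<Longrightarrow> XD k $$ (s, d) = YD k $$ (s, d)"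
  shows "fl_v st \<epsilon> r n A B C D (Y, YB, YD) a d k v"
  using assms(1) unfolding fl_v_def prod.case
  apply (elim exE conjE)
  subgoal for s1 s2 s3 s4 y z
    apply (rule exI[of _ s1], rule exI[of _ s2], rule exI[of _ s3], rule exI[of _ s4],
        rule exI[of _ y], rule exI[of _ z])
    using assms(2-) by (intro conjI) (auto elim!: fl_sum_of_cong)
  done

text \<open>
  The reverse of the order of processing.
\<close>

definition pair_less :: "nat \<times> nat \<Rightarrow> nat \<times> nat \<Rightarrow> bool" where
  "pair_less = (\<lambda>(a, b) (c, d). a < c \<or> a = c \<and> b < d)"

lemma pair_list_Suc: "pair_list (Suc n) = pair_list n @ map (Pair n) [0..<n + 1]"
  by (simp add: pair_list_def)

lemma set_pair_list: "set (pair_list n) = {(i, j). j \<le> i \<and> i < n}"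
  by (induction n) (auto simp: pair_list_Suc less_Suc_eq pair_list_def[of 0] image_iff simp del: upt_Suc)

lemma sorted_pair_list: "sorted_wrt pair_less (pair_list n)"
proof (induction n)
  case (Suc n)
  have "sorted_wrt pair_less (map (Pair n) [0..<n + 1])"
    unfolding sorted_wrt_map by (rule sorted_wrt_mono_rel[OF _ sorted_wrt_upt]) (auto simp: pair_less_def)
  with Suc show ?case
    unfolding pair_list_Suc sorted_wrt_append by (auto simp: set_pair_list pair_less_def)
qed (simp add: pair_list_def)

text \<open>The pair at which the positions \<open>(a, d)\<close> and \<open>(d, a)\<close> are processed.\<close>

definition pair_of :: "nat \<Rightarrow> nat \<Rightarrow> nat \<times> nat" where
  "pair_of a d = (max a d, min a d)"

definition state_eq_at ::
  "nat \<Rightarrow> nat \<Rightarrow> nat \<Rightarrow> bbs_state \<Rightarrow> bbs_state \<Rightarrow> bool" where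
  "state_eq_at r a d = (\<lambda>(X, XB, XD) (Y, YB, YD). \<forall>k<r. X k $$ (a, d) = Y k $$ (a, d) \<and>
     XB k $$ (a, d) = YB k $$ (a, d) \<and> XD k $$ (a, d) = YD k $$ (a, d))"

definition state_carrier :: "nat \<Rightarrow> nat \<Rightarrow> bbs_state \<Rightarrow> bool" where
  "state_carrier r n = (\<lambda>(X, XB, XD). \<forall>k<r. X k \<in> carrier_mat n n \<and> XB k \<in> carrier_mat n n \<and>
     XD k \<in> carrier_mat n n)"

lemma fl_step_carrier: "fl_step st \<kappa> u r n A B C D E x s t \<Longrightarrow> state_carrier r n t"
  by (cases x; cases s; cases t) (auto simp: fl_step_iff state_carrier_def)

lemma fl_step_frame:
  assumes "fl_step st \<kappa> u r n A B C D E (i, j) s t" "j \<le> i" "a < n" "d < n" "pair_of a d \<noteq> (i, j)"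
  shows "state_eq_at r a d s t"
proof -
  obtain X XB XD X' XB' XD' where st: "s = (X, XB, XD)" "t = (X', XB', XD')" by (metis prod_cases3)
  have "(a, d) \<notin> set (small_positions i j)"
    using assms(2,5) by (auto simp: set_small_positions pair_of_def)
  then show ?thesis using assms(1,3,4) unfolding st fl_step_iff state_eq_at_def prod.case by (metis
      (no_types, lifting))
qed

lemma state_eq_at_trans: "state_eq_at r a d s t \<Longrightarrow> state_eq_at r a d t w \<Longrightarrow> state_eq_at r a d s w"
  by (cases s; cases t; cases w) (auto simp: state_eq_at_def)

lemma state_eq_at_refl: "state_eq_at r a d s s"
  by (cases s) (auto simp: state_eq_at_def)

text \<open>
  An entry changes only when its own pair is processed.
\<close>

lemma run_fl_step:
  assumes "run (fl_step st \<kappa> u r n A B C D E) L s t" "state_carrier r n s"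
    and "set L \<subseteq> {(i, j). j \<le> i \<and> i < n}"
  shows "state_carrier r n t \<and>
    (\<forall>a<n. \<forall>d<n. pair_of a d \<notin> set L \<longrightarrow> state_eq_at r a d s t)"
  using assms
proof (induction L arbitrary: s)
  case Nil
  then show ?case by (simp add: state_eq_at_refl)
next
  case (Cons x L)
  then obtain s' where s': "fl_step st \<kappa> u r n A B C D E x s s'" "run (fl_step st \<kappa> u r n A B C D E) L s' t"
    by auto
  obtain i j where x: "x = (i, j)" by force
  have IH: "state_carrier r n t \<and> (\<forall>a<n. \<forall>d<n. pair_of a d \<notin> set L \<longrightarrow> state_eq_at r a d s' t)"
    using Cons.IH[OF s'(2) fl_step_carrier[OF s'(1)]] Cons.prems(3) by auto
  have "state_eq_at r a d s s'" if "a < n" "d < n" "pair_of a d \<noteq> (i, j)" for a d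
    using fl_step_frame[OF s'(1)[unfolded x]] that Cons.prems(3) x by auto
  moreover have "pair_of a d \<noteq> (i, j)" "pair_of a d \<notin> set L" if "pair_of a d \<notin> set (x # L)" for a d
    using that x by auto
  ultimately show ?case using IH state_eq_at_trans by metis
qed

lemma next_mat_cong:
  assumes "X 0 \<in> carrier_mat n n" "Y 0 \<in> carrier_mat n n" "a < n" "t < n" "k < r"
    and "\<And>l. l < r \<Longrightarrow> X l $$ (a, t) = Y l $$ (a, t)" "\<And>l. l < r \<Longrightarrow> X l $$ (t, a) = Y l $$ (t, a)"
  shows "next_mat st r X k $$ (a, t) = next_mat st r Y k $$ (a, t)"
  using assms by (auto simp: next_mat_entry[where n = n] split: star.split)

text \<open>
  The state before and after a step at \<open>(i, j)\<close> may be replaced by the final state. The entries read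
  by the step belong to pairs that come earlier in the processing order or, for the stored products,
  to \<open>(i, j)\<close> itself; none of them is written again.
\<close>

lemma fl_step_final:
  assumes run: "run (fl_step st \<kappa> u r n A B C D E) (rev (pair_list n))
        (\<lambda>_. 0\<^sub>m n n, \<lambda>_. 0\<^sub>m n n, \<lambda>_. 0\<^sub>m n n) F"
    and ij: "j \<le> i" "i < n" and r: "0 < r"
  shows "fl_step st \<kappa> u r n A B C D E (i, j) F F"
proof -
  let ?R = "fl_step st \<kappa> u r n A B C D E"
  have "(i, j) \<in> set (rev (pair_list n))" using ij by (simp add: set_pair_list)
  then obtain ys zs where L: "rev (pair_list n) = ys @ (i, j) # zs" by (meson split_list)
  then obtain s s' where s: "run ?R ys (\<lambda>_. 0\<^sub>m n n, \<lambda>_. 0\<^sub>m n n, \<lambda>_. 0\<^sub>m n n) s"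
    "?R (i, j) s s'" "run ?R zs s' F"
    using run by (auto simp: run_append)
  have sub: "set ys \<subseteq> {(i, j). j \<le> i \<and> i < n}" "set zs \<subseteq> {(i, j). j \<le> i \<and> i < n}"
    using arg_cong[OF L, of set] by (auto simp: set_pair_list)
  have "sorted_wrt (\<lambda>x y. pair_less y x) (ys @ (i, j) # zs)"
    using sorted_pair_list[of n] unfolding L[symmetric] by (simp add: sorted_wrt_rev)
  then have zs: "pair_less z (i, j)" if "z \<in> set zs" for z
    using that by (auto simp: sorted_wrt_append)
  have c: "state_carrier r n s"
    by (rule run_fl_step[OF s(1) _ sub(1), THEN conjunct1]) (simp add: state_carrier_def)
  have c': "state_carrier r n s'" by (rule fl_step_carrier[OF s(2)])
  have cF: "state_carrier r n F" by (rule run_fl_step[OF s(3) c' sub(2), THEN conjunct1])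
  have eq': "state_eq_at r a d s' F" if "a < n" "d < n" "\<not> pair_less (pair_of a d) (i, j)" for a d
    using run_fl_step[OF s(3) c' sub(2)] zs that by metis
  have eq: "state_eq_at r a d s F" if "a < n" "d < n" "pair_less (i, j) (pair_of a d)" for a d
  proof -
    have "\<not> pair_less (pair_of a d) (i, j)" "pair_of a d \<noteq> (i, j)"
      using that(3) by (auto simp: pair_less_def split: prod.splits)
    then show ?thesis using fl_step_frame[OF s(2) ij(1) that(1,2)] eq'[OF that(1,2)]
        state_eq_at_trans by blast
  qed
  obtain X XB XD where sX: "s = (X, XB, XD)" by (metis prod_cases3)
  obtain X' XB' XD' where sX': "s' = (X', XB', XD')" by (metis prod_cases3)
  obtain Y YB YD where FY: "F = (Y, YB, YD)" by (metis prod_cases3)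
  let ?P = "small_positions i j"
  have later: "pair_less (i, j) (pair_of a t)" "pair_less (i, j) (pair_of t a)"
    if "(a, d) \<in> set ?P" "d < t" for a d t
    using that ij by (auto simp: set_small_positions pair_less_def pair_of_def max_def min_def)
  have later': "pair_less (i, j) (pair_of t d)"
    if "(a, d) \<in> set ?P" "a < t" for a d t
    using that ij by (auto simp: set_small_positions pair_less_def pair_of_def max_def min_def)
  have not_earlier: "\<not> pair_less (pair_of a t) (i, j)" "\<not> pair_less (pair_of t a) (i, j)"
    if "(a, d) \<in> set ?P" "d \<le> t" for a d t
    using that ij by (auto simp: set_small_positions pair_less_def pair_of_def max_def min_def)
  have Pn: "a < n" "d < n" if "(a, d) \<in> set ?P" for a d
    using that ij by (auto simp: set_small_positions)
  have X0: "X 0 \<in> carrier_mat n n" "X' 0 \<in> carrier_mat n n" "Y 0 \<in> carrier_mat n n"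
    using c c' cF r by (auto simp: state_carrier_def sX sX' FY)
  have v: "fl_v st \<epsilon> r n A B C D (Y, YB, YD) a d k w"
    if "fl_v st \<epsilon> r n A B C D (X, XB, XD) a d k w" "(a, d) \<in> set ?P" "k < r" for a d k w \<epsilon>
  proof (rule fl_v_cong[OF that(1)])
    fix t assume t: "d < t" "t < n"
    note e = eq[OF Pn(1)[OF that(2)] t(2) later(1)[OF that(2) t(1)]]
      eq[OF t(2) Pn(1)[OF that(2)] later(2)[OF that(2) t(1)]]
    then show "X k $$ (a, t) = Y k $$ (a, t)" using that(3) by (auto simp: state_eq_at_def sX FY)
    show "next_mat st r X k $$ (a, t) = next_mat st r Y k $$ (a, t)"
      using e X0 that(3) t(2) Pn(1)[OF that(2)]
      by (intro next_mat_cong[where n = n]) (auto simp: state_eq_at_def sX FY)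
  next
    fix t assume t: "a < t" "t < n"
    note e = eq[OF t(2) Pn(2)[OF that(2)] later'[OF that(2) t(1)]]
    then show "XB k $$ (t, d) = YB k $$ (t, d)" "XD k $$ (t, d) = YD k $$ (t, d)"
      using that(3) by (auto simp: state_eq_at_def sX FY)
  qed
  have eP: "X' k $$ (a, t) = Y k $$ (a, t)" "X' k $$ (t, a) = Y k $$ (t, a)"
    "XB' k $$ (a, t) = YB k $$ (a, t)" "XD' k $$ (a, t) = YD k $$ (a, t)"
    if "(a, d) \<in> set ?P" "d \<le> t" "t < n" "k < r" for a d t k
    using eq'[OF Pn(1)[OF that(1)] that(3) not_earlier(1)[OF that(1,2)]]
      eq'[OF that(3) Pn(1)[OF that(1)] not_earlier(2)[OF that(1,2)]] that(4)
    by (auto simp: state_eq_at_def sX' FY)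
  have nP: "next_mat st r X' k $$ (a, t) = next_mat st r Y k $$ (a, t)"
    if "(a, d) \<in> set ?P" "d \<le> t" "t < n" "k < r" for a d t k
    using eP[OF that(1-3)] X0 that Pn(1)[OF that(1)]
    by (intro next_mat_cong[where n = n]) auto
  have memP: "?P ! (q div r) \<in> set ?P" if "q < r * length ?P" for q
    using that by (auto intro!: nth_mem simp: div_less_iff_less_mult r mult.commute)
  from s(2)[unfolded sX sX' fl_step_iff] obtain v p g b x where
    1: "\<And>q. q < r * length ?P \<Longrightarrow>
          fl_equation st (\<kappa> * u) r n A B C D E (X, XB, XD) (q mod r) (?P ! (q div r)) (v q) (p q)
              (g q) (b q) \<and>
          X' (q mod r) $$ (?P ! (q div r)) = x q"
    and 2: "fl_small_block st \<kappa> u r (r * length ?P) p g b x"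
    and 3: "\<And>k a d. k < r \<Longrightarrow> a < n \<Longrightarrow> d < n \<Longrightarrow> (a, d) \<in> set ?P \<Longrightarrow>
      fl_stored st (\<kappa> * u) r n B D (X', XB', XD') k a d" by metis
  have kr: "q mod r < r" for q using r by simp
  have eqs: "fl_equation st (\<kappa> * u) r n A B C D E (Y, YB, YD) (q mod r) (?P ! (q div r)) (v q) (p
      q) (g q) (b q) \<and>
          Y (q mod r) $$ (?P ! (q div r)) = x q" if q: "q < r * length ?P" for q
  proof -
    obtain a d where ad: "?P ! (q div r) = (a, d)" by force
    have m: "(a, d) \<in> set ?P" using memP[OF q] ad by simp
    show ?thesis using 1[OF q] v[OF _ m kr] eP(1)[OF m order_refl Pn(2)[OF m] kr]
      unfolding ad fl_equation_def fst_conv snd_conv by metis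
  qed
  have stored: "fl_stored st (\<kappa> * u) r n B D (Y, YB, YD) k a d"
    if "k < r" "a < n" "d < n" "(a, d) \<in> set ?P" for k a d
    using 3[OF that] eP[OF that(4) _ _ that(1)] nP[OF that(4) _ _ that(1)]
      eP(3,4)[OF that(4) order_refl that(3,1)]
    unfolding fl_stored_def prod.case by (auto elim!: fl_sum_of_cong)
  have cY: "Y k \<in> carrier_mat n n \<and> YB k \<in> carrier_mat n n \<and> YD k \<in> carrier_mat n n" if "k < r" for k
    using cF that by (auto simp: state_carrier_def FY)
  show ?thesis unfolding FY fl_step_iff using eqs 2 cY stored
    by (intro exI[of _ v] exI[of _ p] exI[of _ g] exI[of _ b] exI[of _ x]) simp
qed

section \<open>The residual of a computed entry\<close>

text \<open>
  The entry \<open>(a, d)\<close> of a product of three matrices with triangular outer factors, split as it is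
  computed: the term of the current unknown, the remainder of its row, and the stored products below.
\<close>

lemma triangular_sum:
  fixes \<alpha> \<beta> :: "nat \<Rightarrow> 'a::comm_semiring_1"
  assumes "\<And>s. s < a \<Longrightarrow> \<alpha> s = 0" "\<And>t. t < d \<Longrightarrow> \<beta> t = 0" "a < n" "d < n"
  shows "(\<Sum>s<n. \<Sum>t<n. \<alpha> s * \<xi> s t * \<beta> t) = \<alpha> a * \<xi> a d * \<beta> d
    + ((\<Sum>t\<in>{d<..<n}. \<alpha> a * \<xi> a t * \<beta> t) + (\<Sum>s\<in>{a<..<n}. \<alpha> s * (\<Sum>t\<in>{d..<n}. \<xi> s t * \<beta> t)))"
proof -
  have in1: "(\<Sum>t<n. \<alpha> s * \<xi> s t * \<beta> t) = (\<Sum>t\<in>{d..<n}. \<alpha> s * \<xi> s t * \<beta> t)" for s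
    using assms(2) by (intro sum.mono_neutral_right) auto
  have in2: "{d..<n} = insert d {d<..<n}" "{a..<n} = insert a {a<..<n}" using assms by auto
  have "(\<Sum>s<n. \<Sum>t<n. \<alpha> s * \<xi> s t * \<beta> t) = (\<Sum>s\<in>{a..<n}. \<Sum>t\<in>{d..<n}. \<alpha> s * \<xi> s t * \<beta> t)"
    unfolding in1 using assms(1) by (intro sum.mono_neutral_right) auto
  also have "\<dots> = (\<Sum>t\<in>{d..<n}. \<alpha> a * \<xi> a t * \<beta> t) + (\<Sum>s\<in>{a<..<n}. \<Sum>t\<in>{d..<n}. \<alpha> s * \<xi> s t * \<beta> t)"
    unfolding in2(2) by (subst sum.insert) auto
  also have "(\<Sum>t\<in>{d..<n}. \<alpha> a * \<xi> a t * \<beta> t) = \<alpha> a * \<xi> a d * \<beta> d + (\<Sum>t\<in>{d<..<n}. \<alpha> a * \<xi> a t * \<beta> t)"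
    unfolding in2(1) by (subst sum.insert) auto
  also have "(\<Sum>s\<in>{a<..<n}. \<Sum>t\<in>{d..<n}. \<alpha> s * \<xi> s t * \<beta> t)
      = (\<Sum>s\<in>{a<..<n}. \<alpha> s * (\<Sum>t\<in>{d..<n}. \<xi> s t * \<beta> t))"
    by (simp add: sum_distrib_left mult.assoc)
  finally show ?thesis by (simp add: add.assoc)
qed

text \<open>
  The number of roundings is \<open>n + 1\<close> for a stored product and \<open>n + 1\<close> for its use in the outer sum;
  joining the two sums costs one more. The diagonal term is listed separately because its unknown is
  supplied by the small system and only its coefficient is computed.
\<close>

lemma close_triangular_part:
  fixes \<alpha> \<beta> :: "nat \<Rightarrow> 'a::real_normed_field"
  assumes s1: "fl_sum_of \<epsilon> (\<lambda>t. fl_mul3 \<epsilon> (\<alpha> a) (\<xi> a t) (\<beta> t)) {d<..<n} s1"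
    and s2: "fl_sum_of \<epsilon> (\<lambda>s. fl_mul \<epsilon> (\<alpha> s) (\<eta> s)) {a<..<n} s2"
    and y: "fl_add \<epsilon> s1 s2 y"
    and \<eta>: "\<And>s. s < n \<Longrightarrow> fl_sum_of \<epsilon> (\<lambda>t. fl_mul \<epsilon> (\<xi> s t) (\<beta> t)) {d..<n} (\<eta> s)"
    and p: "fl_mul \<epsilon> (\<alpha> a) (\<beta> d) p"
    and z: "\<And>s. s < a \<Longrightarrow> \<alpha> s = 0" "\<And>t. t < d \<Longrightarrow> \<beta> t = 0" and n: "a < n" "d < n" and \<epsilon>: "0 \<le> \<epsilon>"
  obtains V v where "close \<epsilon> (2 * n + 3) V v y"
    and "V + norm (\<alpha> a) * norm (\<xi> a d) * norm (\<beta> d)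
      = (\<Sum>s<n. \<Sum>t<n. norm (\<alpha> s) * norm (\<xi> s t) * norm (\<beta> t))"
    and "v + \<alpha> a * \<xi> a d * \<beta> d = (\<Sum>s<n. \<Sum>t<n. \<alpha> s * \<xi> s t * \<beta> t)"
    and "close \<epsilon> 1 (norm (\<alpha> a) * norm (\<xi> a d) * norm (\<beta> d)) (\<alpha> a * \<xi> a d * \<beta> d) (p * \<xi> a d)"
proof -
  have 1: "close \<epsilon> (2 * n + 2) (\<Sum>t\<in>{d<..<n}. norm (\<alpha> a) * norm (\<xi> a t) * norm (\<beta> t))
      (\<Sum>t\<in>{d<..<n}. \<alpha> a * \<xi> a t * \<beta> t) s1"
    by (rule close_fl_sum_of[OF s1 close_fl_mul3]) (use \<epsilon> in auto)
  have eta: "close \<epsilon> (n + 1) (\<Sum>t\<in>{d..<n}. norm (\<xi> s t) * norm (\<beta> t)) (\<Sum>t\<in>{d..<n}. \<xi> s t * \<beta> t) (\<eta> s)"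
    if "s < n" for s
    by (rule close_fl_sum_of[OF \<eta>[OF that] close_fl_mul_exact]) (use \<epsilon> in auto)
  have 2: "close \<epsilon> (2 * n + 2) (\<Sum>s\<in>{a<..<n}. norm (\<alpha> s) * (\<Sum>t\<in>{d..<n}. norm (\<xi> s t) * norm (\<beta> t)))
      (\<Sum>s\<in>{a<..<n}. \<alpha> s * (\<Sum>t\<in>{d..<n}. \<xi> s t * \<beta> t)) s2"
    by (rule close_fl_sum_of[OF s2 close_fl_mul[OF _ eta]]) (use \<epsilon> in auto)
  note y' = close_fl_add[OF 1 2 y \<epsilon>]
  have "close \<epsilon> (1 + 0) (norm (\<alpha> a) * norm (\<beta> d) * norm (\<xi> a d)) (\<alpha> a * \<beta> d * \<xi> a d) (p * \<xi> a d)"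
    by (rule close_times[OF close_fl_mul_exact[OF p \<epsilon>] close_exact \<epsilon>])
  then have pp: "close \<epsilon> 1 (norm (\<alpha> a) * norm (\<xi> a d) * norm (\<beta> d)) (\<alpha> a * \<xi> a d * \<beta> d) (p * \<xi> a d)"
    by (simp add: mult_ac)
  have A: "(\<Sum>s<n. \<Sum>t<n. norm (\<alpha> s) * norm (\<xi> s t) * norm (\<beta> t)) = norm (\<alpha> a) * norm (\<xi> a d) * norm (\<beta> d)
    + ((\<Sum>t\<in>{d<..<n}. norm (\<alpha> a) * norm (\<xi> a t) * norm (\<beta> t))
      + (\<Sum>s\<in>{a<..<n}. norm (\<alpha> s) * (\<Sum>t\<in>{d..<n}. norm (\<xi> s t) * norm (\<beta> t))))"
    by (rule triangular_sum[where \<xi> = "\<lambda>s t. norm (\<xi> s t)"]) (use z n in auto)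
  have B: "(\<Sum>s<n. \<Sum>t<n. \<alpha> s * \<xi> s t * \<beta> t) = \<alpha> a * \<xi> a d * \<beta> d
    + ((\<Sum>t\<in>{d<..<n}. \<alpha> a * \<xi> a t * \<beta> t) + (\<Sum>s\<in>{a<..<n}. \<alpha> s * (\<Sum>t\<in>{d..<n}. \<xi> s t * \<beta> t)))"
    by (rule triangular_sum) (use z n in auto)
  show ?thesis
    by (rule that[OF _ _ _ pp], rule y'[THEN close_mono]) (use A B \<epsilon> in \<open>auto simp: add.commute\<close>)
qed

definition sylv_entry ::
  "nat \<Rightarrow> complex mat \<Rightarrow> complex mat \<Rightarrow> complex mat \<Rightarrow> nat \<Rightarrow> nat \<Rightarrow> complex" where
  "sylv_entry n A X B a d = (\<Sum>s<n. \<Sum>t<n. A $$ (a, s) * X $$ (s, t) * B $$ (t, d))"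

definition sylv_majorant ::
  "nat \<Rightarrow> complex mat \<Rightarrow> complex mat \<Rightarrow> complex mat \<Rightarrow> nat \<Rightarrow> nat \<Rightarrow> real" where
  "sylv_majorant n A X B a d = (\<Sum>s<n. \<Sum>t<n. norm (A $$ (a, s)) * norm (X $$ (s, t)) * norm (B $$ (t, d)))"

definition sylv_residual ::
  "star \<Rightarrow> nat \<Rightarrow> nat \<Rightarrow> (nat \<Rightarrow> complex mat) \<Rightarrow> (nat \<Rightarrow> complex mat) \<Rightarrow> (nat \<Rightarrow> complex mat)
    \<Rightarrow> (nat \<Rightarrow> complex mat) \<Rightarrow> (nat \<Rightarrow> complex mat) \<Rightarrow> (nat \<Rightarrow> complex mat) \<Rightarrow> nat \<Rightarrow> nat \<Rightarrow> nat \<Rightarrow> complex"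
  where
  "sylv_residual st r n A B C D E X k a d = E k $$ (a, d)
     - (sylv_entry n (A k) (X k) (B k) a d - sylv_entry n (C k) (next_mat st r X k) (D k) a d)"

definition sylv_weight ::
  "star \<Rightarrow> nat \<Rightarrow> nat \<Rightarrow> (nat \<Rightarrow> complex mat) \<Rightarrow> (nat \<Rightarrow> complex mat) \<Rightarrow> (nat \<Rightarrow> complex mat)
    \<Rightarrow> (nat \<Rightarrow> complex mat) \<Rightarrow> (nat \<Rightarrow> complex mat) \<Rightarrow> nat \<Rightarrow> nat \<Rightarrow> nat \<Rightarrow> real" where
  "sylv_weight st r n A B C D X k a d =
     sylv_majorant n (A k) (X k) (B k) a d + sylv_majorant n (C k) (next_mat st r X k) (D k) a d"

text \<open>
  The exact equation is compared with the small system by inserting the computed \<open>v\<close> and \<open>b\<close>. The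
  rounding error of \<open>b\<close> is expressed through \<open>b\<close> itself, whose norm is controlled by the solution of
  the small system.
\<close>

lemma entry_residual:
  assumes eqn: "fl_equation st \<epsilon> r n A B C D E (X, XB, XD) k (a, d) v p g b"
    and stored: "\<And>s. s < n \<Longrightarrow> fl_stored st \<epsilon> r n B D (X, XB, XD) k s d"
    and tri: "\<And>s. s < a \<Longrightarrow> A k $$ (a, s) = 0" "\<And>t. t < d \<Longrightarrow> B k $$ (t, d) = 0"
      "\<And>s. s < a \<Longrightarrow> C k $$ (a, s) = 0" "\<And>t. t < d \<Longrightarrow> D k $$ (t, d) = 0"
    and n: "a < n" "d < n" and \<epsilon>: "0 \<le> \<epsilon>" "\<epsilon> \<le> 1/2"
  shows "norm (sylv_residual st r n A B C D E X k a d)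
    \<le> norm (b - (p * X k $$ (a, d) - g * next_mat st r X k $$ (a, d))) + 2 * \<epsilon> * norm b
      + ((1 + \<epsilon>) ^ (2 * n + 5) - 1) * sylv_weight st r n A B C D X k a d"
proof -
  let ?Y = "next_mat st r X k" and ?e = "E k $$ (a, d)"
  have v: "fl_v st \<epsilon> r n A B C D (X, XB, XD) a d k v"
    and p: "fl_mul \<epsilon> (A k $$ (a, a)) (B k $$ (d, d)) p"
    and g: "fl_mul \<epsilon> (C k $$ (a, a)) (D k $$ (d, d)) g" and b: "fl_sub \<epsilon> ?e v b"
    using eqn by (auto simp: fl_equation_def)
  have XB: "fl_sum_of \<epsilon> (\<lambda>t. fl_mul \<epsilon> (X k $$ (s, t)) (B k $$ (t, d))) {d..<n} (XB k $$ (s, d))"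
    and XD: "fl_sum_of \<epsilon> (\<lambda>t. fl_mul \<epsilon> (?Y $$ (s, t)) (D k $$ (t, d))) {d..<n} (XD k $$ (s, d))"
    if "s < n" for s using stored[OF that] by (auto simp: fl_stored_def)
  from v obtain s1 s2 s3 s4 y z where
    s: "fl_sum_of \<epsilon> (\<lambda>t. fl_mul3 \<epsilon> (A k $$ (a, a)) (X k $$ (a, t)) (B k $$ (t, d))) {d<..<n} s1"
       "fl_sum_of \<epsilon> (\<lambda>s. fl_mul \<epsilon> (A k $$ (a, s)) (XB k $$ (s, d))) {a<..<n} s2"
       "fl_add \<epsilon> s1 s2 y"
       "fl_sum_of \<epsilon> (\<lambda>t. fl_mul3 \<epsilon> (C k $$ (a, a)) (?Y $$ (a, t)) (D k $$ (t, d))) {d<..<n} s3"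
       "fl_sum_of \<epsilon> (\<lambda>s. fl_mul \<epsilon> (C k $$ (a, s)) (XD k $$ (s, d))) {a<..<n} s4"
       "fl_add \<epsilon> s3 s4 z" "fl_sub \<epsilon> y z v"
    unfolding fl_v_def prod.case by blast
  obtain V1 v1 where 1: "close \<epsilon> (2 * n + 3) V1 v1 y"
    "V1 + norm (A k $$ (a, a)) * norm (X k $$ (a, d)) * norm (B k $$ (d, d)) = sylv_majorant n (A
        k) (X k) (B k) a d"
    "v1 + A k $$ (a, a) * X k $$ (a, d) * B k $$ (d, d) = sylv_entry n (A k) (X k) (B k) a d"
    "close \<epsilon> 1 (norm (A k $$ (a, a)) * norm (X k $$ (a, d)) * norm (B k $$ (d, d)))
      (A k $$ (a, a) * X k $$ (a, d) * B k $$ (d, d)) (p * X k $$ (a, d))"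
    unfolding sylv_majorant_def sylv_entry_def
    by (rule close_triangular_part[where \<alpha> = "\<lambda>s. A k $$ (a, s)" and \<xi> = "\<lambda>s t. X k $$ (s, t)"
        and \<beta> = "\<lambda>t. B k $$ (t, d)" and \<eta> = "\<lambda>s. XB k $$ (s, d)", OF s(1-3) XB p tri(1,2) n \<epsilon>(1)]) blast
  obtain V2 v2 where 2: "close \<epsilon> (2 * n + 3) V2 v2 z"
    "V2 + norm (C k $$ (a, a)) * norm (?Y $$ (a, d)) * norm (D k $$ (d, d)) = sylv_majorant n (C k)
        ?Y (D k) a d"
    "v2 + C k $$ (a, a) * ?Y $$ (a, d) * D k $$ (d, d) = sylv_entry n (C k) ?Y (D k) a d"
    "close \<epsilon> 1 (norm (C k $$ (a, a)) * norm (?Y $$ (a, d)) * norm (D k $$ (d, d)))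
      (C k $$ (a, a) * ?Y $$ (a, d) * D k $$ (d, d)) (g * ?Y $$ (a, d))"
    unfolding sylv_majorant_def sylv_entry_def
    by (rule close_triangular_part[where \<alpha> = "\<lambda>s. C k $$ (a, s)" and \<xi> = "\<lambda>s t. ?Y $$ (s, t)"
        and \<beta> = "\<lambda>t. D k $$ (t, d)" and \<eta> = "\<lambda>s. XD k $$ (s, d)", OF s(4-6) XD g tri(3,4) n \<epsilon>(1)]) blast
  let ?A = "sylv_entry n (A k) (X k) (B k) a d" and ?C = "sylv_entry n (C k) ?Y (D k) a d"
  let ?V = "sylv_majorant n (A k) (X k) (B k) a d + sylv_majorant n (C k) ?Y (D k) a d"
  let ?P = "norm (A k $$ (a, a)) * norm (X k $$ (a, d)) * norm (B k $$ (d, d))"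
  let ?G = "norm (C k $$ (a, a)) * norm (?Y $$ (a, d)) * norm (D k $$ (d, d))"
  have 3: "close \<epsilon> (2 * n + 5) (V1 + V2) (v1 - v2) v"
    by (rule close_fl_sub[OF 1(1) 2(1) s(7) \<epsilon>(1), THEN close_mono]) (use \<epsilon> in auto)
  have 4: "close \<epsilon> (2 * n + 5) ?P (A k $$ (a, a) * X k $$ (a, d) * B k $$ (d, d)) (p * X k $$ (a, d))"
    "close \<epsilon> (2 * n + 5) ?G (C k $$ (a, a) * ?Y $$ (a, d) * D k $$ (d, d)) (g * ?Y $$ (a, d))"
    by (rule close_mono[OF 1(4)] close_mono[OF 2(4)]; use \<epsilon> in simp)+
  have "close \<epsilon> (2 * n + 5) ((V1 + V2) + (?P + ?G))
     ((v1 - v2) + (A k $$ (a, a) * X k $$ (a, d) * B k $$ (d, d) + - (C k $$ (a, a) * ?Y $$ (a, d)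
         * D k $$ (d, d))))
     (v + (p * X k $$ (a, d) + - (g * ?Y $$ (a, d))))"
    by (rule close_plus[OF 3 close_plus[OF 4(1) close_uminus[OF 4(2)]]])
  moreover have "(V1 + V2) + (?P + ?G) = ?V" using 1(2) 2(2) by simp
  moreover have "(v1 - v2) + (A k $$ (a, a) * X k $$ (a, d) * B k $$ (d, d) + - (C k $$ (a, a) * ?Y
      $$ (a, d) * D k $$ (d, d)))
      = ?A - ?C" unfolding 1(3)[symmetric] 2(3)[symmetric] by simp
  ultimately have cl: "norm (v + (p * X k $$ (a, d) - g * ?Y $$ (a, d)) - (?A - ?C)) \<le> ((1 + \<epsilon>) ^
      (2 * n + 5) - 1) * ?V"
    by (simp add: close_def)
  from b obtain \<delta> where \<delta>: "norm \<delta> \<le> \<epsilon>" "b = (?e - v) * (1 + \<delta>)" by (auto simp: fl_sub_def fl_round_def)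
  have eb: "norm (?e - v - b) \<le> 2 * \<epsilon> * norm b"
  proof -
    have "?e - v - b = - (\<delta> * (?e - v))" by (simp add: \<delta>(2) algebra_simps)
    then have n1: "norm (?e - v - b) = norm \<delta> * norm (?e - v)" by (simp add: norm_mult)
    have "norm (?e - v) \<le> norm b + norm (?e - v - b)"
      using norm_triangle_ineq[of b "?e - v - b"] by simp
    also have "\<dots> \<le> norm b + 1/2 * norm (?e - v)"
      unfolding n1 using \<delta>(1) \<epsilon>(2) by (intro add_mono mult_right_mono) auto
    finally have "norm (?e - v) \<le> 2 * norm b" by simp
    then have "norm \<delta> * norm (?e - v) \<le> \<epsilon> * (2 * norm b)" using \<delta>(1) \<epsilon>(1) by (intro mult_mono) auto
    then show ?thesis by (simp add: n1)
  qed
  have tri3: "norm (x + (y + z)) \<le> norm x + (norm y + norm z)" for x y z :: complex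
    using norm_triangle_ineq[of x "y + z"] norm_triangle_ineq[of y z] by linarith
  have split: "?e - (?A - ?C) = (b - (p * X k $$ (a, d) - g * ?Y $$ (a, d))) + ((?e - v - b)
      + (v + (p * X k $$ (a, d) - g * ?Y $$ (a, d)) - (?A - ?C)))" by simp
  have "norm (?e - (?A - ?C)) \<le> norm (b - (p * X k $$ (a, d) - g * ?Y $$ (a, d))) + (norm (?e - v - b)
      + norm (v + (p * X k $$ (a, d) - g * ?Y $$ (a, d)) - (?A - ?C)))"
    by (subst split) (rule tri3)
  then show ?thesis using cl eb unfolding sylv_residual_def sylv_weight_def by linarith
qed

section \<open>Norm of the majorant\<close>

lemma L2_set_product: "L2_set f (I \<times> J) = L2_set (\<lambda>i. L2_set (\<lambda>j. f (i, j)) J) I"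
  unfolding l2_nested by (simp add: L2_set_def sum.cartesian_product)

text \<open>
  For each \<open>(i, j)\<close> the sum over \<open>(s, t)\<close> is an inner product with the moduli of the entries of \<open>X\<close>.
  The Cauchy--Schwarz inequality leaves the Frobenius norm of the array \<open>A\<^sub>i\<^sub>s B\<^sub>t\<^sub>j\<close>, and summing first
  over \<open>(i, j)\<close> gives \<open>n\<^sup>2\<close> terms of size at most \<open>\<mu>\<^sup>2\<close>.
\<close>

lemma L2_majorant:
  assumes \<mu>: "\<And>s t. s < n \<Longrightarrow> t < n \<Longrightarrow>
      (\<Sum>(i, j)\<in>{..<n} \<times> {..<n}. (norm (A $$ (i, s)) * norm (B $$ (t, j)))\<^sup>2) \<le> \<mu>\<^sup>2" and "0 \<le> \<mu>"
  shows "L2_set (\<lambda>(i, j). sylv_majorant n A X B i j) ({..<n} \<times> {..<n})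
    \<le> n * \<mu> * L2_set (\<lambda>(i, j). norm (X $$ (i, j))) ({..<n} \<times> {..<n})"
proof -
  let ?Q = "{..<n} \<times> {..<n}"
  let ?f = "\<lambda>ij st. norm (A $$ (fst ij, fst st)) * norm (B $$ (snd st, snd ij))"
  let ?x = "\<lambda>st. norm (X $$ st)"
  have "sylv_majorant n A X B (fst ij) (snd ij) \<le> L2_set (?f ij) ?Q * L2_set ?x ?Q" for ij
  proof -
    have "sylv_majorant n A X B (fst ij) (snd ij) = (\<Sum>st\<in>?Q. \<bar>?f ij st\<bar> * \<bar>?x st\<bar>)"
      unfolding sylv_majorant_def sum.cartesian_product
      by (intro sum.cong) (auto simp: abs_mult)
    then show ?thesis using L2_set_mult_ineq[of "?f ij" ?x ?Q] by simp
  qed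
  moreover have "0 \<le> sylv_majorant n A X B i j" for i j
    by (auto simp: sylv_majorant_def intro!: sum_nonneg)
  ultimately have "L2_set (\<lambda>(i, j). sylv_majorant n A X B i j) ?Q
      \<le> L2_set (\<lambda>ij. L2_set (?f ij) ?Q * L2_set ?x ?Q) ?Q"
    by (intro L2_set_mono) (auto simp: split_beta)
  also have "\<dots> = L2_set (\<lambda>ij. L2_set (?f ij) ?Q) ?Q * L2_set ?x ?Q"
    by (simp add: L2_set_left_distrib)
  also have "L2_set (\<lambda>ij. L2_set (?f ij) ?Q) ?Q = L2_set (\<lambda>st. L2_set (\<lambda>ij. ?f ij st) ?Q) ?Q"
    by (rule l2_swap)
  also have "\<dots> \<le> sqrt (card ?Q) * \<mu>"
  proof (rule l2_const_bound)
    fix st assume "st \<in> ?Q"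
    then have "(L2_set (\<lambda>ij. ?f ij st) ?Q)\<^sup>2 \<le> \<mu>\<^sup>2"
      using \<mu>[of "fst st" "snd st"] by (auto simp: l2_power2 split_beta)
    then show "L2_set (\<lambda>ij. ?f ij st) ?Q \<le> \<mu>" using \<open>0 \<le> \<mu>\<close> by (rule power2_le_imp_le)
  qed (use \<open>0 \<le> \<mu>\<close> in auto)
  also have "sqrt (card ?Q) * \<mu> = n * \<mu>" by (simp add: real_sqrt_mult)
  finally show ?thesis by (simp add: mult_right_mono split_def)
qed

lemma sum_add_block: "(\<Sum>q<a + k. f q) = (\<Sum>q<a. f q) + (\<Sum>t<k. f (a + t :: nat))"
  by (induction k) (auto simp: add.assoc)

lemma sum_blocks: "(\<Sum>q<m * k. f q) = (\<Sum>l<m. \<Sum>t<k. f (l * k + t :: nat))"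
proof (induction m)
  case (Suc m)
  have "Suc m * k = m * k + k" by simp
  then show ?case using Suc by (simp only: sum_add_block sum.lessThan_Suc)
qed simp

text \<open>
  The convention for the last equation only permutes, transposes and conjugates.
\<close>

lemma L2_next:
  assumes X: "\<And>k. k < r \<Longrightarrow> X k \<in> carrier_mat n n" and r: "0 < r"
  shows "L2_set (\<lambda>k. L2_set (\<lambda>(i, j). norm (next_mat st r X k $$ (i, j))) ({..<n} \<times> {..<n})) {..<r}
    = L2_set (\<lambda>k. L2_set (\<lambda>(i, j). norm (X k $$ (i, j))) ({..<n} \<times> {..<n})) {..<r}"
proof -
  let ?Q = "{..<n} \<times> {..<n}"
  define \<phi> where "\<phi> k = L2_set (\<lambda>(i, j). norm (X k $$ (i, j))) ?Q" for k
  obtain m where m: "r = Suc m" using r by (cases r) auto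
  have last: "L2_set (\<lambda>(i, j). norm (next_mat st r X m $$ (i, j))) ?Q = \<phi> 0"
  proof -
    have "L2_set (\<lambda>(i, j). norm (next_mat st r X m $$ (i, j))) ?Q
        = L2_set (\<lambda>(i, j). norm (X 0 $$ (j, i))) ?Q"
      using X[OF r] by (intro L2_set_cong) (auto simp: next_mat_entry[where n = n] m split: star.split)
    also have "\<dots> = \<phi> 0" unfolding L2_set_product prod.case \<phi>_def by (rule l2_swap)
    finally show ?thesis .
  qed
  have other: "L2_set (\<lambda>(i, j). norm (next_mat st r X k $$ (i, j))) ?Q = \<phi> (Suc k)" if "k < m" for k
    using that by (simp add: next_mat_def m \<phi>_def)
  have "(\<Sum>k<r. (L2_set (\<lambda>(i, j). norm (next_mat st r X k $$ (i, j))) ?Q)\<^sup>2) = (\<Sum>k<m. (\<phi> (Suc k))\<^sup>2) + (\<phi> 0)\<^sup>2"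
    by (simp add: m last[unfolded m] other[unfolded m])
  also have "\<dots> = (\<Sum>k<r. (\<phi> k)\<^sup>2)"
    unfolding m sum.lessThan_Suc_shift by simp
  finally show ?thesis unfolding \<phi>_def[symmetric] by (simp add: L2_set_def[of _ "{..<r}"])
qed

section \<open>The residual of the computed solution\<close>

lemma small_block_residual:
  assumes blk: "fl_small_block st \<kappa> u r N p g b x" and st: "st = Transp \<Longrightarrow> 2 \<le> N" and N: "0 < N"
    and P: "\<And>q. q < N \<Longrightarrow> norm (p q) \<le> P" "\<And>q. q < N \<Longrightarrow> norm (g q) \<le> P"
    and u: "0 \<le> u" "1 \<le> \<kappa>" "1280 * real N * (\<kappa> * u) \<le> 1"
  shows "l2 (\<lambda>q. b q - (p q * x q - g q *
        (if st = ConjTransp \<and> q mod r = r - 1 then cnj (x ((q + 1) mod N)) else x ((q + 1) mod N)))) {..<N}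
      \<le> 1000 * real N * (\<kappa> * u) * (sqrt (2 * N) * (8 * P) * l2 x {..<N})"
    and "l2 b {..<N} \<le> 2 * (sqrt (2 * N) * (8 * P) * l2 x {..<N})"
proof -
  have P0: "0 \<le> P" using P(1)[OF N] norm_ge_zero[of "p 0"] by linarith
  have ku: "0 \<le> \<kappa> * u" using u by simp
  have uk: "u \<le> \<kappa> * u" using mult_right_mono[OF u(2,1)] by simp
  have "(l2 (\<lambda>q. b q - (p q * x q - g q *
        (if st = ConjTransp \<and> q mod r = r - 1 then cnj (x ((q + 1) mod N)) else x ((q + 1) mod N)))) {..<N}
      \<le> 1000 * real N * (\<kappa> * u) * (sqrt (2 * N) * (8 * P) * l2 x {..<N})) \<and>
    l2 b {..<N} \<le> 2 * (sqrt (2 * N) * (8 * P) * l2 x {..<N})"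
  proof (cases st)
    case Transp
    then obtain W where W: "fl_system_T (\<kappa> * u) N p g b W" "fl_small_solve 1 (\<kappa> * u) N W x"
      using blk by (auto simp: fl_small_block_def)
    have small: "640 * real N * (\<kappa> * u) \<le> 1"
      using u(3) mult_nonneg_nonneg[OF of_nat_0_le_iff ku, of N] by (simp add: mult.assoc)
    note T = small_system_T[OF W st[OF Transp] P ku small]
    have le: "sqrt N * (2 * P) * l2 x {..<N} \<le> sqrt (2 * N) * (8 * P) * l2 x {..<N}"
      using P0 by (intro mult_right_mono mult_mono) auto
    have wide: "480 * real N * (\<kappa> * u) * (sqrt N * (2 * P) * l2 x {..<N})
        \<le> 1000 * real N * (\<kappa> * u) * (sqrt (2 * N) * (8 * P) * l2 x {..<N})"
      using le u P0 by (intro mult_mono) auto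
    show ?thesis
    proof
      show "l2 b {..<N} \<le> 2 * (sqrt (2 * N) * (8 * P) * l2 x {..<N})" using T(2) le by linarith
    qed (use order_trans[OF T(1) wide] Transp in simp)
  next
    case ConjTransp
    then obtain W y where W: "fl_system_H u N {q. q mod r = r - 1} p g b W" "fl_small_solve 2 u (2 * N) W y"
      "\<And>q. q < N \<Longrightarrow> x q = Complex (y (2 * q)) (y (2 * q + 1))"
      using blk by (auto simp: fl_small_block_def)
    have "1280 * real N * u \<le> 1280 * real N * (\<kappa> * u)" using uk by (intro mult_left_mono) auto
    then have small: "1280 * real N * u \<le> 1" using u(3) by linarith
    note H = small_system_H[OF W(1,2) N W(3) P u(1) small]
    have "1000 * real N * u * (sqrt (2 * N) * (8 * P) * l2 x {..<N})
        \<le> 1000 * real N * (\<kappa> * u) * (sqrt (2 * N) * (8 * P) * l2 x {..<N})"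
      using uk P0 by (intro mult_right_mono mult_left_mono) auto
    with H show ?thesis by (simp add: ConjTransp)
  qed
  then show "l2 (\<lambda>q. b q - (p q * x q - g q *
        (if st = ConjTransp \<and> q mod r = r - 1 then cnj (x ((q + 1) mod N)) else x ((q + 1) mod N)))) {..<N}
      \<le> 1000 * real N * (\<kappa> * u) * (sqrt (2 * N) * (8 * P) * l2 x {..<N})"
    "l2 b {..<N} \<le> 2 * (sqrt (2 * N) * (8 * P) * l2 x {..<N})" by auto
qed

text \<open>
  The second unknown of equation \<open>q\<close> is unknown \<open>q + 1\<close>, cyclically. After the last index \<open>k\<close> the
  transposition swaps the two positions, and this agrees with moving on to the other half of the
  unknowns, or with returning to the first unknown if there is only one half.
\<close>

lemma next_unknown:
  assumes x: "\<And>q. q < r * length (small_positions i j) \<Longrightarrow>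
      X (q mod r) $$ (small_positions i j ! (q div r)) = x q"
    and X: "X 0 \<in> carrier_mat n n" and ij: "i < n" "j < n" and r: "0 < r"
    and q: "q < r * length (small_positions i j)"
  shows "next_mat st r X (q mod r) $$ (small_positions i j ! (q div r))
    = (if st = ConjTransp \<and> q mod r = r - 1 then cnj (x ((q + 1) mod (r * length (small_positions i j))))
       else x ((q + 1) mod (r * length (small_positions i j))))"
proof -
  let ?P = "small_positions i j"
  define m where "m = length ?P"
  have m: "0 < m" "m = 1 \<or> m = 2" by (auto simp: m_def small_positions_def)
  define l k where "l = q div r" "k = q mod r"
  have lk: "q = l * r + k" "k < r" "l < m"
    using r q by (auto simp: l_k_def m_def div_less_iff_less_mult mult.commute)
  have Pn: "fst (?P ! l) < n" "snd (?P ! l) < n"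
    using lk m ij by (auto simp: m_def small_positions_def less_Suc_eq split: if_splits)
  show ?thesis
  proof (cases "Suc k = r")
    case False
    then have k: "Suc k < r" using lk by simp
    have "(l + 1) * r \<le> m * r" using lk(3) by (intro mult_right_mono) auto
    then have lt: "q + 1 < r * m" using k lk(1) by (simp add: algebra_simps)
    have q1: "q + 1 = Suc k + l * r" by (simp add: lk(1))
    have "(q + 1) div r = l" "(q + 1) mod r = Suc k"
      unfolding q1 using k r by (simp_all del: add_Suc add_Suc_right)
    then have "X (Suc k) $$ (?P ! l) = x (q + 1)"
      using x[of "q + 1"] lt by (simp add: m_def)
    then show ?thesis using lt False k
      unfolding l_k_def[symmetric] m_def[symmetric] by (auto simp: next_mat_def)
  next
    case True
    have q1: "q + 1 = (l + 1) * r" using True by (simp add: lk(1) algebra_simps)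
    define l' where "l' = (l + 1) mod m"
    have q2: "(q + 1) mod (r * m) = l' * r"
      unfolding q1 l'_def by (simp add: mult.commute[of _ r] mult_mod_right)
    have l': "l' < m" using m by (simp add: l'_def)
    then have lt: "l' * r < r * m" using r by (simp add: mult.commute)
    have "X 0 $$ (?P ! l') = x (l' * r)"
      using x[of "l' * r"] lt r by (simp add: m_def)
    moreover have "?P ! l' = (snd (?P ! l), fst (?P ! l))"
      using lk(3) by (auto simp: l'_def m_def small_positions_def less_Suc_eq)
    ultimately have "X 0 $$ (snd (?P ! l), fst (?P ! l)) = x (l' * r)" by simp
    moreover have "next_mat st r X k $$ (?P ! l)
        = (case st of Transp \<Rightarrow> X 0 $$ (snd (?P ! l), fst (?P ! l))
           | ConjTransp \<Rightarrow> cnj (X 0 $$ (snd (?P ! l), fst (?P ! l))))"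
      using next_mat_entry[where X = X, OF X Pn] True by simp
    moreover have "k = r - 1" using True by simp
    ultimately show ?thesis unfolding l_k_def[symmetric] m_def[symmetric] q2
      by (cases st) simp_all
  qed
qed

lemma stored_products:
  assumes step: "\<And>i j. j \<le> i \<Longrightarrow> i < n \<Longrightarrow> fl_step st \<kappa> u r n A B C D E (i, j) (X, XB, XD) (X, XB, XD)"
    and "s < n" "d < n" "k < r"
  shows "fl_stored st (\<kappa> * u) r n B D (X, XB, XD) k s d"
proof -
  have mem: "(s, d) \<in> set (small_positions (max s d) (min s d))"
    by (auto simp: set_small_positions max_def min_def)
  have "fl_step st \<kappa> u r n A B C D E (max s d, min s d) (X, XB, XD) (X, XB, XD)"
    using assms by (intro step) auto
  then show ?thesis using assms(2-4) mem unfolding fl_step_iff by (metis (no_types, lifting))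
qed

definition position_norm :: "nat \<Rightarrow> (nat \<Rightarrow> complex mat) \<Rightarrow> nat \<Rightarrow> nat \<Rightarrow> real" where
  "position_norm r X a d = l2 (\<lambda>k. X k $$ (a, d)) {..<r}"

lemma unknowns_norm:
  assumes x: "\<And>q. q < r * length (small_positions i j) \<Longrightarrow>
      X (q mod r) $$ (small_positions i j ! (q div r)) = x q"
    and r: "0 < r"
  shows "l2 x {..<r * length (small_positions i j)} \<le> position_norm r X i j + position_norm r X j i"
proof -
  let ?P = "small_positions i j"
  have "(\<Sum>q<length ?P * r. (norm (x q))\<^sup>2)
      = (\<Sum>l<length ?P. \<Sum>k<r. (norm (X k $$ (?P ! l)))\<^sup>2)"
    unfolding sum_blocks
  proof (intro sum.cong refl)
    fix l k assume lk: "l \<in> {..<length ?P}" "k \<in> {..<r}"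
    then have "(l + 1) * r \<le> length ?P * r" by (intro mult_right_mono) auto
    then have "l * r + k < r * length ?P" using lk by (simp add: algebra_simps)
    from x[OF this] show "(norm (x (l * r + k)))\<^sup>2 = (norm (X k $$ (?P ! l)))\<^sup>2"
      using lk by simp
  qed
  also have "\<dots> = (\<Sum>l<length ?P. (position_norm r X (fst (?P ! l)) (snd (?P ! l)))\<^sup>2)"
    by (simp add: position_norm_def l2_power2)
  also have "\<dots> \<le> (position_norm r X i j + position_norm r X j i)\<^sup>2"
    by (auto simp: small_positions_def power2_eq_square algebra_simps position_norm_def)
  finally have "(l2 x {..<r * length ?P})\<^sup>2 \<le> (position_norm r X i j + position_norm r X j i)\<^sup>2"
    by (simp add: l2_power2 mult.commute)
  then show ?thesis by (rule power2_le_imp_le) (simp add: position_norm_def)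
qed

lemma L2_block_le:
  assumes "l < m"
  shows "L2_set (\<lambda>k. f (l * r + k)) {..<r} \<le> L2_set f {..<r * m :: nat}"
proof -
  have "L2_set (\<lambda>k. f (l * r + k)) {..<r} = L2_set f ((+) (l * r) ` {..<r})"
    by (simp add: L2_set_def sum.reindex)
  also have "\<dots> \<le> L2_set f {..<r * m}"
  proof (rule l2_mono_set)
    have "(l + 1) * r \<le> m * r" using assms by (intro mult_right_mono) auto
    then show "(+) (l * r) ` {..<r} \<subseteq> {..<r * m}" by (auto simp: algebra_simps)
  qed simp
  finally show ?thesis .
qed

text \<open>
  The part \<open>R\<close> of the residual comes from the small system. Its bound involves the unknowns at both
  positions that are solved for together.
\<close>

lemma position_residual:
  assumes step: "\<And>i j. j \<le> i \<Longrightarrow> i < n \<Longrightarrow> fl_step st \<kappa> u r n A B C D E (i, j) (X, XB, XD) (X, XB, XD)"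
    and r: "0 < r" "st = Transp \<Longrightarrow> 2 \<le> r" and u: "0 \<le> u" "1 \<le> \<kappa>" "2560 * real r * (\<kappa> * u) \<le> 1"
    and X: "X 0 \<in> carrier_mat n n"
    and tri: "\<And>k i s. k < r \<Longrightarrow> i < n \<Longrightarrow> s < i \<Longrightarrow> A k $$ (i, s) = 0"
      "\<And>k t j. k < r \<Longrightarrow> j < n \<Longrightarrow> t < j \<Longrightarrow> B k $$ (t, j) = 0"
      "\<And>k i s. k < r \<Longrightarrow> i < n \<Longrightarrow> s < i \<Longrightarrow> C k $$ (i, s) = 0"
      "\<And>k t j. k < r \<Longrightarrow> j < n \<Longrightarrow> t < j \<Longrightarrow> D k $$ (t, j) = 0"
    and \<mu>: "\<And>k i j. k < r \<Longrightarrow> i < n \<Longrightarrow> j < n \<Longrightarrow> norm (A k $$ (i, i)) * norm (B k $$ (j, j)) \<le> \<mu>"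
      "\<And>k i j. k < r \<Longrightarrow> i < n \<Longrightarrow> j < n \<Longrightarrow> norm (C k $$ (i, i)) * norm (D k $$ (j, j)) \<le> \<mu>" "0 \<le> \<mu>"
    and ad: "a < n" "d < n"
  obtains R where "\<And>k. 0 \<le> R k"
    and "\<And>k. k < r \<Longrightarrow> norm (sylv_residual st r n A B C D E X k a d)
      \<le> R k + ((1 + \<kappa> * u) ^ (2 * n + 5) - 1) * sylv_weight st r n A B C D X k a d"
    and "L2_set R {..<r} \<le> 65000 * (r * sqrt r) * (\<kappa> * u) * \<mu> * (position_norm r X a d +
        position_norm r X d a)"
proof -
  define i j where "i = max a d" "j = min a d"
  have ij: "j \<le> i" "i < n" "j < n" using ad by (auto simp: i_j_def)
  let ?P = "small_positions i j" and ?\<epsilon> = "\<kappa> * u"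
  define m where "m = length ?P"
  have m: "0 < m" "m \<le> 2" by (auto simp: m_def small_positions_def)
  have mem: "(a, d) \<in> set ?P" by (auto simp: set_small_positions i_j_def max_def min_def)
  then obtain l where l: "l < m" "?P ! l = (a, d)" by (auto simp: in_set_conv_nth m_def)
  have \<epsilon>: "0 \<le> ?\<epsilon>" using u by simp
  have "?\<epsilon> \<le> real r * ?\<epsilon>" using mult_right_mono[of 1 "real r" ?\<epsilon>] r \<epsilon> by simp
  then have \<epsilon>': "?\<epsilon> \<le> 1/2" using u(3) \<epsilon> by linarith
  define N where "N = r * m"
  have N: "0 < N" "real N \<le> 2 * real r" "st = Transp \<Longrightarrow> 2 \<le> N"
    using r m by (auto simp: N_def intro: order_trans[OF r(2)])
  from step[OF ij(1,2), unfolded fl_step_iff] obtain v p g b x where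
    S: "\<And>q. q < N \<Longrightarrow>
      fl_equation st ?\<epsilon> r n A B C D E (X, XB, XD) (q mod r) (?P ! (q div r)) (v q) (p q) (g q) (b q) \<and>
      X (q mod r) $$ (?P ! (q div r)) = x q"
    and blk: "fl_small_block st \<kappa> u r N p g b x" unfolding N_def m_def by blast
  have Pn: "fst (?P ! (q div r)) < n" "snd (?P ! (q div r)) < n" if "q < N" for q
  proof -
    have "q div r < length ?P" using that r by (simp add: N_def m_def div_less_iff_less_mult mult.commute)
    then have "?P ! (q div r) \<in> set ?P" by (rule nth_mem)
    then show "fst (?P ! (q div r)) < n" "snd (?P ! (q div r)) < n"
      using ij by (auto simp: set_small_positions)
  qed
  have mul: "norm z \<le> 2 * \<mu>" if "fl_mul ?\<epsilon> y w z" "norm y * norm w \<le> \<mu>" for y w z :: complex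
  proof -
    have "norm z \<le> (1 + ?\<epsilon>) ^ 1 * (norm y * norm w)"
      by (rule close_norm[OF close_fl_mul_exact[OF that(1) \<epsilon>]])
    also have "\<dots> \<le> 2 * \<mu>" using that(2) \<epsilon> \<epsilon>' by (intro mult_mono) auto
    finally show ?thesis .
  qed
  have pg: "norm (p q) \<le> 2 * \<mu>" "norm (g q) \<le> 2 * \<mu>" if "q < N" for q
    using S[OF that] \<mu>(1,2)[OF _ Pn[OF that], of "q mod r"] r mul unfolding fl_equation_def by auto
  have "1280 * real N * ?\<epsilon> \<le> 1280 * (2 * real r) * ?\<epsilon>"
    using N \<epsilon> by (intro mult_right_mono mult_left_mono) auto
  then have small: "1280 * real N * ?\<epsilon> \<le> 1" using u(3) by linarith
  define f where "f q = b q - (p q * x q - g q *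
        (if st = ConjTransp \<and> q mod r = r - 1 then cnj (x ((q + 1) mod N)) else x ((q + 1) mod N)))" for q
  note sb = small_block_residual[OF blk N(3,1) pg u(1,2) small, folded f_def]
  define R where "R k = norm (f (l * r + k)) + 2 * ?\<epsilon> * norm (b (l * r + k))" for k
  have xs: "X (q mod r) $$ (?P ! (q div r)) = x q" if "q < r * length ?P" for q
    using S[of q] that by (simp add: N_def m_def)
  show ?thesis
  proof (rule that[of R])
    show "0 \<le> R k" for k using \<epsilon> by (simp add: R_def)
    fix k assume k: "k < r"
    define q where "q = l * r + k"
    have "(l + 1) * r \<le> m * r" using l by (intro mult_right_mono) auto
    then have q: "q < N" using k by (simp add: q_def N_def algebra_simps)
    have qd: "q div r = l" "q mod r = k" using k by (auto simp: q_def)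
    have nx: "next_mat st r X k $$ (a, d) = (if st = ConjTransp \<and> q mod r = r - 1 then cnj (x ((q + 1) mod N))
        else x ((q + 1) mod N))"
      using next_unknown[where X = X and x = x and st = st and q = q, OF xs X ij(2,3) r(1)] q
      by (simp add: qd l N_def m_def)
    note Sq = S[OF q, unfolded qd l(2)]
    have fq: "f q = b q - (p q * X k $$ (a, d) - g q * next_mat st r X k $$ (a, d))"
      unfolding f_def nx using Sq by simp
    have "norm (sylv_residual st r n A B C D E X k a d)
      \<le> norm (b q - (p q * X k $$ (a, d) - g q * next_mat st r X k $$ (a, d))) + 2 * ?\<epsilon> * norm (b q)
      + ((1 + ?\<epsilon>) ^ (2 * n + 5) - 1) * sylv_weight st r n A B C D X k a d"
      using conjunct1[OF Sq] stored_products[OF step _ ad(2) k] tri k ad \<epsilon> \<epsilon>'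
      by (intro entry_residual[where XB = XB and XD = XD and v = "v q"]) auto
    then show "norm (sylv_residual st r n A B C D E X k a d)
      \<le> R k + ((1 + ?\<epsilon>) ^ (2 * n + 5) - 1) * sylv_weight st r n A B C D X k a d"
      unfolding fq[symmetric] R_def q_def[symmetric] .
  next
    let ?S = "sqrt (2 * N) * (8 * (2 * \<mu>)) * l2 x {..<N}"
    have S0: "0 \<le> ?S" using \<mu>(3) by simp
    have "L2_set R {..<r} \<le> L2_set (\<lambda>k. norm (f (l * r + k))) {..<r}
        + L2_set (\<lambda>k. 2 * ?\<epsilon> * norm (b (l * r + k))) {..<r}"
      unfolding R_def by (rule L2_set_triangle_ineq)
    also have "\<dots> = L2_set (\<lambda>k. norm (f (l * r + k))) {..<r}
        + 2 * ?\<epsilon> * L2_set (\<lambda>k. norm (b (l * r + k))) {..<r}"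
      using \<epsilon> by (simp add: L2_set_right_distrib)
    also have "\<dots> \<le> l2 f {..<N} + 2 * ?\<epsilon> * l2 b {..<N}"
      unfolding N_def using \<epsilon> l(1) L2_block_le[of l m "\<lambda>q. norm (f q)" r] L2_block_le[of l m "\<lambda>q.
          norm (b q)" r]
      by (intro add_mono mult_left_mono) auto
    also have "\<dots> \<le> 1000 * real N * ?\<epsilon> * ?S + 2 * ?\<epsilon> * (2 * ?S)"
      using sb \<epsilon> by (intro add_mono mult_left_mono) auto
    also have "\<dots> \<le> 1004 * real N * ?\<epsilon> * ?S"
    proof -
      have "1 * (?\<epsilon> * ?S) \<le> real N * (?\<epsilon> * ?S)"
      proof (rule mult_right_mono)
        show "1 \<le> real N" using N(1) by simp
        show "0 \<le> ?\<epsilon> * ?S" by (rule mult_nonneg_nonneg[OF \<epsilon> S0])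
      qed
      then show ?thesis by (simp add: algebra_simps)
    qed
    \<comment> \<open>\<open>N \<le> 2 r\<close> and \<open>\<surd>(2 N) \<le> 2 \<surd>r\<close>; the computed coefficients are at most \<open>2 \<mu>\<close>.\<close>
    also have "\<dots> \<le> 1004 * (2 * real r) * ?\<epsilon> * ((2 * sqrt r) * (8 * (2 * \<mu>)) *
        (position_norm r X a d + position_norm r X d a))"
    proof (intro mult_mono mult_nonneg_nonneg)
      have "sqrt (2 * N) \<le> sqrt (2\<^sup>2 * r)" using N(2) by (intro real_sqrt_le_mono) auto
      then show "sqrt (2 * N) \<le> 2 * sqrt r" by (simp add: real_sqrt_mult)
      have "l2 x {..<N} \<le> position_norm r X i j + position_norm r X j i"
        unfolding N_def m_def by (rule unknowns_norm[OF xs r(1)])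
      then show "l2 x {..<N} \<le> position_norm r X a d + position_norm r X d a"
        by (auto simp: i_j_def max_def min_def split: if_splits)
    qed (use N u \<mu>(3) in auto)
    also have "\<dots> = 64256 * ((r * sqrt r) * ?\<epsilon> * \<mu> * (position_norm r X a d + position_norm r X d a))"
      by (simp add: mult_ac)
    also have "\<dots> \<le> 65000 * ((r * sqrt r) * ?\<epsilon> * \<mu> * (position_norm r X a d + position_norm r X d a))"
      using u \<mu>(3) by (intro mult_right_mono mult_nonneg_nonneg) (auto simp: position_norm_def)
    finally show "L2_set R {..<r} \<le> 65000 * (r * sqrt r) * ?\<epsilon> * \<mu> * (position_norm r X a d +
        position_norm r X d a)"
      by (simp add: mult_ac)
  qed
qed

definition family_norm :: "nat \<Rightarrow> nat \<Rightarrow> (nat \<Rightarrow> complex mat) \<Rightarrow> real" where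
  "family_norm r n X = L2_set (\<lambda>k. L2_set (\<lambda>(i, j). norm (X k $$ (i, j))) ({..<n} \<times> {..<n})) {..<r}"

lemma family_norm_nonneg: "0 \<le> family_norm r n X"
  by (simp add: family_norm_def)

text \<open>
  For fixed \<open>s\<close> and \<open>t\<close>, the sum is the squared norm of a column of the Kronecker product of the
  transpose of \<open>B\<close> with \<open>A\<close>.
\<close>

definition kronecker_bound ::
  "nat \<Rightarrow> complex mat \<Rightarrow> complex mat \<Rightarrow> real \<Rightarrow> bool" where
  "kronecker_bound n A B \<mu> \<longleftrightarrow> (\<forall>s<n. \<forall>t<n.
     (\<Sum>(i, j)\<in>{..<n} \<times> {..<n}. (norm (A $$ (i, s)) * norm (B $$ (t, j)))\<^sup>2) \<le> \<mu>\<^sup>2)"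

lemma kronecker_bound_diag:
  assumes "kronecker_bound n A B \<mu>" "0 \<le> \<mu>" "i < n" "j < n"
  shows "norm (A $$ (i, i)) * norm (B $$ (j, j)) \<le> \<mu>"
proof (rule power2_le_imp_le[OF _ assms(2)])
  have "(norm (A $$ (i, i)) * norm (B $$ (j, j)))\<^sup>2
      = (case (i, j) of (i', j') \<Rightarrow> (norm (A $$ (i', i)) * norm (B $$ (j, j')))\<^sup>2)" by simp
  also have "\<dots> \<le> (\<Sum>(i', j')\<in>{..<n} \<times> {..<n}. (norm (A $$ (i', i)) * norm (B $$ (j, j')))\<^sup>2)"
    using assms by (intro member_le_sum) auto
  also have "\<dots> \<le> \<mu>\<^sup>2" using assms by (simp add: kronecker_bound_def)
  finally show "(norm (A $$ (i, i)) * norm (B $$ (j, j)))\<^sup>2 \<le> \<mu>\<^sup>2" .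
qed

lemma family_majorant:
  assumes "\<And>k. k < r \<Longrightarrow> kronecker_bound n (A k) (B k) \<mu>" "0 \<le> \<mu>"
  shows "L2_set (\<lambda>k. L2_set (\<lambda>(i, j). sylv_majorant n (A k) (X k) (B k) i j) ({..<n} \<times> {..<n})) {..<r}
    \<le> n * \<mu> * family_norm r n X"
proof -
  have "L2_set (\<lambda>k. L2_set (\<lambda>(i, j). sylv_majorant n (A k) (X k) (B k) i j) ({..<n} \<times> {..<n})) {..<r}
      \<le> L2_set (\<lambda>k. (n * \<mu>) * L2_set (\<lambda>(i, j). norm (X k $$ (i, j))) ({..<n} \<times> {..<n})) {..<r}"
    using assms by (intro L2_set_mono L2_majorant) (auto simp: kronecker_bound_def)
  also have "\<dots> = n * \<mu> * family_norm r n X"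
    using assms(2) by (simp add: family_norm_def L2_set_right_distrib)
  finally show ?thesis .
qed

text \<open>
  The small systems contribute the term with \<open>r * sqrt r\<close>, and the evaluation of \<open>v\<close> the term with
  \<open>n\<^sup>2\<close>, one factor \<open>n\<close> being the number of roundings and the other one the ratio of the Frobenius
  norm to the spectral norm of a Kronecker block.
\<close>

lemma algorithm_residual:
  assumes alg: "fl_block_back_subst st \<kappa> u r n A B C D E X"
    and r: "0 < r" "st = Transp \<Longrightarrow> 2 \<le> r" and n: "0 < n"
    and u: "0 \<le> u" "1 \<le> \<kappa>" "2560 * real r * (\<kappa> * u) \<le> 1" "7 * real n * (\<kappa> * u) \<le> 1"
    and tri: "\<And>k i s. k < r \<Longrightarrow> i < n \<Longrightarrow> s < i \<Longrightarrow> A k $$ (i, s) = 0"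
      "\<And>k t j. k < r \<Longrightarrow> j < n \<Longrightarrow> t < j \<Longrightarrow> B k $$ (t, j) = 0"
      "\<And>k i s. k < r \<Longrightarrow> i < n \<Longrightarrow> s < i \<Longrightarrow> C k $$ (i, s) = 0"
      "\<And>k t j. k < r \<Longrightarrow> j < n \<Longrightarrow> t < j \<Longrightarrow> D k $$ (t, j) = 0"
    and \<mu>: "\<And>k. k < r \<Longrightarrow> kronecker_bound n (A k) (B k) \<mu>" "\<And>k. k < r \<Longrightarrow> kronecker_bound n (C k) (D k) \<mu>"
      "0 \<le> \<mu>"
  shows "\<forall>k<r. X k \<in> carrier_mat n n"
    and "L2_set (\<lambda>k. L2_set (\<lambda>(i, j). norm (sylv_residual st r n A B C D E X k i j)) ({..<n} \<times> {..<n})) {..<r}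
      \<le> (130000 * (r * sqrt r) + 28 * (real n)\<^sup>2) * (\<kappa> * u) * \<mu> * family_norm r n X"
proof -
  let ?\<epsilon> = "\<kappa> * u" and ?Q = "{..<n} \<times> {..<n}" and ?Y = "next_mat st r X"
  from alg obtain XB XD where run: "run (fl_step st \<kappa> u r n A B C D E) (rev (pair_list n))
        (\<lambda>_. 0\<^sub>m n n, \<lambda>_. 0\<^sub>m n n, \<lambda>_. 0\<^sub>m n n) (X, XB, XD)"
    by (auto simp: fl_block_back_subst_def)
  have step: "fl_step st \<kappa> u r n A B C D E (i, j) (X, XB, XD) (X, XB, XD)" if "j \<le> i" "i < n" for i j
    by (rule fl_step_final[OF run that r(1)])
  show car: "\<forall>k<r. X k \<in> carrier_mat n n"
    using fl_step_carrier[OF step[OF order_refl n]] by (simp add: state_carrier_def)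
  have \<epsilon>: "0 \<le> ?\<epsilon>" using u by simp
  define \<eta> where "\<eta> = (1 + ?\<epsilon>) ^ (2 * n + 5) - 1"
  have \<eta>0: "0 \<le> \<eta>" using \<epsilon> by (simp add: \<eta>_def)
  have \<eta>: "\<eta> \<le> 14 * n * ?\<epsilon>"
  proof -
    have le: "real (2 * n + 5) * ?\<epsilon> \<le> 7 * real n * ?\<epsilon>" using n \<epsilon> by (intro mult_right_mono) auto
    then have "\<eta> \<le> 2 * (real (2 * n + 5) * ?\<epsilon>)"
      unfolding \<eta>_def using u(4) \<epsilon> by (intro power_one_plus_le) auto
    with le show ?thesis by simp
  qed
  let ?V = "sylv_weight st r n A B C D X" and ?res = "sylv_residual st r n A B C D E X"
  \<comment> \<open>Transposing positions preserves the total norm, hence twice this factor in the result.\<close>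
  define G where "G = 65000 * (r * sqrt r) * ?\<epsilon> * \<mu>"
  have G0: "0 \<le> G" using \<epsilon> \<mu>(3) by (simp add: G_def)
  have "\<exists>R. (\<forall>k. 0 \<le> R k) \<and> (\<forall>k<r. norm (?res k a d) \<le> R k + \<eta> * ?V k a d) \<and>
      L2_set R {..<r} \<le> G * (position_norm r X a d + position_norm r X d a)" if ad: "a < n" "d < n" for a d
  proof -
    note diag = kronecker_bound_diag[OF \<mu>(1,3)] kronecker_bound_diag[OF \<mu>(2,3)]
    have X0: "X 0 \<in> carrier_mat n n" using car r by simp
    from position_residual[OF step r u(1-3) X0 tri diag \<mu>(3) ad] obtain R where
      "\<And>k. 0 \<le> R k" "\<And>k. k < r \<Longrightarrow> norm (?res k a d) \<le> R k + \<eta> * ?V k a d"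
      "L2_set R {..<r} \<le> G * (position_norm r X a d + position_norm r X d a)"
      unfolding \<eta>_def G_def by blast
    then show ?thesis by blast
  qed
  then obtain R where R: "\<And>a d k. a < n \<Longrightarrow> d < n \<Longrightarrow> 0 \<le> R a d k"
    "\<And>a d k. a < n \<Longrightarrow> d < n \<Longrightarrow> k < r \<Longrightarrow> norm (?res k a d) \<le> R a d k + \<eta> * ?V k a d"
    "\<And>a d. a < n \<Longrightarrow> d < n \<Longrightarrow> L2_set (R a d) {..<r} \<le> G * (position_norm r X a d + position_norm r X d a)"
    by metis
  let ?I = "{..<r} \<times> ?Q"
  have fn: "family_norm r n X = L2_set (\<lambda>(a, d). position_norm r X a d) ?Q"
    unfolding family_norm_def position_norm_def split_def by (rule l2_swap[THEN trans]) (simp add: split_def)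
  have fn': "family_norm r n X = L2_set (\<lambda>(a, d). position_norm r X d a) ?Q"
    unfolding fn L2_set_product prod.case by (rule l2_swap)
  let ?E = "\<lambda>(k, a, d). norm (?res k a d)"
  have "L2_set ?E ?I \<le> L2_set (\<lambda>x. (case x of (k, a, d) \<Rightarrow> R a d k) + (\<eta> * (case x of (k, a, d) \<Rightarrow>
      sylv_majorant n (A k) (X k) (B k) a d)
      + \<eta> * (case x of (k, a, d) \<Rightarrow> sylv_majorant n (C k) (?Y k) (D k) a d))) ?I"
    using R(2) by (intro L2_set_mono) (auto simp: sylv_weight_def algebra_simps)
  also have "\<dots> \<le> L2_set (\<lambda>(k, a, d). R a d k) ?I
      + L2_set (\<lambda>x. \<eta> * (case x of (k, a, d) \<Rightarrow> sylv_majorant n (A k) (X k) (B k) a d)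
      + \<eta> * (case x of (k, a, d) \<Rightarrow> sylv_majorant n (C k) (?Y k) (D k) a d)) ?I"
    by (rule L2_set_triangle_ineq)
  also have "L2_set (\<lambda>x. \<eta> * (case x of (k, a, d) \<Rightarrow> sylv_majorant n (A k) (X k) (B k) a d)
      + \<eta> * (case x of (k, a, d) \<Rightarrow> sylv_majorant n (C k) (?Y k) (D k) a d)) ?I
    \<le> L2_set (\<lambda>x. \<eta> * (case x of (k, a, d) \<Rightarrow> sylv_majorant n (A k) (X k) (B k) a d)) ?I
      + L2_set (\<lambda>x. \<eta> * (case x of (k, a, d) \<Rightarrow> sylv_majorant n (C k) (?Y k) (D k) a d)) ?I"
    by (rule L2_set_triangle_ineq)
  also have "L2_set (\<lambda>x. \<eta> * (case x of (k, a, d) \<Rightarrow> sylv_majorant n (A k) (X k) (B k) a d)) ?I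
      = \<eta> * L2_set (\<lambda>(k, a, d). sylv_majorant n (A k) (X k) (B k) a d) ?I"
    using \<eta>0 by (simp add: L2_set_right_distrib)
  also have "L2_set (\<lambda>x. \<eta> * (case x of (k, a, d) \<Rightarrow> sylv_majorant n (C k) (?Y k) (D k) a d)) ?I
      = \<eta> * L2_set (\<lambda>(k, a, d). sylv_majorant n (C k) (?Y k) (D k) a d) ?I"
    using \<eta>0 by (simp add: L2_set_right_distrib)
  also have "L2_set (\<lambda>(k, a, d). sylv_majorant n (A k) (X k) (B k) a d) ?I \<le> n * \<mu> * family_norm r n X"
    unfolding L2_set_product[of _ _ ?Q] prod.case by (rule family_majorant[OF \<mu>(1,3)])
  also have "L2_set (\<lambda>(k, a, d). sylv_majorant n (C k) (?Y k) (D k) a d) ?I \<le> n * \<mu> * family_norm r n ?Y"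
    unfolding L2_set_product[of _ _ ?Q] prod.case by (rule family_majorant[OF \<mu>(2,3)])
  also have "family_norm r n ?Y = family_norm r n X"
    unfolding family_norm_def using car r by (intro L2_next) auto
  also have "L2_set (\<lambda>(k, a, d). R a d k) ?I \<le> G * (2 * family_norm r n X)"
  proof -
    have "L2_set (\<lambda>(k, a, d). R a d k) ?I = L2_set (\<lambda>ad. L2_set (R (fst ad) (snd ad)) {..<r}) ?Q"
      unfolding L2_set_product[of _ _ ?Q] split_def fst_conv snd_conv by (rule l2_swap)
    also have "\<dots> \<le> L2_set (\<lambda>ad. G * ((case ad of (a, d) \<Rightarrow> position_norm r X a d) + (case ad of (a,
        d) \<Rightarrow> position_norm r X d a))) ?Q"
      using R(3) by (intro L2_set_mono) auto
    also have "\<dots> = G * L2_set (\<lambda>ad. (case ad of (a, d) \<Rightarrow> position_norm r X a d) + (case ad of (a,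
        d) \<Rightarrow> position_norm r X d a)) ?Q"
      using G0 by (simp add: L2_set_right_distrib)
    also have "\<dots> \<le> G * (family_norm r n X + family_norm r n X)"
      using G0 L2_set_triangle_ineq[of "\<lambda>(a, d). position_norm r X a d" "\<lambda>(a, d). position_norm r X d a" ?Q]
      unfolding fn[symmetric] fn'[symmetric] by (intro mult_left_mono) auto
    finally show ?thesis by simp
  qed
  also have "G * (2 * family_norm r n X) + (\<eta> * (n * \<mu> * family_norm r n X) + \<eta> * (n * \<mu> * family_norm r n X))
      = 2 * G * family_norm r n X + \<eta> * (2 * (n * \<mu> * family_norm r n X))" by simp
  also have "\<dots> \<le> 2 * G * family_norm r n X + (14 * n * ?\<epsilon>) * (2 * (n * \<mu> * family_norm r n X))"
    using \<eta> \<mu>(3) family_norm_nonneg[of r n X]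
    by (intro add_left_mono mult_right_mono) auto
  also have "\<dots> = (130000 * (r * sqrt r) + 28 * (real n)\<^sup>2) * ?\<epsilon> * \<mu> * family_norm r n X"
    by (simp add: G_def power2_eq_square algebra_simps)
  finally show "L2_set (\<lambda>k. L2_set (\<lambda>(i, j). norm (?res k i j)) ?Q) {..<r}
      \<le> (130000 * (r * sqrt r) + 28 * (real n)\<^sup>2) * ?\<epsilon> * \<mu> * family_norm r n X"
    using \<eta>0 unfolding L2_set_product[of _ _ ?Q] prod.case by (simp add: mult_left_mono)
qed

section \<open>Matrices of linear maps and the spectral norm\<close>

lemma matrix_of_mult:
  fixes f :: "'a::comm_ring_1 vec \<Rightarrow> 'a vec"
  assumes dim: "\<And>x. x \<in> carrier_vec N \<Longrightarrow> f x \<in> carrier_vec N"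
    and lin: "\<And>x y a. x \<in> carrier_vec N \<Longrightarrow> y \<in> carrier_vec N \<Longrightarrow>
      f (x + a \<cdot>\<^sub>v y) = f x + a \<cdot>\<^sub>v f y"
    and x: "x \<in> carrier_vec N"
  shows "matrix_of N f *\<^sub>v x = f x"
proof (rule eq_vecI)
  fix p assume "p < dim_vec (f x)"
  then have p: "p < N" using dim[OF x] by simp
  \<comment> \<open>Induction on the number of leading components that may be nonzero.\<close>
  have "f x $ p = (\<Sum>q<m. f (unit_vec N q) $ p * x $ q)"
    if "m \<le> N" "x \<in> carrier_vec N" "\<And>q. m \<le> q \<Longrightarrow> q < N \<Longrightarrow> x $ q = 0" for m x
    using that
  proof (induction m arbitrary: x)
    case 0
    have z: "0\<^sub>v N \<in> carrier_vec N" by simp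
    have "x = 0\<^sub>v N" using 0 by (intro eq_vecI) auto
    moreover have "f (0\<^sub>v N + 1 \<cdot>\<^sub>v 0\<^sub>v N) = f (0\<^sub>v N) + 1 \<cdot>\<^sub>v f (0\<^sub>v N)" by (rule lin[OF z z])
    then have "f (0\<^sub>v N) $ p = (f (0\<^sub>v N) + 1 \<cdot>\<^sub>v f (0\<^sub>v N)) $ p" by simp
    then have "f (0\<^sub>v N) $ p = 0" using dim[OF z] p by auto
    ultimately show ?case by simp
  next
    case (Suc m)
    define y where "y = vec N (\<lambda>q. if q = m then 0 else x $ q)"
    have y: "y \<in> carrier_vec N" by (simp add: y_def)
    have u: "unit_vec N m \<in> carrier_vec N" by simp
    have "x = y + x $ m \<cdot>\<^sub>v unit_vec N m"
      using Suc.prems by (intro eq_vecI) (auto simp: y_def unit_vec_def)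
    then have "f x $ p = (f y + x $ m \<cdot>\<^sub>v f (unit_vec N m)) $ p" using lin[OF y u] by metis
    also have "\<dots> = f y $ p + x $ m * f (unit_vec N m) $ p" using dim[OF y] dim[OF u] p by auto
    also have "f y $ p = (\<Sum>q<m. f (unit_vec N q) $ p * y $ q)"
    proof (rule Suc.IH[OF _ y])
      show "y $ q = 0" if "m \<le> q" "q < N" for q
        using Suc.prems(3)[of q] that by (auto simp: y_def)
    qed (use Suc.prems in simp)
    also have "\<dots> = (\<Sum>q<m. f (unit_vec N q) $ p * x $ q)"
      using Suc.prems by (intro sum.cong) (auto simp: y_def)
    finally show ?case by (simp add: mult.commute)
  qed
  from this[OF order_refl x] have "f x $ p = (\<Sum>q<N. f (unit_vec N q) $ p * x $ q)" by simp
  then show "(matrix_of N f *\<^sub>v x) $ p = f x $ p"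
    using p x by (simp add: matrix_of_def scalar_prod_def lessThan_atLeast0)
qed (use dim[OF x] in \<open>simp add: matrix_of_def\<close>)

lemma vec_norm2_l2: "vec_norm2 x = l2 (\<lambda>i. x $ i) {..<dim_vec x}"
  by (simp add: vec_norm2_def L2_set_def)

lemma vec_norm2_nonneg: "0 \<le> vec_norm2 x"
  by (simp add: vec_norm2_l2)

lemma vec_norm2_component: "i < dim_vec x \<Longrightarrow> norm (x $ i) \<le> vec_norm2 x"
  unfolding vec_norm2_l2 by (rule member_le_L2_set) auto

lemma vec_norm2_smult: "vec_norm2 (a \<cdot>\<^sub>v x) = norm a * vec_norm2 (x :: 'a::real_normed_field vec)"
proof -
  have "vec_norm2 (a \<cdot>\<^sub>v x) = L2_set (\<lambda>i. norm a * norm (x $ i)) {..<dim_vec x}"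
    unfolding vec_norm2_l2 by (intro L2_set_cong) (auto simp: norm_mult)
  then show ?thesis by (simp add: vec_norm2_l2 L2_set_right_distrib)
qed

lemma mult_mat_vec_entry:
  assumes "M \<in> carrier_mat R N" "x \<in> carrier_vec N" "i < R"
  shows "(M *\<^sub>v x) $ i = (\<Sum>j<N. M $$ (i, j) * x $ j)"
  using assms by (simp add: scalar_prod_def lessThan_atLeast0)

text \<open>
  The supremum in the definition of the norm is over a set that is bounded by the sum of the column
  norms.
\<close>

lemma mat_norm2_bound:
  fixes M :: "'a::real_normed_field mat"
  assumes M: "M \<in> carrier_mat R N" and x: "x \<in> carrier_vec N"
  shows "vec_norm2 (M *\<^sub>v x) \<le> mat_norm2 M * vec_norm2 x"
proof -
  have le: "vec_norm2 (M *\<^sub>v y) \<le> (\<Sum>j<N. l2 (\<lambda>i. M $$ (i, j)) {..<R} * norm (y $ j))"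
    if "y \<in> carrier_vec N" for y
  proof -
    have "vec_norm2 (M *\<^sub>v y) = l2 (\<lambda>i. \<Sum>j<N. M $$ (i, j) * y $ j) {..<R}"
      unfolding vec_norm2_l2 using mult_mat_vec_entry[OF M that] M
      by (intro L2_set_cong) auto
    also have "\<dots> \<le> (\<Sum>j<N. l2 (\<lambda>i. M $$ (i, j)) {..<R} * norm (y $ j))"
      by (rule l2_lincomb) simp
    finally show ?thesis .
  qed
  have bdd: "bdd_above ((\<lambda>x. vec_norm2 (M *\<^sub>v x)) ` {x \<in> carrier_vec (dim_col M). vec_norm2 x \<le> 1})"
  proof (rule bdd_aboveI2)
    fix y :: "'a vec" assume "y \<in> {x \<in> carrier_vec (dim_col M). vec_norm2 x \<le> 1}"
    then have y: "y \<in> carrier_vec N" "vec_norm2 y \<le> 1" using M by auto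
    have "norm (y $ j) \<le> 1" if "j < N" for j
      using vec_norm2_component[of j y] y that by auto
    then have "(\<Sum>j<N. l2 (\<lambda>i. M $$ (i, j)) {..<R} * norm (y $ j)) \<le> (\<Sum>j<N. l2 (\<lambda>i. M $$ (i, j)) {..<R} * 1)"
      by (intro sum_mono mult_left_mono) auto
    then show "vec_norm2 (M *\<^sub>v y) \<le> (\<Sum>j<N. l2 (\<lambda>i. M $$ (i, j)) {..<R})" using le[OF y(1)] by simp
  qed
  show ?thesis
  proof (cases "vec_norm2 x = 0")
    case True
    then have "norm (x $ j) = 0" if "j < N" for j
      using vec_norm2_component[of j x] x that by auto
    then have "vec_norm2 (M *\<^sub>v x) \<le> 0" using le[OF x] by simp
    then show ?thesis using True by simp
  next
    case False
    then have pos: "vec_norm2 x > 0" using vec_norm2_nonneg[of x] by simp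
    define a :: 'a where "a = of_real (inverse (vec_norm2 x))"
    have na: "norm a = inverse (vec_norm2 x)" using pos unfolding a_def norm_of_real by simp
    have "a \<cdot>\<^sub>v x \<in> {x \<in> carrier_vec (dim_col M). vec_norm2 x \<le> 1}"
      using x M pos by (simp add: vec_norm2_smult na)
    then have "vec_norm2 (M *\<^sub>v (a \<cdot>\<^sub>v x)) \<le> mat_norm2 M"
      unfolding mat_norm2_def using bdd by (rule cSUP_upper)
    then have "norm a * vec_norm2 (M *\<^sub>v x) \<le> mat_norm2 M"
      using mult_mat_vec[OF M x, of a] by (simp add: vec_norm2_smult)
    then show ?thesis using pos by (simp add: na field_simps)
  qed
qed

lemma mat_norm2_nonneg: "0 \<le> mat_norm2 (M :: 'a::real_normed_field mat)"
proof (cases "dim_col M")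
  case 0
  have "{x \<in> carrier_vec (dim_col M). vec_norm2 (x :: 'a vec) \<le> 1} = {0\<^sub>v 0}"
    using 0 by (auto simp: vec_norm2_def)
  then show ?thesis unfolding mat_norm2_def by (simp add: vec_norm2_nonneg)
next
  case (Suc m)
  let ?e = "unit_vec (dim_col M) 0 :: 'a vec"
  have "1 \<le> vec_norm2 ?e" using vec_norm2_component[of 0 ?e] Suc by simp
  moreover have "0 \<le> mat_norm2 M * vec_norm2 ?e"
    using mat_norm2_bound[of M "dim_row M" "dim_col M" ?e] vec_norm2_nonneg[of "M *\<^sub>v ?e"] by auto
  ultimately show ?thesis by (simp add: zero_le_mult_iff)
qed

lemma mat_norm2_leI:
  fixes M :: "'a::real_normed_field mat"
  assumes "\<And>x. x \<in> carrier_vec (dim_col M) \<Longrightarrow> vec_norm2 (M *\<^sub>v x) \<le> K * vec_norm2 x" "0 \<le> K"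
  shows "mat_norm2 M \<le> K"
  unfolding mat_norm2_def
proof (rule cSUP_least)
  have "0\<^sub>v (dim_col M) \<in> {x \<in> carrier_vec (dim_col M). vec_norm2 (x :: 'a vec) \<le> 1}"
    by (simp add: vec_norm2_def)
  then show "{x \<in> carrier_vec (dim_col M). vec_norm2 (x :: 'a vec) \<le> 1} \<noteq> {}" by blast
  fix x :: "'a vec" assume "x \<in> {x \<in> carrier_vec (dim_col M). vec_norm2 x \<le> 1}"
  then have "vec_norm2 (M *\<^sub>v x) \<le> K * vec_norm2 x" "vec_norm2 x \<le> 1" using assms(1) by auto
  then show "vec_norm2 (M *\<^sub>v x) \<le> K" using mult_left_mono[of "vec_norm2 x" 1 K] assms(2) by simp
qed

section \<open>From the residual to the backward error\<close>

text \<open>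
  The perturbation \<open>\<rho> x\<^sup>H / \<parallel>x\<parallel>\<^sup>2\<close> maps \<open>x\<close> to the residual \<open>\<rho>\<close>. If \<open>x = 0\<close>, the hypothesis forces
  \<open>\<rho> = 0\<close>, and the perturbation is zero, because division by zero yields zero.
\<close>

lemma backward_error_of_residual:
  fixes M :: "'a::{real_normed_field, conjugatable_field} mat"
  assumes conj: "\<And>z::'a. z * conjugate z = of_real ((norm z)\<^sup>2)"
    and M: "M \<in> carrier_mat N N" and x: "x \<in> carrier_vec N" and e: "e \<in> carrier_vec N"
    and res: "vec_norm2 (e - M *\<^sub>v x) \<le> \<mu> * mat_norm2 M * vec_norm2 x" and pos: "0 \<le> \<mu>" "0 \<le> \<eta>"
  shows "backward_error_le M x e \<mu> \<eta>"
proof -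
  define \<rho> where "\<rho> = e - M *\<^sub>v x"
  have \<rho>: "\<rho> \<in> carrier_vec N" using M x e by (simp add: \<rho>_def)
  define dM where "dM = mat N N (\<lambda>(p, q). \<rho> $ p * (conjugate (x $ q) / of_real ((vec_norm2 x)\<^sup>2)))"
  have dM: "dM \<in> carrier_mat N N" by (simp add: dM_def)
  have ent: "(dM *\<^sub>v y) $ p = \<rho> $ p * ((\<Sum>q<N. conjugate (x $ q) * y $ q) / of_real ((vec_norm2 x)\<^sup>2))"
    if "p < N" "y \<in> carrier_vec N" for p y
    unfolding mult_mat_vec_entry[OF dM that(2,1)] using that(1)
    by (simp add: dM_def sum_distrib_left sum_divide_distrib mult.assoc)
  have e0: "e = M *\<^sub>v x + \<rho>" using M x e by (intro eq_vecI) (auto simp: \<rho>_def)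
  have K0: "0 \<le> \<mu> * mat_norm2 M" using pos by (simp add: mat_norm2_nonneg)
  have dMx: "dM *\<^sub>v x = \<rho>"
  proof (rule eq_vecI)
    fix p assume "p < dim_vec \<rho>"
    then have p: "p < N" using \<rho> by simp
    show "(dM *\<^sub>v x) $ p = \<rho> $ p"
    proof (cases "vec_norm2 x = 0")
      case True
      then have "vec_norm2 \<rho> \<le> 0" using res by (simp add: \<rho>_def)
      moreover have "norm (\<rho> $ p) \<le> vec_norm2 \<rho>" using \<rho> p by (intro vec_norm2_component) simp
      ultimately have "norm (\<rho> $ p) \<le> 0" by linarith
      then show ?thesis unfolding ent[OF p x] by simp
    next
      case False
      have "(\<Sum>q<N. conjugate (x $ q) * x $ q) = of_real (\<Sum>q<N. (norm (x $ q))\<^sup>2)"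
        unfolding of_real_sum conj[symmetric] by (simp add: mult.commute)
      also have "(\<Sum>q<N. (norm (x $ q))\<^sup>2) = (vec_norm2 x)\<^sup>2"
        using x by (simp add: vec_norm2_l2 l2_power2)
      finally show ?thesis using False unfolding ent[OF p x] by simp
    qed
  qed (use \<rho> dM in simp)
  have "mat_norm2 dM \<le> \<mu> * mat_norm2 M"
  proof (rule mat_norm2_leI[OF _ K0])
    fix y :: "'a vec" assume "y \<in> carrier_vec (dim_col dM)"
    then have y: "y \<in> carrier_vec N" using dM by simp
    define s where "s = (\<Sum>q<N. conjugate (x $ q) * y $ q)"
    have "norm s \<le> (\<Sum>q<N. \<bar>norm (x $ q)\<bar> * \<bar>norm (y $ q)\<bar>)"
      unfolding s_def by (rule norm_sum[THEN order_trans]) (simp add: norm_mult norm_conjugate[OF conj])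
    also have "\<dots> \<le> vec_norm2 x * vec_norm2 y"
      using L2_set_mult_ineq[of "\<lambda>q. norm (x $ q)" "\<lambda>q. norm (y $ q)" "{..<N}"] x y
      by (simp add: vec_norm2_l2)
    finally have s: "norm s \<le> vec_norm2 x * vec_norm2 y" .
    have "dM *\<^sub>v y = (s / of_real ((vec_norm2 x)\<^sup>2)) \<cdot>\<^sub>v \<rho>"
      using dM \<rho> ent[OF _ y] by (intro eq_vecI) (auto simp: s_def)
    then have "vec_norm2 (dM *\<^sub>v y) = norm s / (vec_norm2 x)\<^sup>2 * vec_norm2 \<rho>"
      by (simp add: vec_norm2_smult norm_divide norm_power vec_norm2_nonneg)
    also have "\<dots> \<le> \<mu> * mat_norm2 M * vec_norm2 y"
    proof (cases "vec_norm2 x = 0")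
      case True
      then show ?thesis using K0 by (simp add: vec_norm2_nonneg)
    next
      case False
      then have px: "vec_norm2 x > 0" using vec_norm2_nonneg[of x] by simp
      have "norm s / (vec_norm2 x)\<^sup>2 * vec_norm2 \<rho>
          \<le> (vec_norm2 x * vec_norm2 y) / (vec_norm2 x)\<^sup>2 * (\<mu> * mat_norm2 M * vec_norm2 x)"
        using s res K0 vec_norm2_nonneg[of x] vec_norm2_nonneg[of y] unfolding \<rho>_def[symmetric]
        by (intro mult_mono divide_right_mono) (auto simp: vec_norm2_nonneg)
      also have "\<dots> = \<mu> * mat_norm2 M * vec_norm2 y" using px by (simp add: power2_eq_square)
      finally show ?thesis .
    qed
    finally show "vec_norm2 (dM *\<^sub>v y) \<le> \<mu> * mat_norm2 M * vec_norm2 y" .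
  qed
  moreover have "(M + dM) *\<^sub>v x = e + 0\<^sub>v N"
  proof -
    have "(M + dM) *\<^sub>v x = M *\<^sub>v x + dM *\<^sub>v x" by (rule add_mult_distrib_mat_vec[OF M dM x])
    then show ?thesis using e unfolding dMx e0[symmetric] by simp
  qed
  moreover have "vec_norm2 (0\<^sub>v N :: 'a vec) = 0" by (simp add: vec_norm2_def)
  ultimately show ?thesis unfolding backward_error_le_def
    using dM M e pos vec_norm2_nonneg[of e]
    by (intro exI[of _ dM] exI[of _ "0\<^sub>v N"]) auto
qed

section \<open>Vectorization\<close>

lemma family_norm_power2:
  "(family_norm r n X)\<^sup>2 = (\<Sum>k<r. \<Sum>j<n. \<Sum>i<n. (norm (X k $$ (i, j)))\<^sup>2)"
proof -
  have "(family_norm r n X)\<^sup>2 = (\<Sum>k<r. \<Sum>i<n. \<Sum>j<n. (norm (X k $$ (i, j)))\<^sup>2)"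
    by (simp add: family_norm_def l2_power2 sum.cartesian_product split_def)
  also have "\<dots> = (\<Sum>k<r. \<Sum>j<n. \<Sum>i<n. (norm (X k $$ (i, j)))\<^sup>2)"
    by (intro sum.cong refl sum.swap)
  finally show ?thesis .
qed

lemma vec_index:
  assumes "i < n" "j < (n::nat)"
  shows "(k * n\<^sup>2 + (j * n + i)) div n\<^sup>2 = k" "(k * n\<^sup>2 + (j * n + i)) mod n = i"
    "(k * n\<^sup>2 + (j * n + i)) mod n\<^sup>2 div n = j"
proof -
  have "(j + 1) * n \<le> n * n" using assms by (intro mult_right_mono) auto
  then have lt: "j * n + i < n\<^sup>2" using assms by (simp add: power2_eq_square algebra_simps)
  then have nz: "n\<^sup>2 \<noteq> 0" by linarith
  show "(k * n\<^sup>2 + (j * n + i)) div n\<^sup>2 = k"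
    unfolding div_mult_self3[OF nz] using lt by (simp only: div_less)
  have "(k * n\<^sup>2 + (j * n + i)) mod n\<^sup>2 = j * n + i"
    unfolding mod_mult_self3 using lt by (rule mod_less)
  then show "(k * n\<^sup>2 + (j * n + i)) mod n\<^sup>2 div n = j" using assms by simp
  have "k * n\<^sup>2 + (j * n + i) = i + (k * n + j) * n" by (simp add: power2_eq_square algebra_simps)
  then show "(k * n\<^sup>2 + (j * n + i)) mod n = i" using assms by (metis mod_mult_self1 mod_less)
qed

lemma vec_norm2_vecs: "vec_norm2 (vecs r n X) = family_norm r n X"
proof -
  have "(\<Sum>p<r * n\<^sup>2. (norm (vecs r n X $ p))\<^sup>2)
      = (\<Sum>p<r * n\<^sup>2. (norm (X (p div n\<^sup>2) $$ (p mod n, p mod n\<^sup>2 div n)))\<^sup>2)"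
    by (simp add: vecs_def)
  also have "\<dots> = (\<Sum>k<r. \<Sum>m<n\<^sup>2. (norm (X ((k * n\<^sup>2 + m) div n\<^sup>2) $$ ((k * n\<^sup>2 + m) mod n, (k * n\<^sup>2
      + m) mod n\<^sup>2 div n)))\<^sup>2)"
    by (rule sum_blocks)
  also have "\<dots> = (\<Sum>k<r. \<Sum>j<n. \<Sum>i<n. (norm (X k $$ (i, j)))\<^sup>2)"
  proof (rule sum.cong[OF refl])
    fix k
    have nn: "{..<n\<^sup>2} = {..<n * n}" by (simp add: power2_eq_square)
    show "(\<Sum>m<n\<^sup>2. (norm (X ((k * n\<^sup>2 + m) div n\<^sup>2) $$ ((k * n\<^sup>2 + m) mod n, (k * n\<^sup>2 + m) mod n\<^sup>2 div n)))\<^sup>2)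
        = (\<Sum>j<n. \<Sum>i<n. (norm (X k $$ (i, j)))\<^sup>2)"
      unfolding nn sum_blocks[of _ n n] by (intro sum.cong refl) (simp only: lessThan_iff vec_index)
  qed
  finally have "(\<Sum>p<r * n\<^sup>2. (norm (vecs r n X $ p))\<^sup>2) = (family_norm r n X)\<^sup>2"
    by (simp add: family_norm_power2)
  then show ?thesis by (simp add: vec_norm2_def vecs_def family_norm_nonneg)
qed

lemma unvecs_carrier: "unvecs n x k \<in> carrier_mat n n"
  by (simp add: unvecs_def)

lemma unvecs_index: "i < n \<Longrightarrow> j < n \<Longrightarrow> unvecs n x k $$ (i, j) = x $ (k * n\<^sup>2 + j * n + i)"
  by (simp add: unvecs_def)

lemma vec_index_less:
  assumes "k < r" "i < n" "j < (n::nat)"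
  shows "k * n\<^sup>2 + j * n + i < r * n\<^sup>2"
proof -
  have "(j + 1) * n \<le> n * n" "(k + 1) * n\<^sup>2 \<le> r * n\<^sup>2"
    using assms by (intro mult_right_mono; simp)+
  then show ?thesis using assms by (simp add: power2_eq_square algebra_simps)
qed

lemma unvecs_vecs:
  assumes "X k \<in> carrier_mat n n" "k < r"
  shows "unvecs n (vecs r n X) k = X k"
proof (rule eq_matI)
  fix i j assume "i < dim_row (X k)" "j < dim_col (X k)"
  then have ij: "i < n" "j < n" using assms by auto
  show "unvecs n (vecs r n X) k $$ (i, j) = X k $$ (i, j)"
    using vec_index_less[OF assms(2) ij] vec_index[OF ij, of k]
    by (simp add: unvecs_index ij vecs_def add.assoc)
qed (use assms in \<open>auto simp: unvecs_def\<close>)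

lemma next_mat_carrier:
  assumes "\<And>k. k < r \<Longrightarrow> X k \<in> carrier_mat n n" "k < r"
  shows "next_mat st r X k \<in> carrier_mat n n"
  using assms(1)[of 0] assms(1)[of "Suc k"] assms(2) by (cases st) (auto simp: next_mat_def)

lemma mat_prod_entry:
  assumes "A \<in> carrier_mat n n" "B \<in> carrier_mat n n" "i < n" "j < n"
  shows "(A * B) $$ (i, j) = (\<Sum>s<n. A $$ (i, s) * B $$ (s, j))"
  using assms by (simp add: scalar_prod_def lessThan_atLeast0)

lemma mat_prod3_entry:
  assumes "A \<in> carrier_mat n n" "X \<in> carrier_mat n n" "B \<in> carrier_mat n n" "i < n" "j < n"
  shows "(A * X * B) $$ (i, j) = sylv_entry n A X B i j"
proof -
  have "(A * X * B) $$ (i, j) = (\<Sum>t<n. (\<Sum>s<n. A $$ (i, s) * X $$ (s, t)) * B $$ (t, j))"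
    unfolding mat_prod_entry[OF mult_carrier_mat[OF assms(1,2)] assms(3-5)]
    by (intro sum.cong refl) (simp only: mat_prod_entry[OF assms(1,2,4)] lessThan_iff)
  also have "\<dots> = (\<Sum>t<n. \<Sum>s<n. A $$ (i, s) * X $$ (s, t) * B $$ (t, j))"
    by (simp add: sum_distrib_right)
  also have "\<dots> = sylv_entry n A X B i j" unfolding sylv_entry_def by (rule sum.swap)
  finally show ?thesis .
qed

lemma sylv_op_cong:
  assumes "\<And>k. k < r \<Longrightarrow> X k = Y k" "k < r"
  shows "sylv_op st r A B C D X k = sylv_op st r A B C D Y k"
proof -
  have "X 0 = Y 0" "Suc k \<noteq> r \<Longrightarrow> X (Suc k) = Y (Suc k)" using assms by auto
  then show ?thesis using assms by (simp add: sylv_op_def next_mat_def)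
qed

lemma vecs_cong:
  assumes "\<And>k. k < r \<Longrightarrow> X k = Y k" shows "vecs r n X = vecs r n Y"
  unfolding vecs_def
proof (rule eq_vecI)
  fix p assume "p < dim_vec (vec (r * n\<^sup>2) (\<lambda>p. Y (p div n\<^sup>2) $$ (p mod n, p mod n\<^sup>2 div n)))"
  then have p: "p < r * n\<^sup>2" by simp
  then have "p div n\<^sup>2 < r" by (metis div_less_iff_less_mult less_nat_zero_code mult_0_right not_gr_zero)
  then show "vec (r * n\<^sup>2) (\<lambda>p. X (p div n\<^sup>2) $$ (p mod n, p mod n\<^sup>2 div n)) $ p
      = vec (r * n\<^sup>2) (\<lambda>p. Y (p div n\<^sup>2) $$ (p mod n, p mod n\<^sup>2 div n)) $ p"
    using p assms by simp
qed simp

context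
  fixes st :: star and r n :: nat and A B C D :: "nat \<Rightarrow> complex mat"
  assumes coeff: "\<And>k. k < r \<Longrightarrow> A k \<in> carrier_mat n n" "\<And>k. k < r \<Longrightarrow> B k \<in> carrier_mat n n"
    "\<And>k. k < r \<Longrightarrow> C k \<in> carrier_mat n n" "\<And>k. k < r \<Longrightarrow> D k \<in> carrier_mat n n"
begin

lemma sylv_op_entry:
  assumes X: "\<And>k. k < r \<Longrightarrow> X k \<in> carrier_mat n n" and k: "k < r"
  shows "sylv_op st r A B C D X k \<in> carrier_mat n n"
    and "\<And>i j. i < n \<Longrightarrow> j < n \<Longrightarrow> sylv_op st r A B C D X k $$ (i, j)
      = sylv_entry n (A k) (X k) (B k) i j - sylv_entry n (C k) (next_mat st r X k) (D k) i j"
proof -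
  note c = coeff[OF k] X[OF k] next_mat_carrier[where st = st, OF X k]
  show "sylv_op st r A B C D X k \<in> carrier_mat n n" using c by (auto simp: sylv_op_def)
  show "sylv_op st r A B C D X k $$ (i, j)
      = sylv_entry n (A k) (X k) (B k) i j - sylv_entry n (C k) (next_mat st r X k) (D k) i j"
    if "i < n" "j < n" for i j
  proof -
    have "sylv_op st r A B C D X k $$ (i, j)
        = (A k * X k * B k) $$ (i, j) - (C k * next_mat st r X k * D k) $$ (i, j)"
      using c that by (simp add: sylv_op_def)
    then show ?thesis using c that by (simp only: mat_prod3_entry)
  qed
qed

lemma sylv_op_unvecs_vecs:
  assumes "\<And>k. k < r \<Longrightarrow> X k \<in> carrier_mat n n"
  shows "vecs r n (sylv_op st r A B C D (unvecs n (vecs r n X))) = vecs r n (sylv_op st r A B C D X)"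
  using assms by (intro vecs_cong sylv_op_cong unvecs_vecs)

lemma vecs_sylv_linear:
  assumes x: "x \<in> carrier_vec (r * n\<^sup>2)" and y: "y \<in> carrier_vec (r * n\<^sup>2)" and a: "st = ConjTransp
      \<Longrightarrow> cnj a = a"
  shows "vecs r n (sylv_op st r A B C D (unvecs n (x + a \<cdot>\<^sub>v y)))
    = vecs r n (sylv_op st r A B C D (unvecs n x)) + a \<cdot>\<^sub>v vecs r n (sylv_op st r A B C D (unvecs n y))"
proof (rule eq_vecI)
  fix p assume "p < dim_vec (vecs r n (sylv_op st r A B C D (unvecs n x))
    + a \<cdot>\<^sub>v vecs r n (sylv_op st r A B C D (unvecs n y)))"
  then have p: "p < r * n\<^sup>2" by (simp add: vecs_def)
  then have n: "0 < n" by (cases n) auto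
  define k i j where "k = p div n\<^sup>2" "i = p mod n" "j = p mod n\<^sup>2 div n"
  have kij: "k < r" "i < n" "j < n"
    using p n by (auto simp: k_i_j_def div_less_iff_less_mult power2_eq_square)
  let ?Z = "unvecs n (x + a \<cdot>\<^sub>v y)" and ?X = "unvecs n x" and ?Y = "unvecs n y"
  have Z: "?Z l $$ (s, t) = ?X l $$ (s, t) + a * ?Y l $$ (s, t)" if "l < r" "s < n" "t < n" for l s t
    using vec_index_less[OF that] x y that by (simp add: unvecs_index)
  have N: "next_mat st r ?Z k $$ (s, t) = next_mat st r ?X k $$ (s, t) + a * next_mat st r ?Y k $$ (s, t)"
    if "s < n" "t < n" for s t
  proof -
    note e = next_mat_entry[where X = "unvecs n w" and n = n for w, OF unvecs_carrier that]
    show ?thesis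
    proof (cases "Suc k = r")
      case True
      then show ?thesis unfolding e using Z[of 0 t s] that kij a by (cases st) auto
    next
      case False
      then show ?thesis unfolding e using Z[of "Suc k" s t] that kij by auto
    qed
  qed
  have lin: "sylv_entry n F U G i j = sylv_entry n F V G i j + a * sylv_entry n F W G i j"
    if "\<And>s t. s < n \<Longrightarrow> t < n \<Longrightarrow> U $$ (s, t) = V $$ (s, t) + a * W $$ (s, t)" for F G U V W
    unfolding sylv_entry_def sum_distrib_left sum.distrib[symmetric]
    using that by (intro sum.cong) (auto simp: algebra_simps)
  have ent: "vecs r n (sylv_op st r A B C D (unvecs n w)) $ p
      = sylv_entry n (A k) (unvecs n w k) (B k) i j - sylv_entry n (C k) (next_mat st r (unvecs n
          w) k) (D k) i j" for w
    using p sylv_op_entry(2)[where X = "unvecs n w", OF unvecs_carrier kij]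
    by (simp add: vecs_def k_i_j_def)
  show "vecs r n (sylv_op st r A B C D ?Z) $ p
    = (vecs r n (sylv_op st r A B C D ?X) + a \<cdot>\<^sub>v vecs r n (sylv_op st r A B C D ?Y)) $ p"
  proof -
    have dv: "dim_vec (vecs r n U) = r * n\<^sup>2" for U by (simp add: vecs_def)
    have "(vecs r n (sylv_op st r A B C D ?X) + a \<cdot>\<^sub>v vecs r n (sylv_op st r A B C D ?Y)) $ p
      = vecs r n (sylv_op st r A B C D ?X) $ p + a * vecs r n (sylv_op st r A B C D ?Y) $ p"
      using p by (simp add: dv)
    moreover have "sylv_entry n (A k) (?Z k) (B k) i j
      = sylv_entry n (A k) (?X k) (B k) i j + a * sylv_entry n (A k) (?Y k) (B k) i j"
      using Z[OF kij(1)] by (rule lin)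
    moreover have "sylv_entry n (C k) (next_mat st r ?Z k) (D k) i j
      = sylv_entry n (C k) (next_mat st r ?X k) (D k) i j + a * sylv_entry n (C k) (next_mat st r
          ?Y k) (D k) i j"
      using N by (rule lin)
    ultimately show ?thesis unfolding ent by (simp add: algebra_simps)
  qed
qed (simp add: vecs_def)

end

lemma vecs_carrier: "vecs r n X \<in> carrier_vec (r * n\<^sup>2)"
  by (simp add: vecs_def)

lemma realify_carrier: "x \<in> carrier_vec N \<Longrightarrow> realify x \<in> carrier_vec (2 * N)"
  by (auto simp: realify_def)

lemma complexify_carrier: "x \<in> carrier_vec (2 * N) \<Longrightarrow> complexify x \<in> carrier_vec N"
  by (auto simp: complexify_def)

lemma complexify_realify: "complexify (realify x) = x"
  by (rule eq_vecI) (auto simp: complexify_def realify_def)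

lemma realify_linear:
  assumes "x \<in> carrier_vec N" "y \<in> carrier_vec N"
  shows "realify (x + of_real a \<cdot>\<^sub>v y) = realify x + a \<cdot>\<^sub>v realify y"
  using assms by (intro eq_vecI) (auto simp: realify_def)

lemma complexify_linear:
  assumes "x \<in> carrier_vec (2 * N)" "y \<in> carrier_vec (2 * N)"
  shows "complexify (x + a \<cdot>\<^sub>v y) = complexify x + of_real a \<cdot>\<^sub>v complexify y"
  using assms by (intro eq_vecI) (auto simp: complexify_def complex_eq_iff)

lemma vec_norm2_realify: "vec_norm2 (realify x) = vec_norm2 x"
  unfolding vec_norm2_l2
proof (rule trans)
  show "l2 (\<lambda>i. realify x $ i) {..<dim_vec (realify x)} = l2 (\<lambda>i. realify x $ i) {..<2 * dim_vec x}"
    by (simp add: realify_def)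
  show "l2 (\<lambda>i. realify x $ i) {..<2 * dim_vec x} = l2 (\<lambda>i. x $ i) {..<dim_vec x}"
    by (rule l2_complex_parts) (auto simp: realify_def)
qed

section \<open>Kronecker blocks of the system matrix\<close>

definition single_family :: "nat \<Rightarrow> nat \<Rightarrow> nat \<Rightarrow> nat \<Rightarrow> complex \<Rightarrow> nat \<Rightarrow> complex mat" where
  "single_family n l s t \<omega> k = mat n n (\<lambda>(i, j). if k = l \<and> i = s \<and> j = t then \<omega> else 0)"

lemma single_family_norm:
  assumes "norm \<omega> = 1"
  shows "family_norm r n (single_family n l s t \<omega>) \<le> 1"
proof -
  have "(\<Sum>k<r. \<Sum>j<n. \<Sum>i<n. (norm (single_family n l s t \<omega> k $$ (i, j)))\<^sup>2)
      = (\<Sum>k<r. \<Sum>j<n. \<Sum>i<n. if i = s then if j = t then if k = l then 1 else 0 else 0 else 0 :: real)"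
    by (intro sum.cong refl) (auto simp: single_family_def assms)
  also have "\<dots> \<le> 1" by (cases "s < n"; cases "t < n"; cases "l < r") simp_all
  finally have "(family_norm r n (single_family n l s t \<omega>))\<^sup>2 \<le> 1\<^sup>2" by (simp add: family_norm_power2)
  then show ?thesis by (rule power2_le_imp_le) simp
qed

lemma sylv_entry_single:
  assumes "\<And>s' t'. s' < n \<Longrightarrow> t' < n \<Longrightarrow> X $$ (s', t') = (if s' = s \<and> t' = t then \<omega> else 0)" "s < n" "t < n"
  shows "sylv_entry n A X B i j = A $$ (i, s) * \<omega> * B $$ (t, j)"
proof -
  have "(\<Sum>t'<n. A $$ (i, s') * X $$ (s', t') * B $$ (t', j)) = (if s' = s then A $$ (i, s) * \<omega> * B
      $$ (t, j) else 0)"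
    if "s' < n" for s'
  proof -
    have "(\<Sum>t'<n. A $$ (i, s') * X $$ (s', t') * B $$ (t', j))
        = (\<Sum>t'<n. if t' = t then if s' = s then A $$ (i, s) * \<omega> * B $$ (t, j) else 0 else 0)"
      using assms(1)[OF that] by (intro sum.cong refl) auto
    then show ?thesis using assms(3) by simp
  qed
  then have "sylv_entry n A X B i j = (\<Sum>s'<n. if s' = s then A $$ (i, s) * \<omega> * B $$ (t, j) else 0)"
    unfolding sylv_entry_def by (intro sum.cong refl) simp
  then show ?thesis using assms(2) by simp
qed

lemma sylv_entry_zero:
  assumes "\<And>s' t'. s' < n \<Longrightarrow> t' < n \<Longrightarrow> X $$ (s', t') = 0"
  shows "sylv_entry n A X B i j = 0"
  unfolding sylv_entry_def using assms by (intro sum.neutral ballI) auto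

lemma family_norm_member:
  assumes "k < r"
  shows "(\<Sum>(i, j)\<in>{..<n} \<times> {..<n}. (norm (Z k $$ (i, j)))\<^sup>2) \<le> (family_norm r n Z)\<^sup>2"
proof -
  have "(\<Sum>(i, j)\<in>{..<n} \<times> {..<n}. (norm (Z k $$ (i, j)))\<^sup>2)
      \<le> (\<Sum>k<r. \<Sum>(i, j)\<in>{..<n} \<times> {..<n}. (norm (Z k $$ (i, j)))\<^sup>2)"
    using assms by (intro member_le_sum[where f = "\<lambda>k. \<Sum>(i, j)\<in>{..<n} \<times> {..<n}. (norm (Z k $$ (i, j)))\<^sup>2"])
      (auto intro!: sum_nonneg)
  then show ?thesis by (simp add: family_norm_def l2_power2 split_def)
qed

text \<open>
  The assumption on \<open>\<mu>\<close> is applied to families with a single nonzero entry. For \<open>r \<ge> 2\<close> such a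
  family meets only one of the two terms of equation \<open>k\<close>, so its image contains a column of one
  Kronecker block. For \<open>r = 1\<close> and the conjugate transpose both terms occur, but one of them is linear
  and the other one antilinear. The entries \<open>1\<close> and \<open>\<i>\<close> yield the difference and, up to the
  factor \<open>\<i>\<close>, the sum of the two, and the parallelogram law separates them.
\<close>

lemma kronecker_bounds:
  assumes coeff: "\<And>k. k < r \<Longrightarrow> A k \<in> carrier_mat n n" "\<And>k. k < r \<Longrightarrow> B k \<in> carrier_mat n n"
      "\<And>k. k < r \<Longrightarrow> C k \<in> carrier_mat n n" "\<And>k. k < r \<Longrightarrow> D k \<in> carrier_mat n n"
    and bound: "\<And>X. (\<And>k. k < r \<Longrightarrow> X k \<in> carrier_mat n n) \<Longrightarrow>
      family_norm r n (sylv_op st r A B C D X) \<le> \<mu> * family_norm r n X"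
    and \<mu>: "0 \<le> \<mu>" and st: "st = Transp \<Longrightarrow> 2 \<le> r" and k: "k < r"
  shows "kronecker_bound n (A k) (B k) \<mu> \<and> kronecker_bound n (C k) (D k) \<mu>"
proof -
  let ?Q = "{..<n} \<times> {..<n}"
  let ?U = "single_family n"
  have car: "?U l s t \<omega> k \<in> carrier_mat n n" for l s t \<omega> k by (simp add: single_family_def)
  have ent: "?U l s t \<omega> k $$ (i, j) = (if k = l \<and> i = s \<and> j = t then \<omega> else 0)"
    if "i < n" "j < n" for l s t \<omega> k i j using that by (simp add: single_family_def)
  have main: "(\<Sum>(i, j)\<in>?Q. (norm (sylv_op st r A B C D (?U l s t \<omega>) k $$ (i, j)))\<^sup>2) \<le> \<mu>\<^sup>2"
    if "norm \<omega> = 1" for l s t \<omega>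
  proof -
    have "family_norm r n (sylv_op st r A B C D (?U l s t \<omega>)) \<le> \<mu> * family_norm r n (?U l s t \<omega>)"
      by (rule bound[OF car])
    also have "\<dots> \<le> \<mu> * 1" using single_family_norm[OF that] \<mu> by (intro mult_left_mono) auto
    finally have "(family_norm r n (sylv_op st r A B C D (?U l s t \<omega>)))\<^sup>2 \<le> \<mu>\<^sup>2"
      by (intro power_mono) (auto simp: family_norm_nonneg)
    then show ?thesis using family_norm_member[OF k] order_trans by blast
  qed
  have op: "sylv_op st r A B C D (?U l s t \<omega>) k $$ (i, j)
      = sylv_entry n (A k) (?U l s t \<omega> k) (B k) i j - sylv_entry n (C k) (next_mat st r (?U l s t
          \<omega>) k) (D k) i j"
    if "i < n" "j < n" for l s t \<omega> i j
    using sylv_op_entry(2)[where A = A and B = B and C = C and D = D and X = "?U l s t \<omega>", OF coeff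
        car k that] by simp
  have nxt: "next_mat st r (?U l s t \<omega>) k $$ (i, j) = (if Suc k = r then
      (case st of Transp \<Rightarrow> ?U l s t \<omega> 0 $$ (j, i) | ConjTransp \<Rightarrow> cnj (?U l s t \<omega> 0 $$ (j, i)))
      else ?U l s t \<omega> (Suc k) $$ (i, j))" if "i < n" "j < n" for l s t \<omega> i j
    by (rule next_mat_entry[where X = "?U l s t \<omega>", OF car that])
  show ?thesis
  proof (cases "2 \<le> r")
    case True
    have A: "kronecker_bound n (A k) (B k) \<mu>" unfolding kronecker_bound_def
    proof (intro allI impI)
      fix s t assume st': "s < n" "t < n"
      have "next_mat st r (?U k s t 1) k $$ (i, j) = 0" if "i < n" "j < n" for i j
        unfolding nxt[OF that] using True k that by (cases st) (auto simp: ent)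
      then have "sylv_op st r A B C D (?U k s t 1) k $$ (i, j) = A k $$ (i, s) * B k $$ (t, j)"
        if "i < n" "j < n" for i j
        unfolding op[OF that] using sylv_entry_zero[of n "next_mat st r (?U k s t 1) k"]
          sylv_entry_single[of n "?U k s t 1 k" s t 1] st' by (simp add: ent)
      then have "(\<Sum>(i, j)\<in>?Q. (norm (A k $$ (i, s)) * norm (B k $$ (t, j)))\<^sup>2)
          = (\<Sum>(i, j)\<in>?Q. (norm (sylv_op st r A B C D (?U k s t 1) k $$ (i, j)))\<^sup>2)"
        by (intro sum.cong) (auto simp: norm_mult)
      then show "(\<Sum>(i, j)\<in>?Q. (norm (A k $$ (i, s)) * norm (B k $$ (t, j)))\<^sup>2) \<le> \<mu>\<^sup>2"
        using main[of 1] by simp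
    qed
    have C: "kronecker_bound n (C k) (D k) \<mu>" unfolding kronecker_bound_def
    proof (intro allI impI)
      fix s t assume st': "s < n" "t < n"
      define U where "U = (if Suc k = r then ?U 0 t s 1 else ?U (Suc k) s t 1)"
      have U0: "U k $$ (i, j) = 0" if "i < n" "j < n" for i j
        using True k that by (auto simp: U_def ent)
      have U1: "next_mat st r U k $$ (i, j) = (if i = s \<and> j = t then 1 else 0)" if "i < n" "j < n" for i j
        using that by (auto simp: U_def nxt ent split: star.split)
      have "sylv_op st r A B C D U k $$ (i, j) = - (C k $$ (i, s) * D k $$ (t, j))"
        if "i < n" "j < n" for i j
      proof -
        have "sylv_op st r A B C D U k $$ (i, j)
          = sylv_entry n (A k) (U k) (B k) i j - sylv_entry n (C k) (next_mat st r U k) (D k) i j"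
          using op[OF that] by (simp add: U_def)
        then show ?thesis using sylv_entry_zero[of n "U k"] U0
          sylv_entry_single[of n "next_mat st r U k" s t 1] U1 st' by simp
      qed
      then have "(\<Sum>(i, j)\<in>?Q. (norm (C k $$ (i, s)) * norm (D k $$ (t, j)))\<^sup>2)
          = (\<Sum>(i, j)\<in>?Q. (norm (sylv_op st r A B C D U k $$ (i, j)))\<^sup>2)"
        by (intro sum.cong) (auto simp: norm_mult)
      then show "(\<Sum>(i, j)\<in>?Q. (norm (C k $$ (i, s)) * norm (D k $$ (t, j)))\<^sup>2) \<le> \<mu>\<^sup>2"
        using main[of 1] by (simp add: U_def)
    qed
    from A C show ?thesis ..
  next
    case False
    then have r1: "r = 1" "k = 0" using k by auto
    then have H: "st = ConjTransp" using st by (cases st) auto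
    have both: "(\<Sum>(i, j)\<in>?Q. (norm (A k $$ (i, s)) * norm (B k $$ (t, j)))\<^sup>2)
      + (\<Sum>(i, j)\<in>?Q. (norm (C k $$ (i, t)) * norm (D k $$ (s, j)))\<^sup>2) \<le> \<mu>\<^sup>2"
      if st': "s < n" "t < n" for s t
    proof -
      have val: "sylv_op st r A B C D (?U 0 s t \<omega>) k $$ (i, j)
          = \<omega> * (A k $$ (i, s) * B k $$ (t, j)) - cnj \<omega> * (C k $$ (i, t) * D k $$ (s, j))"
        if "i < n" "j < n" for i j \<omega>
      proof -
        have "next_mat st r (?U 0 s t \<omega>) k $$ (s', t') = (if s' = t \<and> t' = s then cnj \<omega> else 0)"
          if "s' < n" "t' < n" for s' t'
          unfolding nxt[OF that] using that by (auto simp: H r1 ent)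
        then show ?thesis unfolding op[OF that]
          using sylv_entry_single[of n "?U 0 s t \<omega> k" s t \<omega>] st'
            sylv_entry_single[of n "next_mat st r (?U 0 s t \<omega>) k" t s "cnj \<omega>"]
          by (simp add: ent r1)
      qed
      \<comment> \<open>Parallelogram law for the images of the entries \<open>1\<close> and \<open>\<i>\<close>.\<close>
      have par: "(norm (a - c))\<^sup>2 + (norm (\<i> * a + \<i> * c))\<^sup>2 = 2 * (norm a)\<^sup>2 + 2 * (norm c)\<^sup>2" for
          a c :: complex
        by (simp add: cmod_power2) (simp add: power2_eq_square algebra_simps)
      let ?a = "\<lambda>ij. (norm (A k $$ (fst ij, s)) * norm (B k $$ (t, snd ij)))\<^sup>2"
      let ?c = "\<lambda>ij. (norm (C k $$ (fst ij, t)) * norm (D k $$ (s, snd ij)))\<^sup>2"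
      let ?v = "\<lambda>\<omega> ij. (norm (sylv_op st r A B C D (?U 0 s t \<omega>) k $$ ij))\<^sup>2"
      have "(\<Sum>ij\<in>?Q. ?v 1 ij) + (\<Sum>ij\<in>?Q. ?v \<i> ij) = (\<Sum>ij\<in>?Q. 2 * ?a ij + 2 * ?c ij)"
        unfolding sum.distrib[symmetric]
      proof (intro sum.cong refl)
        fix ij assume "ij \<in> ?Q"
        then obtain i j where ij: "ij = (i, j)" "i < n" "j < n" by auto
        show "?v 1 ij + ?v \<i> ij = 2 * ?a ij + 2 * ?c ij"
          unfolding ij(1) val[OF ij(2,3)]
          using par[of "A k $$ (i, s) * B k $$ (t, j)" "C k $$ (i, t) * D k $$ (s, j)"]
          by (simp add: norm_mult)
      qed
      also have "\<dots> = 2 * ((\<Sum>ij\<in>?Q. ?a ij) + (\<Sum>ij\<in>?Q. ?c ij))"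
        by (simp add: sum.distrib sum_distrib_left)
      finally have "2 * ((\<Sum>ij\<in>?Q. ?a ij) + (\<Sum>ij\<in>?Q. ?c ij)) \<le> \<mu>\<^sup>2 + \<mu>\<^sup>2"
        using main[of 1 0 s t] main[of \<i> 0 s t] by (simp add: split_def)
      then show ?thesis by (simp add: split_def)
    qed
    have nn: "0 \<le> (\<Sum>(i, j)\<in>?Q. (norm (F $$ (i, s)) * norm (G $$ (t, j)))\<^sup>2)" for F G :: "complex mat" and s t
      by (auto intro!: sum_nonneg)
    show ?thesis unfolding kronecker_bound_def
    proof (intro conjI allI impI)
      fix s t assume "s < n" "t < n"
      then show "(\<Sum>(i, j)\<in>?Q. (norm (A k $$ (i, s)) * norm (B k $$ (t, j)))\<^sup>2) \<le> \<mu>\<^sup>2"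
        using both[of s t] nn[of "C k" t "D k" s] by linarith
    next
      fix s t assume "s < n" "t < n"
      then show "(\<Sum>(i, j)\<in>?Q. (norm (C k $$ (i, s)) * norm (D k $$ (t, j)))\<^sup>2) \<le> \<mu>\<^sup>2"
        using both[of t s] nn[of "A k" t "B k" s] by linarith
    qed
  qed
qed

section \<open>Backward stability\<close>

lemma gamma_const_ge:
  assumes "0 \<le> c" "0 \<le> u" "c * real k * u < 1"
  shows "c * real k * u \<le> gamma_const c u k"
proof -
  have "0 \<le> c * real k * u" using assms by simp
  then show ?thesis using assms(3) mult_left_le[of "1 - c * real k * u" "c * real k * u"]
    by (simp add: gamma_const_def pos_le_divide_eq)
qed

lemma system_matrix_T_apply:
  assumes coeff: "\<And>k. k < r \<Longrightarrow> A k \<in> carrier_mat n n" "\<And>k. k < r \<Longrightarrow> B k \<in> carrier_mat n n"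
      "\<And>k. k < r \<Longrightarrow> C k \<in> carrier_mat n n" "\<And>k. k < r \<Longrightarrow> D k \<in> carrier_mat n n"
    and X: "\<And>k. k < r \<Longrightarrow> X k \<in> carrier_mat n n"
  shows "system_matrix_T r n A B C D *\<^sub>v vecs r n X = vecs r n (sylv_op Transp r A B C D X)"
proof -
  have "system_matrix_T r n A B C D *\<^sub>v vecs r n X
      = vecs r n (sylv_op Transp r A B C D (unvecs n (vecs r n X)))"
    unfolding system_matrix_T_def
    by (rule matrix_of_mult[OF vecs_carrier
          vecs_sylv_linear[where A = A and B = B and C = C and D = D and r = r and n = n and st =
              Transp, OF coeff]
          vecs_carrier]) auto
  then show ?thesis using sylv_op_unvecs_vecs[where A = A and B = B and C = C and D = D, OF coeff X] by simp
qed

lemma system_matrix_H_apply: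
  assumes coeff: "\<And>k. k < r \<Longrightarrow> A k \<in> carrier_mat n n" "\<And>k. k < r \<Longrightarrow> B k \<in> carrier_mat n n"
      "\<And>k. k < r \<Longrightarrow> C k \<in> carrier_mat n n" "\<And>k. k < r \<Longrightarrow> D k \<in> carrier_mat n n"
    and X: "\<And>k. k < r \<Longrightarrow> X k \<in> carrier_mat n n"
  shows "system_matrix_H r n A B C D *\<^sub>v realify (vecs r n X) = realify (vecs r n (sylv_op
      ConjTransp r A B C D X))"
proof -
  let ?f = "\<lambda>x. realify (vecs r n (sylv_op ConjTransp r A B C D (unvecs n (complexify x))))"
  have N: "2 * r * n\<^sup>2 = 2 * (r * n\<^sup>2)" by simp
  have lin: "?f (x + a \<cdot>\<^sub>v y) = ?f x + a \<cdot>\<^sub>v ?f y"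
    if "x \<in> carrier_vec (2 * (r * n\<^sup>2))" "y \<in> carrier_vec (2 * (r * n\<^sup>2))" for x y a
    unfolding complexify_linear[OF that]
    using vecs_sylv_linear[where A = A and B = B and C = C and D = D and r = r and n = n and st =
        ConjTransp and a = "of_real a", OF coeff complexify_carrier[OF that(1)]
        complexify_carrier[OF that(2)]]
    by (simp add: realify_linear[OF vecs_carrier vecs_carrier])
  have "system_matrix_H r n A B C D *\<^sub>v realify (vecs r n X) = ?f (realify (vecs r n X))"
    unfolding system_matrix_H_def N
    by (rule matrix_of_mult[OF _ lin]) (auto intro!: realify_carrier vecs_carrier)
  then show ?thesis using sylv_op_unvecs_vecs[where A = A and B = B and C = C and D = D, OF coeff
      X] by (simp add: complexify_realify)
qed

lemma residual_vec:
  assumes "\<And>k. k < r \<Longrightarrow> E k \<in> carrier_mat n n" "\<And>k. k < r \<Longrightarrow> S k \<in> carrier_mat n n"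
  shows "vec_norm2 (vecs r n E - vecs r n S)
    = L2_set (\<lambda>k. L2_set (\<lambda>(i, j). norm (E k $$ (i, j) - S k $$ (i, j))) ({..<n} \<times> {..<n})) {..<r}"
proof -
  have "vecs r n E - vecs r n S = vecs r n (\<lambda>k. mat n n (\<lambda>(i, j). E k $$ (i, j) - S k $$ (i, j)))"
  proof (rule eq_vecI)
    fix p assume "p < dim_vec (vecs r n (\<lambda>k. mat n n (\<lambda>(i, j). E k $$ (i, j) - S k $$ (i, j))))"
    then have p: "p < r * n\<^sup>2" by (simp add: vecs_def)
    then have n: "0 < n" by (cases n) auto
    have "p mod n < n" "p mod n\<^sup>2 div n < n"
      using n by (auto simp: div_less_iff_less_mult power2_eq_square)
    then show "(vecs r n E - vecs r n S) $ p = vecs r n (\<lambda>k. mat n n (\<lambda>(i, j). E k $$ (i, j) - S k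
        $$ (i, j))) $ p"
      using p by (simp add: vecs_def)
  qed (simp add: vecs_def)
  then show ?thesis unfolding vec_norm2_vecs family_norm_def
    by (auto intro!: L2_set_cong simp: vec_norm2_vecs family_norm_def)
qed

theorem theorem24:
  fixes \<kappa> :: real
  assumes "1 \<le> \<kappa>"
  shows "\<exists>c>0. \<forall>(st::star) (r::nat) (n::nat) (u::real) A B C D E Xt.
    0 < r \<longrightarrow> 0 < n \<longrightarrow> (st = Transp \<longrightarrow> 2 \<le> r) \<longrightarrow>
    (\<forall>k<r. A k \<in> carrier_mat n n \<and> B k \<in> carrier_mat n n \<and> C k \<in> carrier_mat n n \<and>
       D k \<in> carrier_mat n n \<and> E k \<in> carrier_mat n n) \<longrightarrow>
    (\<forall>k<r. upper_triangular (A k) \<and> upper_triangular (C k) \<and>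
       upper_triangular (transpose_mat (B k)) \<and> upper_triangular (transpose_mat (D k))) \<longrightarrow>
    nonsingular_system st r n A B C D \<longrightarrow>
    0 \<le> u \<longrightarrow> c * real r * u < 1 \<longrightarrow> c * real (n\<^sup>2) * u < 1 \<longrightarrow>
    fl_block_back_subst st \<kappa> u r n A B C D E Xt \<longrightarrow>
    (let \<gamma> = gamma_const c u;
         \<mu> = real r * \<gamma> r + \<gamma> (n\<^sup>2) * (1 + real r * \<gamma> r);
         \<eta> = \<gamma> (n\<^sup>2)
     in case st of
          Transp \<Rightarrow>
            backward_error_le (system_matrix_T r n A B C D) (vecs r n Xt) (vecs r n E) \<mu> \<eta>
        | ConjTransp \<Rightarrow>
            backward_error_le (system_matrix_H r n A B C D) (realify (vecs r n Xt))
              (realify (vecs r n E)) \<mu> \<eta>)"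
  \<comment> \<open>The constant covers the factor \<open>130000\<close> of the residual bound, and it implies that \<open>r \<epsilon>\<close> and
    \<open>n \<epsilon>\<close> are as small as the error analysis requires.\<close>
proof (intro exI[of _ "130000 * \<kappa>"] conjI allI impI)
  show "0 < 130000 * \<kappa>" using assms by simp
  fix st :: star and r n :: nat and u :: real and A B C D E Xt
  assume r: "0 < r" and n: "0 < n" and st: "st = Transp \<longrightarrow> 2 \<le> r"
    and car: "\<forall>k<r. A k \<in> carrier_mat n n \<and> B k \<in> carrier_mat n n \<and> C k \<in> carrier_mat n n \<and>
       D k \<in> carrier_mat n n \<and> E k \<in> carrier_mat n n"
    and tri: "\<forall>k<r. upper_triangular (A k) \<and> upper_triangular (C k) \<and>
       upper_triangular (transpose_mat (B k)) \<and> upper_triangular (transpose_mat (D k))"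
    and u: "0 \<le> u" and cr: "130000 * \<kappa> * real r * u < 1" and cn: "130000 * \<kappa> * real (n\<^sup>2) * u < 1"
    and alg: "fl_block_back_subst st \<kappa> u r n A B C D E Xt"
  define c where "c = 130000 * \<kappa>"
  define \<gamma> where "\<gamma> = gamma_const c u"
  define \<tau> where "\<tau> = real r * \<gamma> r + \<gamma> (n\<^sup>2) * (1 + real r * \<gamma> r)"
  have ku: "0 \<le> \<kappa> * u" using assms u by simp
  have c0: "0 \<le> c" using assms by (simp add: c_def)
  have gr: "c * real r * u \<le> \<gamma> r" "c * real (n\<^sup>2) * u \<le> \<gamma> (n\<^sup>2)"
    unfolding \<gamma>_def using cr cn by (intro gamma_const_ge[OF c0 u]; simp only: c_def)+
  have g0: "0 \<le> \<gamma> r" "0 \<le> \<gamma> (n\<^sup>2)"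
    by (rule order_trans[OF _ gr(1)] order_trans[OF _ gr(2)], use c0 u in simp)+
  have \<tau>0: "0 \<le> \<tau>" using g0 by (simp add: \<tau>_def)
  have \<tau>: "(130000 * (r * sqrt r) + 28 * (real n)\<^sup>2) * (\<kappa> * u) \<le> \<tau>"
  proof -
    have "sqrt r \<le> sqrt ((real r)\<^sup>2)"
      using r by (intro real_sqrt_le_mono) (auto simp: power2_eq_square)
    then have "130000 * (r * sqrt r) \<le> 130000 * (real r * real r)" by (intro mult_left_mono) auto
    then have "(130000 * (r * sqrt r) + 28 * (real n)\<^sup>2) * (\<kappa> * u)
        \<le> (130000 * (real r * real r) + 130000 * (real n)\<^sup>2) * (\<kappa> * u)"
      using ku by (intro mult_right_mono add_mono) auto
    also have "\<dots> = real r * (c * real r * u) + c * real (n\<^sup>2) * u"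
      by (simp add: c_def algebra_simps)
    also have "\<dots> \<le> real r * \<gamma> r + \<gamma> (n\<^sup>2)"
      using gr by (intro add_mono mult_left_mono) auto
    also have "\<dots> \<le> \<tau>" using g0 by (simp add: \<tau>_def algebra_simps)
    finally show ?thesis .
  qed
  have coeff: "\<And>k. k < r \<Longrightarrow> A k \<in> carrier_mat n n" "\<And>k. k < r \<Longrightarrow> B k \<in> carrier_mat n n"
      "\<And>k. k < r \<Longrightarrow> C k \<in> carrier_mat n n" "\<And>k. k < r \<Longrightarrow> D k \<in> carrier_mat n n"
    and E: "\<And>k. k < r \<Longrightarrow> E k \<in> carrier_mat n n" using car by auto
  have tri': "\<And>k i s. k < r \<Longrightarrow> i < n \<Longrightarrow> s < i \<Longrightarrow> A k $$ (i, s) = 0"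
      "\<And>k t j. k < r \<Longrightarrow> j < n \<Longrightarrow> t < j \<Longrightarrow> B k $$ (t, j) = 0"
      "\<And>k i s. k < r \<Longrightarrow> i < n \<Longrightarrow> s < i \<Longrightarrow> C k $$ (i, s) = 0"
      "\<And>k t j. k < r \<Longrightarrow> j < n \<Longrightarrow> t < j \<Longrightarrow> D k $$ (t, j) = 0"
  proof -
    have upper: "F $$ (i, s) = 0" if "upper_triangular F" "F \<in> carrier_mat n n" "i < n" "s < i"
      for F :: "complex mat" and i s
      using that by (auto simp: upper_triangular_def)
    have lower: "F $$ (t, j) = 0" if "upper_triangular (transpose_mat F)" "F \<in> carrier_mat n n" "j
        < n" "t < j"
      for F :: "complex mat" and t j
    proof -
      have "transpose_mat F $$ (j, t) = 0" using that by (intro upper) auto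
      then show ?thesis using that by auto
    qed
    fix k assume "k < r"
    then have k: "upper_triangular (A k)" "upper_triangular (transpose_mat (B k))" "upper_triangular (C k)"
      "upper_triangular (transpose_mat (D k))" using tri by auto
    show "A k $$ (i, s) = 0" if "i < n" "s < i" for i s by (rule upper[OF k(1) coeff(1)[OF \<open>k < r\<close>] that])
    show "B k $$ (t, j) = 0" if "j < n" "t < j" for t j by (rule lower[OF k(2) coeff(2)[OF \<open>k < r\<close>] that])
    show "C k $$ (i, s) = 0" if "i < n" "s < i" for i s by (rule upper[OF k(3) coeff(3)[OF \<open>k < r\<close>] that])
    show "D k $$ (t, j) = 0" if "j < n" "t < j" for t j by (rule lower[OF k(4) coeff(4)[OF \<open>k < r\<close>] that])
  qed
  have small: "2560 * real r * (\<kappa> * u) \<le> 1" "7 * real n * (\<kappa> * u) \<le> 1"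
  proof -
    have "0 \<le> real r * (\<kappa> * u)" using assms u by (intro mult_nonneg_nonneg) auto
    then show "2560 * real r * (\<kappa> * u) \<le> 1" using cr by (simp add: algebra_simps)
    have "real n * (\<kappa> * u) \<le> real (n\<^sup>2) * (\<kappa> * u)"
      by (rule mult_right_mono[OF _ ku]) (use n in \<open>simp add: power2_eq_square\<close>)
    moreover have "0 \<le> real n * (\<kappa> * u)" using mult_nonneg_nonneg[OF of_nat_0_le_iff ku] .
    moreover have "130000 * (real (n\<^sup>2) * (\<kappa> * u)) < 1" using cn by (simp only: mult_ac)
    ultimately show "7 * real n * (\<kappa> * u) \<le> 1" by linarith
  qed
  have st': "st = Transp \<Longrightarrow> 2 \<le> r" using st by simp
  let ?S = "sylv_op st r A B C D"
  have residual: "(\<forall>k<r. Xt k \<in> carrier_mat n n) \<and>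
      vec_norm2 (vecs r n E - vecs r n (?S Xt)) \<le> \<tau> * \<mu> * family_norm r n Xt"
    if \<mu>: "0 \<le> \<mu>" and bound: "\<And>X. (\<And>k. k < r \<Longrightarrow> X k \<in> carrier_mat n n) \<Longrightarrow>
      family_norm r n (?S X) \<le> \<mu> * family_norm r n X" for \<mu>
  proof -
    have kb: "kronecker_bound n (A k) (B k) \<mu> \<and> kronecker_bound n (C k) (D k) \<mu>" if k: "k < r" for k
    proof (rule kronecker_bounds[OF coeff _ \<mu> st' k])
      fix X :: "nat \<Rightarrow> complex mat" assume "\<And>k. k < r \<Longrightarrow> X k \<in> carrier_mat n n"
      then show "family_norm r n (?S X) \<le> \<mu> * family_norm r n X" by (rule bound)
    qed
    note ar = algorithm_residual[where st = st and A = A and B = B and C = C and D = D and r = r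
        and n = n and E = E and X = Xt, OF alg r st' n u assms small tri' conjunct1[OF kb] conjunct2[OF kb] \<mu>]
    have Xc: "\<And>k. k < r \<Longrightarrow> Xt k \<in> carrier_mat n n" using ar(1) by simp
    have "vec_norm2 (vecs r n E - vecs r n (?S Xt))
      = L2_set (\<lambda>k. L2_set (\<lambda>(i, j). norm (E k $$ (i, j) - ?S Xt k $$ (i, j))) ({..<n} \<times> {..<n})) {..<r}"
      by (rule residual_vec[OF E sylv_op_entry(1)[where A = A and B = B and C = C and D = D and r =
          r and n = n, OF coeff Xc]])
    also have "\<dots> = L2_set (\<lambda>k. L2_set (\<lambda>(i, j). norm (sylv_residual st r n A B C D E Xt k i j))
        ({..<n} \<times> {..<n})) {..<r}"
      by (intro L2_set_cong refl)
        (auto simp only: sylv_residual_def mem_Sigma_iff lessThan_iff prod.case split_paired_all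
          sylv_op_entry(2)[where A = A and B = B and C = C and D = D and r = r and n = n, OF coeff Xc])
    also have "\<dots> \<le> (130000 * (r * sqrt r) + 28 * (real n)\<^sup>2) * (\<kappa> * u) * \<mu> * family_norm r n Xt" by
        (rule ar(2))
    also have "\<dots> \<le> \<tau> * \<mu> * family_norm r n Xt"
      using \<tau> \<mu> family_norm_nonneg by (intro mult_right_mono) auto
    finally show ?thesis using ar(1) by simp
  qed
  show "let \<gamma> = gamma_const (130000 * \<kappa>) u;
         \<mu> = real r * \<gamma> r + \<gamma> (n\<^sup>2) * (1 + real r * \<gamma> r);
         \<eta> = \<gamma> (n\<^sup>2)
     in case st of
          Transp \<Rightarrow>
            backward_error_le (system_matrix_T r n A B C D) (vecs r n Xt) (vecs r n E) \<mu> \<eta>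
        | ConjTransp \<Rightarrow>
            backward_error_le (system_matrix_H r n A B C D) (realify (vecs r n Xt))
              (realify (vecs r n E)) \<mu> \<eta>"
  proof (cases st)
    case Transp
    let ?M = "system_matrix_T r n A B C D"
    have M: "?M \<in> carrier_mat (r * n\<^sup>2) (r * n\<^sup>2)" by (simp add: system_matrix_T_def matrix_of_def)
    have res: "(\<forall>k<r. Xt k \<in> carrier_mat n n) \<and>
      vec_norm2 (vecs r n E - vecs r n (?S Xt)) \<le> \<tau> * mat_norm2 ?M * family_norm r n Xt"
    proof (rule residual[OF mat_norm2_nonneg])
      fix X :: "nat \<Rightarrow> complex mat" assume X: "\<And>k. k < r \<Longrightarrow> X k \<in> carrier_mat n n"
      have apply_X: "?M *\<^sub>v vecs r n X = vecs r n (sylv_op Transp r A B C D X)"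
        by (rule system_matrix_T_apply[OF coeff X])
      show "family_norm r n (?S X) \<le> mat_norm2 ?M * family_norm r n X"
        using mat_norm2_bound[OF M vecs_carrier, of X]
        unfolding apply_X vec_norm2_vecs Transp .
    qed
    then have Xc: "\<And>k. k < r \<Longrightarrow> Xt k \<in> carrier_mat n n" by simp
    have apply_Xt: "?M *\<^sub>v vecs r n Xt = vecs r n (sylv_op Transp r A B C D Xt)"
      by (rule system_matrix_T_apply[OF coeff Xc])
    have "backward_error_le ?M (vecs r n Xt) (vecs r n E) \<tau> (\<gamma> (n\<^sup>2))"
    proof (rule backward_error_of_residual[OF complex_conj M vecs_carrier vecs_carrier _ \<tau>0 g0(2)])
      show "vec_norm2 (vecs r n E - ?M *\<^sub>v vecs r n Xt) \<le> \<tau> * mat_norm2 ?M * vec_norm2 (vecs r n Xt)"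
        unfolding apply_Xt vec_norm2_vecs using res unfolding Transp by blast
    qed
    then show ?thesis unfolding Let_def Transp star.case \<tau>_def \<gamma>_def c_def .
  next
    case ConjTransp
    let ?M = "system_matrix_H r n A B C D"
    have M: "?M \<in> carrier_mat (2 * (r * n\<^sup>2)) (2 * (r * n\<^sup>2))"
      unfolding system_matrix_H_def matrix_of_def mult.assoc by (rule mat_carrier)
    note rc = realify_carrier[OF vecs_carrier]
    have res: "(\<forall>k<r. Xt k \<in> carrier_mat n n) \<and>
      vec_norm2 (vecs r n E - vecs r n (?S Xt)) \<le> \<tau> * mat_norm2 ?M * family_norm r n Xt"
    proof (rule residual[OF mat_norm2_nonneg])
      fix X :: "nat \<Rightarrow> complex mat" assume X: "\<And>k. k < r \<Longrightarrow> X k \<in> carrier_mat n n"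
      have apply_X: "?M *\<^sub>v realify (vecs r n X) = realify (vecs r n (sylv_op ConjTransp r A B C D X))"
        by (rule system_matrix_H_apply[OF coeff X])
      show "family_norm r n (?S X) \<le> mat_norm2 ?M * family_norm r n X"
        using mat_norm2_bound[OF M rc, of X]
        unfolding apply_X vec_norm2_realify vec_norm2_vecs ConjTransp .
    qed
    then have Xc: "\<And>k. k < r \<Longrightarrow> Xt k \<in> carrier_mat n n" by simp
    have apply_Xt: "?M *\<^sub>v realify (vecs r n Xt) = realify (vecs r n (sylv_op ConjTransp r A B C D Xt))"
      by (rule system_matrix_H_apply[OF coeff Xc])
    have "backward_error_le ?M (realify (vecs r n Xt)) (realify (vecs r n E)) \<tau> (\<gamma> (n\<^sup>2))"
    proof (rule backward_error_of_residual[OF real_conj M rc rc _ \<tau>0 g0(2)])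
      have "realify (vecs r n E) - realify (vecs r n (?S Xt)) = realify (vecs r n E - vecs r n (?S Xt))"
        by (intro eq_vecI) (auto simp: realify_def vecs_def)
      then show "vec_norm2 (realify (vecs r n E) - ?M *\<^sub>v realify (vecs r n Xt))
          \<le> \<tau> * mat_norm2 ?M * vec_norm2 (realify (vecs r n Xt))"
        unfolding apply_Xt
          vec_norm2_realify vec_norm2_vecs ConjTransp
        using res unfolding ConjTransp by (simp only: vec_norm2_realify)
    qed
    then show ?thesis unfolding Let_def ConjTransp star.case \<tau>_def \<gamma>_def c_def .
  qed
qed

end
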